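(* Let $r \ge 3$. There exists $t_0 = t_0(r)$ such that for every integer $t \ge t_0$ and every integer $m$ with $\binom{t-1}{r} \le m \le \binom{t}{r} - \binom{t-2}{r-2}$, every $r$-graph $G$ with $m$ edges satisfies \[ \lambda(G) \le \lambda(\mathcal{C}(m,r)). \]
   Context: An $r$-graph is a finite family $G$ of $r$-element subsets of $\mathbb{N}=\{1,2,\dots\}$ (its edges). A weighting of $\mathbb{N}$ is a function $w:\mathbb{N}\to[0,\infty)$ with $\sum_{x}w(x)=1$; for a set $e$ put $w(e)=\prod_{x\in e}w(x)$ and $w(G)=\sum_{e\in G}w(e)$. The Lagrangian of $G$ is $\lambda(G)=\max\{w(G): w \text{ a weighting of } \mathbb{N}\}$. The colexicographic (colex) order on $\mathbb{N}^{(r)}$ (the $r$-subsets of $\mathbb{N}$) is given by $A<B$ iff $\sum_{i\in A}2^i<\sum_{i\in B}2^i$; $\mathcal{C}(m,r)$ denotes the $r$-graph consisting of the first $m$ sets of $\mathbb{N}^{(r)}$ in colex order. *)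

theory Defs
  imports "HOL-Analysis.Analysis"
begin

definition r_graph :: "nat \<Rightarrow> nat set set \<Rightarrow> bool" where
  "r_graph r G \<longleftrightarrow> finite G \<and> (\<forall>e\<in>G. e \<subseteq> {1..} \<and> finite e \<and> card e = r)"

definition weighting :: "(nat \<Rightarrow> real) \<Rightarrow> bool" where
  "weighting w \<longleftrightarrow> (\<forall>x\<ge>1. w x \<ge> 0) \<and> (w has_sum 1) {1..}"

definition weight_edge :: "(nat \<Rightarrow> real) \<Rightarrow> nat set \<Rightarrow> real" where
  "weight_edge w e = (\<Prod>x\<in>e. w x)"

definition weight_graph :: "(nat \<Rightarrow> real) \<Rightarrow> nat set set \<Rightarrow> real" where
  "weight_graph w G = (\<Sum>e\<in>G. weight_edge w e)"

definition lagrangian :: "nat set set \<Rightarrow> real" where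
  "lagrangian G = Sup {weight_graph w G | w. weighting w}"

definition colex_val :: "nat set \<Rightarrow> nat" where
  "colex_val A = (\<Sum>i\<in>A. 2 ^ i)"

definition colex_less :: "nat set \<Rightarrow> nat set \<Rightarrow> bool" where
  "colex_less A B \<longleftrightarrow> colex_val A < colex_val B"

definition r_sets :: "nat \<Rightarrow> nat set set" where
  "r_sets r = {A. A \<subseteq> {1..} \<and> finite A \<and> card A = r}"

definition colex_graph :: "nat \<Rightarrow> nat \<Rightarrow> nat set set" where
  "colex_graph m r = {A \<in> r_sets r. card {B \<in> r_sets r. colex_less B A} < m}"

end

theory Submission
  imports Defs
begin

text \<open>
  Put \<open>T = t - 1\<close>. Since \<open>m \<ge> T choose r\<close>, the colex graph contains the clique on \<open>T\<close> vertices, so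
  it suffices to bound the weight of \<open>G\<close> by that of the clique. Suppose an optimal weighting of \<open>G\<close>,
  rescaled to a function \<open>x\<close> of total weight \<open>T\<close> on its support \<open>V\<close>, does better. By the Lagrange
  conditions every link is heavy; together with Cauchy-Schwarz this forces \<open>x \<le> 1 + O(1/T)\<close>. If
  \<open>x i\<close> is viewed as the probability that the vertex \<open>i\<close> survives, summing over the edges the
  probability that at most one vertex fails gives \<open>card V \<le> T + 1\<close>, with equality by Maclaurin.

  Now \<open>G\<close> misses at least \<open>N = (T - 1) choose (r - 2)\<close> of the \<open>r\<close>-subsets of \<open>V\<close>, exactly as many as
  contain a given pair \<open>u, v\<close>. Exchanging the missing sets for those through \<open>u, v\<close> turns \<open>u, v\<close> into
  twins, which can be merged into one vertex of a \<open>T\<close>-clique. The merged weighting loses a multiple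
  of its squared deviation from the uniform one. With \<open>u, v\<close> the two lightest vertices, this loss
  shows that all vertices but \<open>u\<close> have weight close to 1 and that \<open>x u\<close> is close to 0. With \<open>v\<close> then
  chosen to have the largest codegree with \<open>u\<close> among the missing sets, the loss outweighs the gain of
  the exchange by an inequality on sums of squared degrees.
\<close>

section \<open>Elementary symmetric sums\<close>

text \<open>At the largest admissible \<open>m\<close> the colex graph consists of all
  \<open>r\<close>-subsets of \<open>T + 1\<close> points that do not contain one fixed pair. The
  pair are twins, and merging them gives the \<open>T\<close>-clique, so the Lagrangian is still
  that of the clique. This is the graph with which the exchange compares \<open>G\<close>. The
  obstacle is that gain and loss are both quadratic in \<open>x u\<close> and the deviations from 1,
  so a soft estimate cannot decide between them. After completing squares the question is whether
  \<open>c^2\<close> plus a sum of squared degrees is at most \<open>4 * \<kappa> * c\<close>, where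
  \<open>c\<close> is the number of exchanged sets and \<kappa> is close to \<open>N / 2\<close>;
  double counting alone bounds the left side by about \<open>2 * N * c\<close>. Hence the weights
  are first brought close to 1, which makes the stability constant sharp, and \<open>v\<close> is
  then chosen anew: its maximal codegree wins a margin of order \<open>1 / r\<close>. The tolerances
  are fixed backwards from this margin, first \<open>1 / (32 * r^2)\<close> for the weights, then
  \<rho>, \<open>p\<close> and the threshold for \<open>T\<close>.\<close>

definition ksub :: "nat \<Rightarrow> 'a set \<Rightarrow> 'a set set" where
  "ksub k V = {e. e \<subseteq> V \<and> card e = k}"

definition esym :: "nat \<Rightarrow> 'a set \<Rightarrow> ('a \<Rightarrow> real) \<Rightarrow> real" where
  "esym k V x = (\<Sum>e\<in>ksub k V. prod x e)"

lemma finite_ksub [simp]: "finite V \<Longrightarrow> finite (ksub k V)"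
  by (simp add: ksub_def)

lemma card_ksub: "finite V \<Longrightarrow> card (ksub k V) = card V choose k"
  by (simp add: ksub_def n_subsets)

lemma ksubD: "e \<in> ksub k V \<Longrightarrow> e \<subseteq> V" "e \<in> ksub k V \<Longrightarrow> card e = k"
  by (auto simp: ksub_def)

lemma ksub_0: "finite V \<Longrightarrow> ksub 0 V = {{}}"
  by (auto simp: ksub_def dest: finite_subset)

lemma esym_0 [simp]: "finite V \<Longrightarrow> esym 0 V x = 1"
  by (simp add: esym_def ksub_0)

lemma ksub_containing:
  assumes "finite V" "i \<in> V"
  shows "{e \<in> ksub (Suc k) V. i \<in> e} = insert i ` ksub k (V - {i})"
proof (intro set_eqI iffI)
  fix e assume e: "e \<in> {e \<in> ksub (Suc k) V. i \<in> e}"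
  then have "finite e" using assms finite_subset by (auto simp: ksub_def)
  with e have "e - {i} \<in> ksub k (V - {i})" "e = insert i (e - {i})"
    by (auto simp: ksub_def)
  then show "e \<in> insert i ` ksub k (V - {i})" by blast
next
  fix e assume "e \<in> insert i ` ksub k (V - {i})"
  then obtain f where f: "f \<in> ksub k (V - {i})" "e = insert i f" by blast
  then have "finite f" using assms finite_subset by (auto simp: ksub_def)
  with f assms show "e \<in> {e \<in> ksub (Suc k) V. i \<in> e}"
    by (auto simp: ksub_def card_insert_if)
qed

lemma inj_on_insert_ksub: "inj_on (insert i) (ksub k (V - {i}))"
proof (rule inj_onI)
  fix e f assume "e \<in> ksub k (V - {i})" "f \<in> ksub k (V - {i})" "insert i e = insert i f"
  then show "e = f" by (metis DiffE insertI1 insert_ident ksubD(1) subsetD)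
qed

lemma sum_ksub_containing:
  assumes "finite V" "i \<in> V"
  shows "(\<Sum>e\<in>{e \<in> ksub (Suc k) V. i \<in> e}. f e) = (\<Sum>e\<in>ksub k (V - {i}). f (insert i e))"
  using assms by (simp add: ksub_containing sum.reindex inj_on_insert_ksub)

lemma sum_prod_containing:
  assumes "finite V" "i \<in> V"
  shows "(\<Sum>e\<in>{e \<in> ksub (Suc k) V. i \<in> e}. prod x e) = x i * esym k (V - {i}) x"
proof -
  have "prod x (insert i e) = x i * prod x e" if "e \<in> ksub k (V - {i})" for e
  proof -
    have "finite e" "i \<notin> e" using that assms finite_subset by (auto simp: ksub_def)
    then show ?thesis by simp
  qed
  then show ?thesis
    by (simp add: sum_ksub_containing[OF assms] esym_def sum_distrib_left)
qed

lemma esym_split: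
  assumes "finite V" "i \<in> V"
  shows "esym (Suc k) V x = esym (Suc k) (V - {i}) x + x i * esym k (V - {i}) x"
proof -
  have "ksub (Suc k) V = ksub (Suc k) (V - {i}) \<union> {e \<in> ksub (Suc k) V. i \<in> e}"
    by (auto simp: ksub_def)
  moreover have "ksub (Suc k) (V - {i}) \<inter> {e \<in> ksub (Suc k) V. i \<in> e} = {}"
    by (auto simp: ksub_def)
  ultimately have "esym (Suc k) V x = esym (Suc k) (V - {i}) x
      + (\<Sum>e\<in>{e \<in> ksub (Suc k) V. i \<in> e}. prod x e)"
    unfolding esym_def using assms
    by (metis (no_types, lifting) finite_Un finite_ksub sum.union_disjoint)
  then show ?thesis by (simp add: sum_prod_containing[OF assms])
qed

lemma esym_nonneg: "(\<And>i. i \<in> V \<Longrightarrow> 0 \<le> x i) \<Longrightarrow> 0 \<le> esym k V x"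
  unfolding esym_def by (intro sum_nonneg prod_nonneg) (auto simp: ksub_def)

text \<open>Double counting of incidences. The map \<open>B\<close> allows an edge to be counted
  through a part of it, such as the edge without a fixed pair of vertices.\<close>

lemma sum_over_members:
  fixes f :: "'a \<Rightarrow> 'b \<Rightarrow> real"
  assumes "finite F" "finite V" "\<And>e. e \<in> F \<Longrightarrow> B e \<subseteq> V"
  shows "(\<Sum>e\<in>F. \<Sum>i\<in>B e. f i e) = (\<Sum>i\<in>V. \<Sum>e\<in>{e\<in>F. i \<in> B e}. f i e)"
proof -
  have "(\<Sum>e\<in>F. \<Sum>i\<in>B e. f i e) = (\<Sum>e\<in>F. \<Sum>i\<in>{i\<in>V. i \<in> B e}. f i e)"
    by (intro sum.cong refl) (use assms(3) in auto)
  also have "\<dots> = (\<Sum>i\<in>V. \<Sum>e\<in>{e\<in>F. i \<in> B e}. f i e)"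
    by (rule sum.swap_restrict[OF assms(1,2)])
  finally show ?thesis .
qed

lemma esym_Suc:
  assumes "finite V"
  shows "real (Suc k) * esym (Suc k) V x = (\<Sum>i\<in>V. x i * esym k (V - {i}) x)"
proof -
  have "real (Suc k) * esym (Suc k) V x = (\<Sum>e\<in>ksub (Suc k) V. \<Sum>i\<in>e. prod x e)"
    by (simp add: esym_def sum_distrib_left ksubD)
  also have "\<dots> = (\<Sum>i\<in>V. \<Sum>e\<in>{e\<in>ksub (Suc k) V. i \<in> e}. prod x e)"
    by (rule sum_over_members) (use assms in \<open>auto simp: ksub_def\<close>)
  also have "\<dots> = (\<Sum>i\<in>V. x i * esym k (V - {i}) x)"
    by (intro sum.cong refl sum_prod_containing assms)
  finally show ?thesis .
qed

lemma esym_1: "finite V \<Longrightarrow> esym (Suc 0) V x = sum x V"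
  using esym_Suc[of V 0 x] by simp

lemma sum_Diff_singleton:
  fixes f :: "'a \<Rightarrow> real"
  shows "finite V \<Longrightarrow> i \<in> V \<Longrightarrow> sum f (V - {i}) = sum f V - f i"
  by (simp add: sum_diff1)

lemma fact_esym_Suc:
  assumes "finite V"
  shows "fact (Suc k) * esym (Suc k) V x = (\<Sum>i\<in>V. x i * (fact k * esym k (V - {i}) x))"
proof -
  have "fact (Suc k) * esym (Suc k) V x = fact k * (real (Suc k) * esym (Suc k) V x)"
    by (simp only: fact_Suc of_nat_mult mult_ac)
  also have "\<dots> = (\<Sum>i\<in>V. x i * (fact k * esym k (V - {i}) x))"
    unfolding esym_Suc[OF assms] sum_distrib_left by (simp add: mult_ac)
  finally show ?thesis .
qed

text \<open>Every squarefree monomial of degree \<open>k\<close> occurs \<open>k!\<close> times in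
  the expansion of the power.\<close>

lemma fact_esym_le_power:
  assumes "finite V" "\<And>i. i \<in> V \<Longrightarrow> 0 \<le> x i"
  shows "fact k * esym k V x \<le> sum x V ^ k"
  using assms
proof (induction k arbitrary: V)
  case (Suc k)
  have "fact (Suc k) * esym (Suc k) V x = (\<Sum>i\<in>V. x i * (fact k * esym k (V - {i}) x))"
    by (rule fact_esym_Suc[OF Suc.prems(1)])
  also have "\<dots> \<le> (\<Sum>i\<in>V. x i * sum x V ^ k)"
  proof (rule sum_mono)
    fix i assume i: "i \<in> V"
    have "fact k * esym k (V - {i}) x \<le> sum x (V - {i}) ^ k"
      by (rule Suc.IH) (use Suc.prems in auto)
    also have "\<dots> \<le> sum x V ^ k"
      using Suc.prems i by (intro power_mono sum_mono2 sum_nonneg) auto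
    finally show "x i * (fact k * esym k (V - {i}) x) \<le> x i * sum x V ^ k"
      using Suc.prems(2)[OF i] by (rule mult_left_mono)
  qed
  also have "\<dots> = sum x V ^ Suc k" by (simp add: sum_distrib_right)
  finally show ?case .
qed simp

text \<open>The binomial expansion truncated after its second-order term; the induction step
  discards a negative cubic term.\<close>

lemma power_diff_le_quadratic:
  fixes U x :: real
  assumes "0 \<le> x" "x \<le> U"
  shows "(U - x) ^ (m + 2) \<le> U ^ (m + 2) - real (m + 2) * x * U ^ (m + 1)
    + real ((m + 2) choose 2) * x\<^sup>2 * U ^ m"
proof (induction m)
  case 0
  then show ?case by (simp add: power2_eq_square algebra_simps choose_two)
next
  case (Suc m)
  have ch: "real ((Suc m + 2) choose 2) = real ((m + 2) choose 2) + real (m + 2)"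
    by (simp add: numeral_2_eq_2)
  have "(U - x) ^ (Suc m + 2) = (U - x) * (U - x) ^ (m + 2)" by simp
  also have "\<dots> \<le> (U - x) * (U ^ (m + 2) - real (m + 2) * x * U ^ (m + 1)
    + real ((m + 2) choose 2) * x\<^sup>2 * U ^ m)"
    by (rule mult_left_mono[OF Suc]) (use assms in simp)
  also have "\<dots> = U ^ (Suc m + 2) - real (Suc m + 2) * x * U ^ (Suc m + 1)
    + real ((Suc m + 2) choose 2) * x\<^sup>2 * U ^ Suc m - real ((m + 2) choose 2) * x ^ 3 * U ^ m"
    unfolding ch by (simp add: algebra_simps power2_eq_square power3_eq_cube)
  also have "\<dots> \<le> U ^ (Suc m + 2) - real (Suc m + 2) * x * U ^ (Suc m + 1)
    + real ((Suc m + 2) choose 2) * x\<^sup>2 * U ^ Suc m"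
    using assms by simp
  finally show ?case .
qed

text \<open>Bernoulli's inequality multiplied by \<open>U\<close>, which avoids both a division and
  the exponent \<open>m - 1\<close>.\<close>

lemma power_diff_ge_linear:
  fixes U x :: real
  assumes "0 \<le> x" "x \<le> U"
  shows "U ^ (m + 1) - real m * x * U ^ m \<le> U * (U - x) ^ m"
proof (induction m)
  case (Suc m)
  have "U ^ (Suc m + 1) - real (Suc m) * x * U ^ Suc m
      \<le> (U - x) * (U ^ (m + 1) - real m * x * U ^ m)"
    using assms by (simp add: algebra_simps)
  also have "\<dots> \<le> (U - x) * (U * (U - x) ^ m)"
    by (rule mult_left_mono[OF Suc]) (use assms in simp)
  finally show ?case by (simp add: algebra_simps)
qed simp

text \<open>A second-order Bonferroni estimate: sampling k vertices independently with probabilities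
  proportional to x, the left-hand side is the normalised probability that they are distinct.\<close>
lemma fact_esym_le:
  assumes "finite V" "\<And>i. i \<in> V \<Longrightarrow> 0 \<le> x i" "\<And>i. i \<in> V \<Longrightarrow> x i \<le> B"
  shows "fact (m + 2) * esym (m + 2) V x \<le> sum x V ^ (m + 2)
    - real ((m + 2) choose 2) * (\<Sum>i\<in>V. (x i)\<^sup>2) * sum x V ^ m
    + real (m + 2) ^ 4 * B\<^sup>2 * sum x V ^ m"
  using assms
proof (induction m arbitrary: V)
  case 0
  have "2 * esym 2 V x = (\<Sum>i\<in>V. x i * (sum x V - x i))"
    using esym_Suc[OF 0(1), of 1 x] 0(1) by (simp add: numeral_2_eq_2 esym_1 sum_Diff_singleton)
  also have "\<dots> = (sum x V)\<^sup>2 - (\<Sum>i\<in>V. (x i)\<^sup>2)"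
    by (simp add: power2_eq_square algebra_simps sum_subtractf sum_distrib_left)
  finally show ?case by (simp add: numeral_2_eq_2)
next
  case (Suc m)
  define U S c where "U = sum x V" and "S = (\<Sum>i\<in>V. (x i)\<^sup>2)" and "c = real ((m + 2) choose 2)"
  define K where "K = real (m + 2) ^ 4 * B\<^sup>2"
  have c0: "0 \<le> c" "K \<ge> 0" by (simp_all add: c_def K_def)
  have U0: "0 \<le> U" unfolding U_def using Suc.prems by (intro sum_nonneg) auto
  have SB: "S \<le> B * U"
    unfolding S_def U_def sum_distrib_left power2_eq_square
    using Suc.prems by (intro sum_mono mult_right_mono) auto
  have S0: "0 \<le> S" by (simp add: S_def sum_nonneg)
  have step: "fact (m + 2) * esym (m + 2) (V - {i}) x
    \<le> U ^ (m + 2) - real (m + 2) * x i * U ^ (m + 1) - c * S * U ^ m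
      + (c * real (m + 2) * B\<^sup>2 + K) * U ^ m" if i: "i \<in> V" for i
  proof -
    have xi: "0 \<le> x i" "x i \<le> B" "x i \<le> U"
      using Suc.prems i unfolding U_def by (auto intro: member_le_sum)
    then have sq: "(x i)\<^sup>2 \<le> B\<^sup>2" by (intro power_mono)
    have B0: "0 \<le> B" using xi by linarith
    have ih: "fact (m + 2) * esym (m + 2) (V - {i}) x
      \<le> (U - x i) ^ (m + 2) - c * (S - (x i)\<^sup>2) * (U - x i) ^ m + K * (U - x i) ^ m"
      using Suc.IH[of "V - {i}"] Suc.prems i
      by (simp add: U_def S_def c_def K_def sum_Diff_singleton)
    have pm: "(U - x i) ^ m \<le> U ^ m" "0 \<le> (U - x i) ^ m" using xi U0 by (auto intro: power_mono)
    \<comment> \<open>The linear loss is \<open>m * x i * S * U^(m-1)\<close>, and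
      \<open>S \<le> B * U\<close> supplies the missing factor \<open>U\<close>. The case
      \<open>U = 0\<close> is separate because the comparison is made after multiplying by
      \<open>U\<close>.\<close>
    have lin: "S * U ^ m - real m * B\<^sup>2 * U ^ m \<le> S * (U - x i) ^ m"
    proof (cases "U = 0")
      case True
      then have "S = 0" using SB S0 by simp
      then show ?thesis by (simp add: True)
    next
      case False
      then have Up: "U > 0" using U0 by simp
      have "S * (U ^ (m+1) - real m * x i * U ^ m) \<le> S * (U * (U - x i) ^ m)"
        by (rule mult_left_mono[OF power_diff_ge_linear]) (use xi S0 in auto)
      moreover have "S * (real m * x i * U ^ m) \<le> (B * U) * (real m * B * U ^ m)"
        using SB xi U0 S0 B0 by (intro mult_mono) auto
      ultimately have "U * (S * U ^ m - real m * B\<^sup>2 * U ^ m) \<le> U * (S * (U - x i) ^ m)"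
        by (simp add: algebra_simps power2_eq_square)
      then show ?thesis using Up by simp
    qed
    have "(x i)\<^sup>2 * (U - x i) ^ m \<le> B\<^sup>2 * U ^ m"
      using sq pm by (intro mult_mono) auto
    with lin have "S * U ^ m - real (m + 1) * B\<^sup>2 * U ^ m \<le> (S - (x i)\<^sup>2) * (U - x i) ^ m"
      by (simp add: algebra_simps)
    then have 1: "c * (S * U ^ m - real (m + 1) * B\<^sup>2 * U ^ m) \<le> c * ((S - (x i)\<^sup>2) * (U - x i) ^ m)"
      using c0 by (intro mult_left_mono) auto
    have 2: "(U - x i) ^ (m + 2) \<le> U ^ (m + 2) - real (m + 2) * x i * U ^ (m + 1) + c * (x i)\<^sup>2 * U ^ m"
      unfolding c_def by (rule power_diff_le_quadratic) (use xi in auto)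
    have 3: "c * ((x i)\<^sup>2 * U ^ m) \<le> c * (B\<^sup>2 * U ^ m)"
      using sq c0 U0 by (intro mult_left_mono mult_right_mono) auto
    have 4: "K * (U - x i) ^ m \<le> K * U ^ m" using c0 pm by (intro mult_left_mono)
    show ?thesis using ih 1 2 3 4 by (simp add: algebra_simps)
  qed
  have "fact (Suc m + 2) * esym (Suc m + 2) V x = (\<Sum>i\<in>V. x i * (fact (m+2) * esym (m+2) (V - {i}) x))"
    using fact_esym_Suc[OF Suc.prems(1), of "m+2" x] by simp
  also have "\<dots> \<le> (\<Sum>i\<in>V. x i * (U ^ (m + 2) - real (m + 2) * x i * U ^ (m + 1) - c * S * U ^ m
      + (c * real (m + 2) * B\<^sup>2 + K) * U ^ m))"
    using Suc.prems by (intro sum_mono mult_left_mono step) auto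
  \<comment> \<open>Weighted by \<open>x i\<close>, the linear term sums to
    \<open>(m + 2) * S * U^(m+1)\<close>. It raises the coefficient of \<open>S\<close> from
    \<open>(m + 2) choose 2\<close> to \<open>(m + 3) choose 2\<close>.\<close>
  also have "\<dots> = U * (U ^ (m + 2) - c * S * U ^ m + (c * real (m + 2) * B\<^sup>2 + K) * U ^ m)
      - real (m + 2) * S * U ^ (m + 1)"
  proof -
    have "x i * (U ^ (m + 2) - real (m + 2) * x i * U ^ (m + 1) - c * S * U ^ m
      + (c * real (m + 2) * B\<^sup>2 + K) * U ^ m)
      = x i * (U ^ (m + 2) - c * S * U ^ m + (c * real (m + 2) * B\<^sup>2 + K) * U ^ m)
       - (real (m + 2) * U ^ (m + 1)) * (x i)\<^sup>2" for i
      by (simp add: algebra_simps power2_eq_square)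
    then show ?thesis
      by (simp add: sum_subtractf flip: sum_distrib_right sum_distrib_left U_def S_def)
  qed
  also have "\<dots> = U ^ (Suc m + 2) - (c + real (m + 2)) * S * U ^ Suc m
      + (c * real (m + 2) * B\<^sup>2 + K) * U ^ Suc m"
    by (simp add: algebra_simps)
  also have "\<dots> \<le> U ^ (Suc m + 2) - (c + real (m + 2)) * S * U ^ Suc m
      + (real (Suc m + 2) ^ 4 * B\<^sup>2) * U ^ Suc m"
  proof -
    have "c \<le> real (m + 2) ^ 2"
    proof -
      have "(m + 2) choose 2 \<le> (m + 2) ^ 2" by (rule binomial_le_pow) simp
      then show ?thesis unfolding c_def by (metis of_nat_le_iff of_nat_power)
    qed
    then have "c * real (m + 2) \<le> real (m + 2) ^ 2 * real (m + 2)" by (intro mult_right_mono) auto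
    also have "\<dots> = real (m + 2) ^ 3" by (simp add: power2_eq_square power3_eq_cube)
    finally have "c * real (m + 2) + real (m + 2) ^ 4 \<le> real (m + 2) ^ 3 + real (m + 2) ^ 4" by simp
    also have "\<dots> \<le> (real (m + 2) + 1) ^ 4"
      by (simp add: power_numeral_reduce algebra_simps)
    finally have "(c * real (m + 2) + real (m + 2) ^ 4) * B\<^sup>2 \<le> real (Suc m + 2) ^ 4 * B\<^sup>2"
      by (intro mult_right_mono) (auto simp: add_ac)
    then have "c * real (m + 2) * B\<^sup>2 + K \<le> real (Suc m + 2) ^ 4 * B\<^sup>2"
      by (simp add: K_def algebra_simps)
    then have "(c * real (m + 2) * B\<^sup>2 + K) * U ^ Suc m \<le> (real (Suc m + 2) ^ 4 * B\<^sup>2) * U ^ Suc m"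
      using U0 by (intro mult_right_mono) auto
    then show ?thesis by simp
  qed
  also have "c + real (m + 2) = real ((Suc m + 2) choose 2)"
    by (simp add: c_def numeral_2_eq_2)
  finally show ?case unfolding U_def S_def .
qed

section \<open>Maclaurin's inequality and its stability\<close>

lemma esym_ge_power:
  assumes "finite V" "0 \<le> \<theta>" "\<And>i. i \<in> V \<Longrightarrow> \<theta> \<le> x i"
  shows "\<theta> ^ k * real (card V choose k) \<le> esym k V x"
proof -
  have "\<theta> ^ k \<le> prod x e" if "e \<in> ksub k V" for e
  proof -
    have "(\<Prod>i\<in>e. \<theta>) \<le> prod x e"
      using assms that by (intro prod_mono) (auto simp: ksub_def)
    then show ?thesis using that by (simp add: ksub_def)
  qed
  then have "(\<Sum>e\<in>ksub k V. \<theta> ^ k) \<le> esym k V x"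
    unfolding esym_def by (rule sum_mono)
  then show ?thesis using assms by (simp add: card_ksub mult.commute)
qed

text \<open>A quantitative Chebyshev sum inequality: the sequences \<open>x i\<close> and
  \<open>x i * esym k (V - {i}) x\<close> are ordered in the same way.\<close>
lemma esym_Suc_Suc_le:
  assumes fin: "finite V"
    and F: "\<And>i j. i \<in> V \<Longrightarrow> j \<in> V \<Longrightarrow> i \<noteq> j \<Longrightarrow> F \<le> esym k (V - {i, j}) x"
  shows "real (card V) * (real (k + 2) * esym (k + 2) V x) \<le>
    (real (card V) - real (k + 1)) * (sum x V * esym (k + 1) V x)
    - F * (real (card V) * (\<Sum>i\<in>V. (x i)\<^sup>2) - (sum x V)\<^sup>2)"
proof -
  define n U S where "n = real (card V)" and "U = sum x V" and "S = (\<Sum>i\<in>V. (x i)\<^sup>2)"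
  define a where "a i = x i * esym k (V - {i}) x" for i
  have suma: "sum a V = real (k + 1) * esym (k + 1) V x"
    using esym_Suc[OF fin, of k x] by (simp add: a_def)
  have "real (k + 2) * esym (k + 2) V x = (\<Sum>i\<in>V. x i * esym (Suc k) (V - {i}) x)"
    using esym_Suc[OF fin, of "Suc k" x] by simp
  also have "\<dots> = (\<Sum>i\<in>V. x i * esym (Suc k) V x - x i * a i)"
    by (intro sum.cong refl) (simp add: esym_split[OF fin] a_def algebra_simps)
  also have "\<dots> = U * esym (k + 1) V x - (\<Sum>i\<in>V. x i * a i)"
    by (simp add: sum_subtractf U_def flip: sum_distrib_right)
  finally have rec: "real (k + 2) * esym (k + 2) V x = U * esym (k + 1) V x - (\<Sum>i\<in>V. x i * a i)" .
  have summand: "F * (x i - x j)\<^sup>2 \<le> (x i - x j) * (a i - a j)" if ij: "i \<in> V" "j \<in> V" for i j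
  proof (cases "i = j")
    case False
    \<comment> \<open>Splitting both links by the other vertex, the terms that contain
      \<open>x i * x j\<close> cancel.\<close>
    have "a i - a j = (x i - x j) * esym k (V - {i, j}) x"
    proof (cases k)
      case 0
      then show ?thesis using fin by (simp add: a_def)
    next
      case (Suc l)
      have "esym k (V - {i}) x = esym k (V - {i, j}) x + x j * esym l (V - {i, j}) x"
        using esym_split[of "V - {i}" j l x] fin ij False by (simp add: Suc Diff_insert2[symmetric] insert_commute)
      moreover have "esym k (V - {j}) x = esym k (V - {i, j}) x + x i * esym l (V - {i, j}) x"
        using esym_split[of "V - {j}" i l x] fin ij False by (simp add: Suc Diff_insert2[symmetric] insert_commute)
      ultimately show ?thesis by (simp add: a_def algebra_simps)
    qed
    then have "(x i - x j) * (a i - a j) = esym k (V - {i, j}) x * (x i - x j)\<^sup>2"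
      by (simp add: power2_eq_square)
    then show ?thesis using F[OF ij False] by (simp add: mult_right_mono)
  qed simp
  have expand: "(\<Sum>i\<in>V. \<Sum>j\<in>V. (x i - x j) * (b i - b j)) = 2 * n * (\<Sum>i\<in>V. x i * b i) - 2 * U * sum b V" for b
  proof -
    have "(\<Sum>i\<in>V. \<Sum>j\<in>V. (x i - x j) * (b i - b j))
      = (\<Sum>i\<in>V. \<Sum>j\<in>V. x i * b i + x j * b j - x i * b j - b i * x j)"
      by (intro sum.cong refl) (simp add: algebra_simps)
    also have "\<dots> = 2 * n * (\<Sum>i\<in>V. x i * b i) - 2 * U * sum b V"
      by (simp add: sum.distrib sum_subtractf n_def U_def algebra_simps flip: sum_distrib_left sum_distrib_right)
        (simp add: sum_distrib_left mult_ac)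
    finally show ?thesis .
  qed
  have "F * (\<Sum>i\<in>V. \<Sum>j\<in>V. (x i - x j)\<^sup>2) \<le> (\<Sum>i\<in>V. \<Sum>j\<in>V. (x i - x j) * (a i - a j))"
    unfolding sum_distrib_left by (intro sum_mono summand)
  moreover have "(\<Sum>i\<in>V. \<Sum>j\<in>V. (x i - x j)\<^sup>2) = 2 * n * S - 2 * U\<^sup>2"
    using expand[of x] by (simp add: power2_eq_square U_def S_def)
  ultimately have "F * (n * S - U\<^sup>2) \<le> n * (\<Sum>i\<in>V. x i * a i) - U * sum a V"
    unfolding expand by (simp add: algebra_simps)
  moreover have "n * (real (k + 2) * esym (k + 2) V x) = n * U * esym (k + 1) V x - n * (\<Sum>i\<in>V. x i * a i)"
    unfolding rec by (simp add: algebra_simps)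
  moreover have "U * sum a V = real (k + 1) * (U * esym (k + 1) V x)"
    unfolding suma by simp
  ultimately show ?thesis
    unfolding n_def[symmetric] U_def[symmetric] S_def[symmetric] by (simp add: algebra_simps)
qed

lemma choose_Suc_real:
  assumes "k \<le> n"
  shows "real (Suc k) * real (n choose Suc k) = (real n - real k) * real (n choose k)"
proof -
  have "Suc k * (n choose Suc k) = (n - k) * (n choose k)"
    by (metis Suc_times_binomial_eq add_diff_cancel_right' binomial_absorb_comp binomial_absorption
        diff_Suc_1 mult.commute)
  then have "real (Suc k * (n choose Suc k)) = real ((n - k) * (n choose k))" by simp
  then show ?thesis by (simp only: of_nat_mult of_nat_diff[OF assms])
qed

text \<open>Maclaurin's inequality, from the Chebyshev bound with \<open>F = 0\<close>. A support of
  \<open>n \<le> T\<close> vertices loses nothing because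
  \<open>(n - k - 1) * T \<le> n * (T - k - 1)\<close>.\<close>

lemma esym_le_choose:
  assumes fin: "finite V" and "V \<noteq> {}" and cV: "card V \<le> T" and U: "sum x V = real T"
    and x0: "\<And>i. i \<in> V \<Longrightarrow> 0 \<le> x i"
  shows "k \<le> T \<Longrightarrow> esym k V x \<le> real (T choose k)"
proof (induction k rule: induct_nat_012)
  case (ge2 k)
  define n where "n = real (card V)"
  have n: "0 < n" "n \<le> real T" using assms by (auto simp: n_def card_gt_0_iff)
  have E: "esym (k + 1) V x \<le> real (T choose (k + 1))" "0 \<le> esym (k + 1) V x"
    using ge2 esym_nonneg[OF x0] by auto
  have "n * (real (k + 2) * esym (k + 2) V x) \<le> (n - real (k + 1)) * (real T * esym (k + 1) V x)"
  proof -
    have "0 \<le> esym k (V - {i, j}) x" for i j by (rule esym_nonneg) (use x0 in auto)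
    then show ?thesis using esym_Suc_Suc_le[OF fin, of 0 k x] by (simp add: U n_def)
  qed
  also have "\<dots> \<le> n * (real T - real (k + 1)) * esym (k + 1) V x"
  proof -
    have "(n - real (k + 1)) * real T \<le> n * (real T - real (k + 1))"
    proof -
      have "n * real (k + 1) \<le> real T * real (k + 1)" using n by (intro mult_right_mono) auto
      then show ?thesis by (simp add: algebra_simps)
    qed
    from mult_right_mono[OF this E(2)] show ?thesis by (simp add: mult.assoc)
  qed
  also have "\<dots> \<le> n * (real T - real (k + 1)) * real (T choose (k + 1))"
    using E n ge2.prems by (intro mult_left_mono mult_nonneg_nonneg) auto
  also have "\<dots> = n * (real (k + 2) * real (T choose (k + 2)))"
    using choose_Suc_real[of "k + 1" T] ge2.prems by simp
  finally show ?case using n by simp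
qed (use fin U in \<open>auto simp: esym_1\<close>)

lemma sum_deviation:
  assumes "finite V" "sum x V = real (card V)"
  shows "(\<Sum>i\<in>V. (x i)\<^sup>2) = real (card V) + (\<Sum>i\<in>V. (x i - 1)\<^sup>2)"
  using assms by (simp add: power2_diff sum.distrib sum_subtractf flip: sum_distrib_left)

text \<open>When the mean is 1, the variance term of the Chebyshev bound is \<open>T\<close> times
  the squared deviation from 1, and the factor \<open>T\<close> cancels.\<close>

lemma esym_Suc_Suc_le_deviation:
  assumes fin: "finite V" and "card V = T" "0 < T" and U: "sum x V = real T"
    and F: "\<And>i j. i \<in> V \<Longrightarrow> j \<in> V \<Longrightarrow> i \<noteq> j \<Longrightarrow> F \<le> esym k (V - {i, j}) x"
  shows "real (k + 2) * esym (k + 2) V x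
    \<le> (real T - real (k + 1)) * esym (k + 1) V x - F * (\<Sum>i\<in>V. (x i - 1)\<^sup>2)"
proof -
  have "real T * (real (k + 2) * esym (k + 2) V x)
    \<le> real T * ((real T - real (k + 1)) * esym (k + 1) V x - F * (\<Sum>i\<in>V. (x i - 1)\<^sup>2))"
    using esym_Suc_Suc_le[OF fin F] sum_deviation[OF fin, of x] assms(2) U
    by (simp add: algebra_simps power2_eq_square)
  then show ?thesis using assms(3) by simp
qed

lemma esym_2_deviation:
  assumes "finite V" "card V = T" "0 < T" "sum x V = real T"
  shows "esym 2 V x \<le> real (T choose 2) - (\<Sum>i\<in>V. (x i - 1)\<^sup>2) / 2"
proof -
  have "2 * esym 2 V x \<le> (real T - 1) * real T - (\<Sum>i\<in>V. (x i - 1)\<^sup>2)"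
    using esym_Suc_Suc_le_deviation[OF assms, of 1 0] assms by (simp add: esym_1 numeral_2_eq_2)
  moreover have "2 * real (T choose 2) = (real T - 1) * real T"
    using choose_Suc_real[of 1 T] assms(3) by (simp add: numeral_2_eq_2)
  ultimately show ?thesis by simp
qed

text \<open>With no positive lower bound on the weights, the deviation term arises only at degree 2
  and is then carried along with \<open>F = 0\<close>. This is why it is divided by
  \<open>(m + 1) * (m + 2)\<close>.\<close>

lemma esym_le_choose_weak_deviation:
  assumes fin: "finite V" and cV: "card V = T" "0 < T" and U: "sum x V = real T"
    and x0: "\<And>i. i \<in> V \<Longrightarrow> 0 \<le> x i"
  shows "m + 2 \<le> T \<Longrightarrow> esym (m + 2) V x \<le> real (T choose (m + 2))
    - real ((T - 2) choose m) / (real (m + 1) * real (m + 2)) * (\<Sum>i\<in>V. (x i - 1)\<^sup>2)"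
proof (induction m)
  case 0
  show ?case using esym_2_deviation[OF fin cV U] by (simp add: numeral_2_eq_2)
next
  case (Suc m)
  define Q where "Q = (\<Sum>i\<in>V. (x i - 1)\<^sup>2)"
  have "real (m + 3) * esym (m + 3) V x \<le> (real T - real (m + 2)) * esym (m + 2) V x"
  proof -
    have "0 \<le> esym (m + 1) (V - {i, j}) x" for i j by (rule esym_nonneg) (use x0 in auto)
    then show ?thesis
      using esym_Suc_Suc_le_deviation[OF fin cV U, of 0 "m + 1"] by (simp add: numeral_3_eq_3)
  qed
  also have "\<dots> \<le> (real T - real (m + 2)) * (real (T choose (m + 2))
    - real ((T - 2) choose m) / (real (m + 1) * real (m + 2)) * Q)"
    using Suc by (intro mult_left_mono) (auto simp: Q_def)
  also have "\<dots> = real (m + 3) * real (T choose (m + 3))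
      - ((real (T - 2) - real m) * real ((T - 2) choose m)) / (real (m + 1) * real (m + 2)) * Q"
    using choose_Suc_real[of "m + 2" T] Suc.prems
    by (simp add: numeral_3_eq_3 right_diff_distrib of_nat_diff mult.assoc)
  also have "\<dots> = real (m + 3) * real (T choose (m + 3)) - real ((T - 2) choose (m + 1)) / real (m + 2) * Q"
  proof -
    have "(real (T - 2) - real m) * real ((T - 2) choose m) = real (m + 1) * real ((T - 2) choose (m + 1))"
      using choose_Suc_real[of m "T - 2"] Suc.prems by simp
    then show ?thesis by simp
  qed
  also have "\<dots> = real (m + 3) * (real (T choose (m + 3))
     - real ((T - 2) choose (m + 1)) / (real (m + 2) * real (m + 3)) * Q)"
    by (simp add: right_diff_distrib)
  finally show ?case by (simp add: Q_def numeral_3_eq_3)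
qed

text \<open>A lower bound \<theta> on the weights makes every induction step contribute a fresh
  deviation term. The old share \<open>(m + 1) / 2\<close> and the new share 1 add up to
  \<open>(m + 3) / 2\<close>, so the constant \<open>1 / 2\<close> persists;
  \<open>no_almost_uniform\<close> depends on its sharpness.\<close>

lemma esym_le_choose_deviation:
  assumes fin: "finite V" and cV: "card V = T" "0 < T" and U: "sum x V = real T"
    and \<theta>: "0 \<le> \<theta>" "\<theta> \<le> 1" and x0: "\<And>i. i \<in> V \<Longrightarrow> \<theta> \<le> x i"
  shows "m + 2 \<le> T \<Longrightarrow> esym (m + 2) V x \<le> real (T choose (m + 2))
    - \<theta> ^ m / 2 * real ((T - 2) choose m) * (\<Sum>i\<in>V. (x i - 1)\<^sup>2)"
proof (induction m)
  case 0
  show ?case using esym_2_deviation[OF fin cV U] by (simp add: numeral_2_eq_2)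
next
  case (Suc m)
  define Q where "Q = (\<Sum>i\<in>V. (x i - 1)\<^sup>2)"
  have Q0: "0 \<le> Q" by (simp add: Q_def sum_nonneg)
  define b c where "b = real ((T - 2) choose m)" and "c = real ((T - 2) choose (m + 1))"
  have bc: "(real T - real (m + 2)) * b = real (m + 1) * c"
    using choose_Suc_real[of m "T - 2"] Suc.prems by (simp add: b_def c_def of_nat_diff)
  have F: "\<theta> ^ (m + 1) * c \<le> esym (m + 1) (V - {i, j}) x" if "i \<in> V" "j \<in> V" "i \<noteq> j" for i j
  proof -
    have "card (V - {i, j}) = T - 2" using that fin cV by (simp add: card_Diff_subset)
    then show ?thesis using esym_ge_power[of "V - {i, j}" \<theta> x "m + 1"] fin \<theta> x0 by (simp add: c_def)
  qed
  have "real (m + 3) * esym (m + 3) V x \<le> (real T - real (m + 2)) * esym (m + 2) V x - \<theta> ^ (m + 1) * c * Q"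
    using esym_Suc_Suc_le_deviation[OF fin cV U F] by (simp add: Q_def numeral_3_eq_3)
  also have "\<dots> \<le> (real T - real (m + 2)) * (real (T choose (m + 2)) - \<theta> ^ m / 2 * b * Q) - \<theta> ^ (m + 1) * c * Q"
    using Suc by (intro diff_right_mono mult_left_mono) (auto simp: Q_def b_def)
  also have "\<dots> = real (m + 3) * real (T choose (m + 3)) - ((real T - real (m + 2)) * b) * \<theta> ^ m / 2 * Q
      - \<theta> ^ (m + 1) * c * Q"
    using choose_Suc_real[of "m + 2" T] Suc.prems by (simp add: numeral_3_eq_3 right_diff_distrib)
  also have "\<dots> = real (m + 3) * real (T choose (m + 3)) - real (m + 1) * c * \<theta> ^ m / 2 * Q - \<theta> ^ (m + 1) * c * Q"
    unfolding bc ..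
  also have "\<dots> \<le> real (m + 3) * real (T choose (m + 3)) - real (m + 1) * c * \<theta> ^ (m + 1) / 2 * Q
      - \<theta> ^ (m + 1) * c * Q"
  proof -
    have "\<theta> ^ (m + 1) \<le> \<theta> ^ m" using \<theta> by (intro power_decreasing) auto
    then have "real (m + 1) * c * Q * \<theta> ^ (m + 1) \<le> real (m + 1) * c * Q * \<theta> ^ m"
      using Q0 by (intro mult_left_mono) (auto simp: c_def)
    then show ?thesis by (simp add: algebra_simps)
  qed
  also have "\<dots> = real (m + 3) * (real (T choose (m + 3)) - \<theta> ^ (m + 1) / 2 * c * Q)"
    by (simp add: algebra_simps)
  finally show ?case by (simp add: Q_def c_def numeral_3_eq_3)
qed

section \<open>Lower bounds for binomial coefficients\<close>

lemma fact_choose_ge_power: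
  "k \<le> n \<Longrightarrow> (real n - real k + 1) ^ k \<le> fact k * real (n choose k)"
proof (induction k)
  case (Suc k)
  have "(real n - real (Suc k) + 1) ^ Suc k = (real n - real k) * (real n - real k) ^ k"
    by simp
  also have "\<dots> \<le> (real n - real k) * (real n - real k + 1) ^ k"
    using Suc.prems by (intro mult_left_mono power_mono) auto
  also have "\<dots> \<le> (real n - real k) * (fact k * real (n choose k))"
    using Suc by (intro mult_left_mono) auto
  also have "\<dots> = fact k * (real (Suc k) * real (n choose Suc k))"
    using choose_Suc_real[of k n] Suc.prems by simp
  finally show ?case by (simp add: mult_ac)
qed simp

text \<open>The falling factorial \<open>n * (n - 1) * ...\<close> with \<open>k\<close> factors
  loses, to first order, the sum of the relative defects \<open>j / n\<close> for
  \<open>j < k\<close>.\<close>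

lemma fact_choose_ge:
  assumes "0 < n"
  shows "k \<le> n \<Longrightarrow> real n ^ k * (1 - real k * (real k - 1) / (2 * real n)) \<le> fact k * real (n choose k)"
proof (induction k)
  case (Suc k)
  have "real n ^ Suc k * (1 - real (Suc k) * (real (Suc k) - 1) / (2 * real n))
    = real n ^ k * (real n - real k - real k * (real k - 1) / 2)"
    using assms by (simp add: field_simps)
  also have "\<dots> \<le> real n ^ k * ((real n - real k) * (1 - real k * (real k - 1) / (2 * real n)))"
  proof (rule mult_left_mono)
    have "0 \<le> real k * (real k * (real k - 1)) / (2 * real n)"
      by (cases k) auto
    moreover have "(real n - real k) * (1 - real k * (real k - 1) / (2 * real n))
      = real n - real k - real k * (real k - 1) / 2 + real k * (real k * (real k - 1)) / (2 * real n)"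
      using assms by (simp add: field_simps)
    ultimately show "real n - real k - real k * (real k - 1) / 2
      \<le> (real n - real k) * (1 - real k * (real k - 1) / (2 * real n))" by linarith
  qed simp
  also have "\<dots> = (real n - real k) * (real n ^ k * (1 - real k * (real k - 1) / (2 * real n)))"
    by simp
  also have "\<dots> \<le> (real n - real k) * (fact k * real (n choose k))"
    using Suc by (intro mult_left_mono) auto
  also have "\<dots> = fact k * (real (Suc k) * real (n choose Suc k))"
    using choose_Suc_real[of k n] Suc.prems by simp
  finally show ?case by (simp add: mult_ac)
qed simp

section \<open>Optimal weightings that beat the clique\<close>

text \<open>The weighting is scaled to have total weight \<open>T\<close>; \<open>crit\<close> is the Lagrange condition at an optimal
  weighting with support \<open>V\<close>.\<close>
locale heavy_weighting =
  fixes r T :: nat and V :: "'a set" and G :: "'a set set" and x :: "'a \<Rightarrow> real"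
  assumes r3: "3 \<le> r" and Tr: "2 * r \<le> T"
    and finV: "finite V" and xpos: "\<And>i. i \<in> V \<Longrightarrow> 0 < x i" and xsum: "sum x V = real T"
    and Gsub: "G \<subseteq> ksub r V"
    and Gcard: "card G \<le> (T choose r) + ((T - 1) choose (r - 1))"
    and heavy: "real (T choose r) < (\<Sum>e\<in>G. prod x e)"
    and crit: "\<And>i. i \<in> V \<Longrightarrow>
      real r * (\<Sum>e\<in>G. prod x e) \<le> real T * (\<Sum>e\<in>{e\<in>G. i \<in> e}. prod x (e - {i}))"
begin

text \<open>\<open>W\<close> is the edge polynomial of \<open>G\<close> at \<open>x\<close> and
  \<open>L i\<close> its partial derivative at \<open>i\<close>. \<open>\<Lambda>\<close> and
  \<open>P\<close> are the values of these two for the \<open>T\<close>-clique with all weights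
  1.\<close>

definition "W = (\<Sum>e\<in>G. prod x e)"
definition "L i = (\<Sum>e\<in>{e\<in>G. i \<in> e}. prod x (e - {i}))"
definition "\<Lambda> = real (T choose r)"
definition "P = real ((T - 1) choose (r - 1))"

lemma Tpos: "0 < real T" "0 < T" "r \<le> T" "0 < real r"
  using r3 Tr by auto

lemma xnonneg: "i \<in> V \<Longrightarrow> 0 \<le> x i"
  using xpos less_imp_le by blast

lemma finG: "finite G"
  using Gsub finV finite_subset finite_ksub by metis

lemma W_gt: "\<Lambda> < W"
  using heavy by (simp add: W_def \<Lambda>_def)

lemma \<Lambda>_pos: "0 < \<Lambda>"
  using Tpos by (simp add: \<Lambda>_def)

lemma W_le_esym: "W \<le> esym r V x"
  unfolding W_def esym_def using Gsub finV
  by (intro sum_mono2 prod_nonneg xnonneg) (auto simp: ksub_def)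

lemma TP: "real T * P = real r * \<Lambda>"
proof -
  have "r * (T choose r) = T * ((T - 1) choose (r - 1))"
    using binomial_absorption[of "r - 1" T] r3 by simp
  then show ?thesis unfolding P_def \<Lambda>_def by (metis of_nat_mult)
qed

lemma P_pos: "0 < P"
  using TP Tpos \<Lambda>_pos by (metis mult_pos_pos zero_less_mult_pos)

lemma cardG: "real (card G) \<le> \<Lambda> + P"
  using Gcard unfolding \<Lambda>_def P_def by (metis of_nat_add of_nat_le_iff)

lemma L_ge: "i \<in> V \<Longrightarrow> real r * W / real T \<le> L i"
  using crit[of i] Tpos by (simp add: W_def L_def field_simps)

lemma L_gt: "i \<in> V \<Longrightarrow> P < L i"
proof -
  assume "i \<in> V"
  then have "real T * P < real T * L i"
    using crit[of i] W_gt Tpos TP unfolding W_def[symmetric] L_def[symmetric]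
    by (smt (verit) mult_strict_left_mono)
  then show ?thesis using Tpos by simp
qed

lemma L_le_esym:
  assumes i: "i \<in> V"
  shows "L i \<le> esym (r - 1) (V - {i}) x"
proof -
  have "L i \<le> (\<Sum>e\<in>{e\<in>ksub (Suc (r - 1)) V. i \<in> e}. prod x (e - {i}))"
    unfolding L_def using Gsub finV r3
    by (intro sum_mono2 prod_nonneg xnonneg) (auto simp: ksub_def)
  also have "\<dots> = (\<Sum>e\<in>ksub (r - 1) (V - {i}). prod x (insert i e - {i}))"
    by (rule sum_ksub_containing[OF finV i])
  also have "\<dots> = esym (r - 1) (V - {i}) x"
    unfolding esym_def by (intro sum.cong refl arg_cong[of _ _ "prod x"]) (auto simp: ksub_def)
  finally show ?thesis .
qed

lemma sum_del: "i \<in> V \<Longrightarrow> sum x (V - {i}) = real T - x i"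
  by (simp add: sum_Diff_singleton[OF finV] xsum)

lemma x_le_T: "i \<in> V \<Longrightarrow> x i \<le> real T"
  using member_le_sum[of i V x] finV xnonneg xsum by auto

text \<open>A first crude bound: a heavier vertex would leave too little weight
  \<open>T - x i\<close> on the other vertices for its link to reach \<open>P\<close>.\<close>

lemma x_le_r: 
  assumes i: "i \<in> V"
  shows "x i \<le> real r"
proof -
  have "(real T - real r + 1) ^ (r - 1) \<le> fact (r - 1) * P"
    using fact_choose_ge_power[of "r - 1" "T - 1"] Tpos r3 by (simp add: P_def of_nat_diff)
  also have "\<dots> \<le> fact (r - 1) * esym (r - 1) (V - {i}) x"
    using L_gt[OF i] L_le_esym[OF i] by simp
  also have "\<dots> \<le> (real T - x i) ^ (r - 1)"
    using fact_esym_le_power[of "V - {i}" x "r - 1"] finV xnonneg sum_del[OF i] by simp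
  finally have "real T - real r + 1 \<le> real T - x i"
    using power_mono_iff[of "real T - real r + 1" "real T - x i" "r - 1"] r3 Tpos x_le_T[OF i] by simp
  then show ?thesis by simp
qed

definition "S2 = (\<Sum>i\<in>V. (x i)\<^sup>2)"

text \<open>By Cauchy-Schwarz over the edges, \<open>W^2\<close> is at most \<open>card G\<close>
  times the elementary symmetric sum of the squares. The bound on \<open>card G\<close> exceeds
  \<open>\<Lambda>\<close> only by the factor \<open>1 + r / T\<close>, so the squares cannot sum to
  much less than \<open>T\<close>.\<close>

lemma S2_ge: "real T - real r ^ 2 \<le> S2"
proof (rule ccontr)
  assume "\<not> ?thesis"
  then have less: "S2 < real T - real r ^ 2" by simp
  have S20: "0 \<le> S2" by (simp add: S2_def sum_nonneg)
  define q where "q = S2 / real T"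
  have q: "0 \<le> q" "q < 1 - real r ^ 2 / real T" "q \<le> 1"
  proof -
    show "0 \<le> q" using S20 by (simp add: q_def)
    show q2: "q < 1 - real r ^ 2 / real T" using less Tpos by (simp add: q_def field_simps)
    have "0 \<le> real r ^ 2 / real T" by simp
    then show "q \<le> 1" using q2 by linarith
  qed
  have "W\<^sup>2 \<le> (\<Sum>e\<in>G. (1::real)\<^sup>2) * (\<Sum>e\<in>G. (prod x e)\<^sup>2)"
    unfolding W_def using Cauchy_Schwarz_ineq_sum[of "\<lambda>_. 1" "prod x" G] by simp
  also have "\<dots> \<le> (\<Lambda> + P) * esym r V (\<lambda>i. (x i)\<^sup>2)"
  proof (rule mult_mono)
    show "(\<Sum>e\<in>G. (prod x e)\<^sup>2) \<le> esym r V (\<lambda>i. (x i)\<^sup>2)"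
      unfolding esym_def prod_power_distrib using Gsub finV
      by (intro sum_mono2) (auto intro: prod_nonneg)
  qed (use cardG \<Lambda>_pos P_pos in \<open>auto intro: sum_nonneg\<close>)
  finally have "fact r * W\<^sup>2 \<le> (\<Lambda> + P) * (fact r * esym r V (\<lambda>i. (x i)\<^sup>2))" 
    by (simp add: mult_ac)
  also have "\<dots> \<le> (\<Lambda> + P) * S2 ^ r"
    using fact_esym_le_power[of V "\<lambda>i. (x i)\<^sup>2" r] finV \<Lambda>_pos P_pos
    by (intro mult_left_mono) (auto simp: S2_def)
  finally have 1: "fact r * W\<^sup>2 \<le> (\<Lambda> + P) * S2 ^ r" .
  have "\<Lambda>\<^sup>2 < W\<^sup>2" using W_gt \<Lambda>_pos by (intro power_strict_mono) auto
  then have "fact r * \<Lambda>\<^sup>2 < fact r * W\<^sup>2" by simp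
  from this 1 have "fact r * \<Lambda>\<^sup>2 < (\<Lambda> + P) * S2 ^ r" by (rule less_le_trans)
  also have "\<Lambda> + P = \<Lambda> * (1 + real r / real T)"
    using TP Tpos by (simp add: field_simps)
  finally have "\<Lambda> * (fact r * \<Lambda>) < \<Lambda> * ((1 + real r / real T) * S2 ^ r)"
    by (simp add: power2_eq_square mult_ac)
  then have "fact r * \<Lambda> < (1 + real r / real T) * S2 ^ r"
    using \<Lambda>_pos by simp
  moreover have "real T ^ r * (1 - real r * (real r - 1) / (2 * real T)) \<le> fact r * \<Lambda>"
    unfolding \<Lambda>_def by (rule fact_choose_ge) (use Tpos in auto)
  moreover have "S2 ^ r = real T ^ r * q ^ r"
    using Tpos by (simp add: q_def power_divide)
  ultimately have "real T ^ r * (1 - real r * (real r - 1) / (2 * real T))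
    < real T ^ r * ((1 + real r / real T) * q ^ r)" by (simp add: mult_ac)
  then have "1 - real r * (real r - 1) / (2 * real T) < (1 + real r / real T) * q ^ r"
    using Tpos by simp
  \<comment> \<open>Keeping one of the \<open>r\<close> factors \<open>q\<close> is enough: it loses
    \<open>r^2 / T\<close>, which outweighs \<open>r / T\<close> together with half of
    \<open>r * (r - 1) / T\<close>.\<close>
  also have "\<dots> \<le> (1 + real r / real T) * q"
    using q r3 power_decreasing[of 1 r q] by (intro mult_left_mono) auto
  also have "\<dots> \<le> (1 + real r / real T) * (1 - real r ^ 2 / real T)"
    using q by (intro mult_left_mono) auto
  also have "\<dots> = 1 + real r / real T - real r ^ 2 / real T - (real r / real T) * (real r ^ 2 / real T)"
    unfolding ring_distribs mult_1_left mult_1_right by linarith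
  also have "\<dots> \<le> 1 + real r / real T - real r ^ 2 / real T" by simp
  finally have "real r ^ 2 / real T - real r / real T < real r * (real r - 1) / (2 * real T)" by simp
  then have "(real r ^ 2 - real r) / real T < (real r * (real r - 1) / 2) / real T"
    by (simp only: diff_divide_distrib divide_divide_eq_left)
  then have "real r ^ 2 - real r < real r * (real r - 1) / 2"
    using Tpos by (simp only: divide_less_cancel)
  then have "real r * (real r - 1) < 0" by (simp add: power2_eq_square algebra_simps)
  moreover have "0 \<le> real r * (real r - 1)" using r3 by simp
  ultimately show False by simp
qed

text \<open>Compare \<open>P < L i\<close> with the Bonferroni bound for the link, in powers of
  \<open>T\<close>. As \<open>S2\<close> is at least \<open>T\<close> up to a constant, its term
  \<open>c * T^(r-2)\<close> cancels against the same term in \<open>P\<close>. What remains at that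
  order is \<open>(r - 1) * (x i - 1)\<close>, which is thus \<open>O(1 / T)\<close>.\<close>

lemma x_le:
  assumes i: "i \<in> V"
  shows "x i \<le> 1 + 5 * real r ^ 6 / real T"
proof -
  obtain m where m: "r = m + 3" using r3 by (metis add.commute le_Suc_ex)
  define c where "c = real ((m + 2) choose 2)"
  define K where "K = real (m + 2) ^ 4 * real r ^ 2"
  have c0: "0 \<le> c" "0 \<le> K" by (simp_all add: c_def K_def)
  have cm: "c + real (m + 2) = real r * (real r - 1) / 2"
    unfolding c_def m choose_two by (simp add: real_of_nat_div field_simps)
  have cr: "c \<le> real r ^ 2"
  proof -
    have "0 \<le> real m * real m" by simp
    moreover have "2 * c = 2 + (real m * real m + real m * 3)" using cm by (simp add: m algebra_simps)
    moreover have "real r ^ 2 = real m * real m + real m * 6 + 9"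
      by (simp add: m power2_eq_square algebra_simps)
    ultimately show ?thesis by linarith
  qed
  have xi: "0 \<le> x i" "x i \<le> real r" "x i \<le> real T" using xnonneg x_le_r x_le_T i by auto
  have xi2: "(x i)\<^sup>2 \<le> real r ^ 2" using xi by (intro power_mono) auto
  define U where "U = real T - x i"
  have U: "0 \<le> U" "U \<le> real T" using xi by (auto simp: U_def)
  have Um: "0 \<le> U ^ m" "U ^ m \<le> real T ^ m" using U by (auto intro: power_mono)
  have "real T ^ (m + 3) * (1 - real r * (real r - 1) / (2 * real T)) \<le> fact r * \<Lambda>"
    unfolding \<Lambda>_def using fact_choose_ge[of T r] Tpos m by simp
  also have "fact r * \<Lambda> = real T * (fact (m + 2) * P)"
  proof -
    have "(fact r :: real) = real r * fact (m + 2)" by (simp add: m numeral_3_eq_3)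
    then show ?thesis using TP by simp
  qed
  also have "real T ^ (m + 3) * (1 - real r * (real r - 1) / (2 * real T))
      = real T * (real T ^ (m + 2) - (c + real (m + 2)) * real T ^ (m + 1))"
    unfolding cm using Tpos by (simp add: field_simps numeral_3_eq_3)
  finally have "real T * (real T ^ (m + 2) - (c + real (m + 2)) * real T ^ (m + 1)) \<le> real T * (fact (m + 2) * P)" .
  then have "real T ^ (m + 2) - (c + real (m + 2)) * real T ^ (m + 1) \<le> fact (m + 2) * P"
    using Tpos by simp
  also have "\<dots> \<le> fact (m + 2) * esym (m + 2) (V - {i}) x"
    using L_gt[OF i] L_le_esym[OF i] m by simp
  also have "\<dots> \<le> U ^ (m + 2) - c * (S2 - (x i)\<^sup>2) * U ^ m + K * U ^ m"
  proof -
    have "(\<Sum>j\<in>V - {i}. (x j)\<^sup>2) = S2 - (x i)\<^sup>2"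
      by (simp add: S2_def sum_Diff_singleton[OF finV i])
    then show ?thesis
      using fact_esym_le[of "V - {i}" x "real r" m] finV xnonneg x_le_r sum_del[OF i]
      by (simp add: U_def c_def K_def)
  qed
  finally have main: "real T ^ (m + 2) - (c + real (m + 2)) * real T ^ (m + 1)
    \<le> U ^ (m + 2) - c * (S2 - (x i)\<^sup>2) * U ^ m + K * U ^ m" .
  have 1: "U ^ (m + 2) \<le> real T ^ (m + 2) - real (m + 2) * x i * real T ^ (m + 1) + c * real r ^ 2 * real T ^ m"
  proof -
    have "U ^ (m + 2) \<le> real T ^ (m + 2) - real (m + 2) * x i * real T ^ (m + 1) + c * (x i)\<^sup>2 * real T ^ m"
      unfolding U_def c_def by (rule power_diff_le_quadratic) (use xi in auto)
    moreover have "c * (x i)\<^sup>2 * real T ^ m \<le> c * real r ^ 2 * real T ^ m"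
      using c0 xi2 by (intro mult_right_mono mult_left_mono) auto
    ultimately show ?thesis by linarith
  qed
  have 2: "real T ^ (m + 1) - 3 * real r ^ 2 * real T ^ m \<le> (S2 - (x i)\<^sup>2) * U ^ m"
  proof -
    have "real T ^ (m + 1) - real m * x i * real T ^ m \<le> real T * U ^ m"
      unfolding U_def by (rule power_diff_ge_linear) (use xi in auto)
    moreover have "real m * x i * real T ^ m \<le> real r ^ 2 * real T ^ m"
      using xi m unfolding power2_eq_square by (intro mult_mono) auto
    moreover have "2 * real r ^ 2 * U ^ m \<le> 2 * real r ^ 2 * real T ^ m"
      using Um by (intro mult_left_mono) auto
    moreover have "(real T - 2 * real r ^ 2) * U ^ m \<le> (S2 - (x i)\<^sup>2) * U ^ m"
      using S2_ge xi2 Um by (intro mult_right_mono) auto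
    ultimately show ?thesis by (simp add: algebra_simps)
  qed
  have 3: "K * U ^ m \<le> real r ^ 6 * real T ^ m"
  proof (rule mult_mono)
    have "real (m + 2) ^ 4 \<le> real r ^ 4" using m by (intro power_mono) auto
    then have "K \<le> real r ^ 4 * real r ^ 2" unfolding K_def by (intro mult_right_mono) auto
    then show "K \<le> real r ^ 6" by (simp flip: power_add)
  qed (use Um in auto)
  have 4: "c * (real T ^ (m + 1) - 3 * real r ^ 2 * real T ^ m) \<le> c * ((S2 - (x i)\<^sup>2) * U ^ m)"
    using 2 c0 by (intro mult_left_mono)
  have 5: "4 * c * real r ^ 2 * real T ^ m \<le> 4 * real r ^ 6 * real T ^ m"
  proof -
    have "c * real r ^ 2 \<le> real r ^ 2 * real r ^ 2" using cr by (intro mult_right_mono) auto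
    also have "\<dots> = real r ^ 4" by (simp flip: power_add)
    also have "\<dots> \<le> real r ^ 6" using r3 by (intro power_increasing) auto
    finally have "c * real r ^ 2 * real T ^ m \<le> real r ^ 6 * real T ^ m" by (intro mult_right_mono) auto
    then show ?thesis by simp
  qed
  \<comment> \<open>The errors of order \<open>T^m\<close> are \<open>c * r^2\<close> from fact 1,
    \<open>3 * c * r^2\<close> from fact 2, and \<open>r^6\<close> from \<open>K\<close>. With
    \<open>c \<le> r^2\<close> they add up to at most \<open>5 * r^6\<close>.\<close>
  have "real (m + 2) * (x i - 1) * real T ^ (m + 1) \<le> 5 * real r ^ 6 * real T ^ m"
    using main 1 3 4 5 by (simp add: algebra_simps)
  then have "real T ^ m * (real (m + 2) * (x i - 1) * real T) \<le> real T ^ m * (5 * real r ^ 6)"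
    by (simp add: algebra_simps)
  then have "real (m + 2) * (x i - 1) * real T \<le> 5 * real r ^ 6"
    using Tpos by simp
  then have m2: "real (m + 2) * (x i - 1) \<le> 5 * real r ^ 6 / real T"
    using Tpos by (simp add: field_simps)
  have "x i - 1 \<le> 5 * real r ^ 6 / real T"
  proof (cases "x i \<le> 1")
    case True
    then show ?thesis using Tpos by (smt (verit) divide_nonneg_pos zero_le_power of_nat_0_le_iff)
  next
    case False
    then have "1 * (x i - 1) \<le> real (m + 2) * (x i - 1)" by (intro mult_right_mono) auto
    with m2 show ?thesis by simp
  qed
  then show ?thesis by simp
qed

end

text \<open>For independent events of probabilities \<open>z i\<close>, the left-hand side is the probability
  that at most one of them fails.\<close>
lemma at_most_one_failure:
  fixes z :: "'a \<Rightarrow> real"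
  assumes "finite e" "\<And>i. i \<in> e \<Longrightarrow> 0 \<le> z i" "\<And>i. i \<in> e \<Longrightarrow> z i \<le> 1"
  shows "(\<Sum>i\<in>e. prod z (e - {i})) - (real (card e) - 1) * prod z e \<le> 1"
  using assms
proof (induction e rule: finite_induct)
  case (insert j e)
  have "prod z (insert j e - {i}) = z j * prod z (e - {i})" if "i \<in> e" for i
  proof -
    have "insert j e - {i} = insert j (e - {i})" using insert that by auto
    then show ?thesis using insert by simp
  qed
  then have "(\<Sum>i\<in>insert j e. prod z (insert j e - {i})) = prod z e + z j * (\<Sum>i\<in>e. prod z (e - {i}))"
    using insert by (simp add: sum_distrib_left)
  then have "(\<Sum>i\<in>insert j e. prod z (insert j e - {i})) - (real (card (insert j e)) - 1) * prod z (insert j e)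
    = z j * ((\<Sum>i\<in>e. prod z (e - {i})) - (real (card e) - 1) * prod z e) + (1 - z j) * prod z e"
    using insert by (simp add: algebra_simps)
  also have "\<dots> \<le> z j * 1 + (1 - z j) * 1"
    using insert by (intro add_mono mult_left_mono prod_le_1) auto
  finally show ?case by simp
qed simp

lemma power_mult_one_minus_le:
  fixes g :: real
  assumes "0 \<le> g"
  shows "(1 + g) ^ k * (1 - real k * g) \<le> 1"
proof (induction k)
  case (Suc k)
  have "(1 + g) * (1 - real (Suc k) * g) \<le> 1 - real k * g"
    using assms by (simp add: algebra_simps)
  then have "(1 + g) ^ k * ((1 + g) * (1 - real (Suc k) * g)) \<le> (1 + g) ^ k * (1 - real k * g)"
    using assms by (intro mult_left_mono) auto
  then show ?case using Suc by (simp add: mult_ac)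
qed simp

section \<open>The support has \<open>T + 1\<close> vertices\<close>

context heavy_weighting
begin

lemma finite_edge: "e \<in> G \<Longrightarrow> finite e"
  using Gsub finV by (meson finite_subset ksubD(1) subsetD)

text \<open>With at least \<open>T + 2\<close> vertices the link bounds make the sum of
  \<open>\<phi>\<close> over \<open>G\<close> exceed \<open>W + 2 * P\<close>. If all weights were
  at most 1, that sum would be at most \<open>card G \<le> \<Lambda> + P\<close>. The slack
  \<open>P\<close> has to absorb the correction for weights slightly above 1.\<close>

lemma card_V_le:
  assumes T: "30 * real r ^ 13 * 2 ^ r \<le> real T"
  shows "card V \<le> T + 1"
proof (rule ccontr)
  assume "\<not> ?thesis"
  then have n: "real T + 2 \<le> real (card V)" by simp
  define g where "g = 5 * real r ^ 6 / real T"
  define k where "k = r - 1"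
  have rk: "r = Suc k" using r3 by (simp add: k_def)
  have g0: "0 \<le> g" by (simp add: g_def)
  define A where "A = real k * g * (1 + g) ^ k"
  have A0: "0 \<le> A" using g0 by (simp add: A_def)
  define \<phi> where "\<phi> e = (\<Sum>i\<in>e. prod x (e - {i})) - (real r - 1) * prod x e" for e
  \<comment> \<open>The factor \<open>1 + g\<close> brings the weights into \<open>{0..1}\<close>.\<close>
  have edge: "\<phi> e \<le> 1 + A * (1 - prod x e / (1 + g) ^ r)" if e: "e \<in> G" for e
  proof -
    define z where "z i = x i / (1 + g)" for i
    have fe: "finite e" "card e = r" "e \<subseteq> V" using Gsub e finite_edge by (auto simp: ksub_def)
    have z: "0 \<le> z i" "z i \<le> 1" if "i \<in> e" for i
    proof -
      have "0 \<le> x i" "x i \<le> 1 + g" using that fe x_le xnonneg by (auto simp: g_def)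
      then show "0 \<le> z i" "z i \<le> 1" using g0 by (auto simp: z_def)
    qed
    have p: "prod x f = (1 + g) ^ card f * prod z f" for f
      using g0 by (simp add: z_def prod_dividef)
    have s: "(\<Sum>i\<in>e. prod x (e - {i})) = (1 + g) ^ k * (\<Sum>i\<in>e. prod z (e - {i}))"
      unfolding sum_distrib_left by (intro sum.cong refl) (use p fe in \<open>simp add: k_def\<close>)
    have "\<phi> e = (1 + g) ^ k * ((\<Sum>i\<in>e. prod z (e - {i})) - real k * prod z e - real k * g * prod z e)"
      unfolding \<phi>_def s p[of e] fe by (simp add: rk algebra_simps)
    also have "\<dots> \<le> (1 + g) ^ k * (1 - real k * g * prod z e)"
      using at_most_one_failure[OF fe(1) z] g0 fe by (intro mult_left_mono) (auto simp: rk)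
    also have "\<dots> = (1 + g) ^ k * (1 - real k * g) + A * (1 - prod z e)"
      by (simp add: A_def algebra_simps)
    also have "\<dots> \<le> 1 + A * (1 - prod z e)"
      using power_mult_one_minus_le[OF g0] by simp
    also have "prod z e = prod x e / (1 + g) ^ r" using p[of e] fe g0 by simp
    finally show ?thesis .
  qed
  have "(\<Sum>e\<in>G. \<phi> e) = (\<Sum>i\<in>V. L i) - (real r - 1) * W"
  proof -
    have "(\<Sum>e\<in>G. \<Sum>i\<in>e. prod x (e - {i})) = (\<Sum>i\<in>V. L i)"
      unfolding L_def by (rule sum_over_members) (use finG finV Gsub in \<open>auto simp: ksub_def\<close>)
    then show ?thesis by (simp add: \<phi>_def sum_subtractf W_def flip: sum_distrib_left)
  qed
  moreover have "(real T + 2) * (real r * W / real T) \<le> (\<Sum>i\<in>V. L i)"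
  proof -
    have "0 \<le> real r * W / real T" using W_gt \<Lambda>_pos by simp
    then have "(real T + 2) * (real r * W / real T) \<le> real (card V) * (real r * W / real T)"
      using n by (rule mult_right_mono[rotated])
    also have "\<dots> \<le> (\<Sum>i\<in>V. L i)"
      using sum_mono[of V "\<lambda>_. real r * W / real T" L] L_ge by simp
    finally show ?thesis .
  qed
  moreover have "(real T + 2) * (real r * W / real T) = real r * W + 2 * (real r * W / real T)"
    using Tpos by (simp add: field_simps)
  moreover have "P < real r * W / real T"
    using TP W_gt Tpos by (simp add: field_simps)
  moreover have "(real r - 1) * W = real r * W - W" by (simp add: algebra_simps)
  ultimately have lower: "W + 2 * P < (\<Sum>e\<in>G. \<phi> e)" by linarith
  have "(\<Sum>e\<in>G. \<phi> e) \<le> (\<Sum>e\<in>G. 1 + A * (1 - prod x e / (1 + g) ^ r))"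
    by (rule sum_mono[OF edge])
  also have "\<dots> = real (card G) + A * (real (card G) - W / (1 + g) ^ r)"
    by (simp add: sum.distrib sum_subtractf W_def flip: sum_distrib_left sum_divide_distrib)
  \<comment> \<open>The factors \<open>1 - prod z e\<close> sum to \<open>O(P)\<close> because
    \<open>W\<close> is close to \<open>card G\<close>. An error of \<open>A\<close> on each edge
    would instead total a large constant times \<open>P\<close>, as \<open>A\<close> is of order
    \<open>1 / T\<close>.\<close>
  also have "\<dots> \<le> (\<Lambda> + P) + A * ((\<Lambda> + P) - \<Lambda> * (1 - real r * g))"
  proof -
    have "\<Lambda> * (1 - real r * g) \<le> W / (1 + g) ^ r"
    proof -
      have "\<Lambda> * ((1 + g) ^ r * (1 - real r * g)) \<le> \<Lambda> * 1"
        using power_mult_one_minus_le[OF g0] \<Lambda>_pos by (intro mult_left_mono) auto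
      then have "\<Lambda> * (1 - real r * g) * (1 + g) ^ r \<le> W" using W_gt by (simp add: mult_ac)
      then show ?thesis using g0 by (simp add: pos_le_divide_eq)
    qed
    then show ?thesis using cardG A0 by (intro add_mono mult_left_mono) auto
  qed
  also have "\<dots> = \<Lambda> + P + A * (1 + 5 * real r ^ 6) * P"
  proof -
    have "real r * g * \<Lambda> = 5 * real r ^ 6 * P"
      using TP Tpos by (simp add: g_def field_simps)
    then show ?thesis by (simp add: algebra_simps)
  qed
  \<comment> \<open>The threshold for \<open>T\<close> is the product of \<open>r * g * 2^r\<close>,
    which bounds \<open>A\<close>, and \<open>6 * r^6\<close>, with
    \<open>g = 5 * r^6 / T\<close>.\<close>
  also have "\<dots> \<le> \<Lambda> + P + 1 * P"
  proof -
    have gle: "30 * real r ^ 13 * 2 ^ r / real T \<le> 1" using T Tpos by simp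
    have "g \<le> 30 * real r ^ 13 * 2 ^ r / real T"
    proof -
      have "real r ^ 6 \<le> real r ^ 13" using r3 by (intro power_increasing) auto
      then have "5 * real r ^ 6 * 1 \<le> (30 * real r ^ 13) * 2 ^ r" by (intro mult_mono) auto
      then show ?thesis unfolding g_def using Tpos by (intro divide_right_mono) auto
    qed
    then have "g \<le> 1" using gle by simp
    then have "(1 + g) ^ k \<le> 2 ^ k" using g0 by (intro power_mono) auto
    also have "\<dots> \<le> 2 ^ r" by (simp add: rk)
    finally have "A \<le> real r * g * 2 ^ r"
      unfolding A_def using g0 by (intro mult_mono) (auto simp: rk)
    moreover have "1 + 5 * real r ^ 6 \<le> 6 * real r ^ 6"
      using r3 by simp
    ultimately have "A * (1 + 5 * real r ^ 6) \<le> (real r * g * 2 ^ r) * (6 * real r ^ 6)"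
      using A0 g0 by (intro mult_mono) auto
    also have "\<dots> = 30 * real r ^ 13 * 2 ^ r / real T"
      by (simp add: g_def power_numeral_reduce)
    finally have "A * (1 + 5 * real r ^ 6) \<le> 1" using gle by simp
    then show ?thesis using P_pos by (intro add_left_mono mult_right_mono) auto
  qed
  finally show False using lower W_gt by simp
qed

lemma card_V:
  assumes "30 * real r ^ 13 * 2 ^ r \<le> real T"
  shows "card V = T + 1"
proof (rule ccontr)
  assume "card V \<noteq> T + 1"
  then have "card V \<le> T" using card_V_le[OF assms] by simp
  moreover have "V \<noteq> {}" using xsum Tpos by auto
  ultimately have "esym r V x \<le> \<Lambda>"
    unfolding \<Lambda>_def using finV xsum xnonneg Tpos by (intro esym_le_choose) auto
  then show False using W_le_esym W_gt by simp
qed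

end

section \<open>Sets through a fixed set, and merging two vertices\<close>

lemma ksub_superset:
  assumes "finite V" "f \<subseteq> V"
  shows "{e \<in> ksub (card f + k) V. f \<subseteq> e} = (\<union>) f ` ksub k (V - f)"
proof (intro set_eqI iffI)
  fix e assume e: "e \<in> {e \<in> ksub (card f + k) V. f \<subseteq> e}"
  then have "finite f" using assms finite_subset by blast
  with e have "e - f \<in> ksub k (V - f)" "e = f \<union> (e - f)"
    by (auto simp: ksub_def card_Diff_subset)
  then show "e \<in> (\<union>) f ` ksub k (V - f)" by blast
next
  fix e assume "e \<in> (\<union>) f ` ksub k (V - f)"
  then obtain g where g: "g \<in> ksub k (V - f)" "e = f \<union> g" by blast
  then have "finite g" "finite f" "f \<inter> g = {}"
    using assms by (auto simp: ksub_def intro: finite_subset)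
  with g assms show "e \<in> {e \<in> ksub (card f + k) V. f \<subseteq> e}"
    by (auto simp: ksub_def card_Un_disjoint)
qed

lemma inj_on_Un_ksub: "inj_on ((\<union>) f) (ksub k (V - f))"
proof (rule inj_onI)
  fix g h assume "g \<in> ksub k (V - f)" "h \<in> ksub k (V - f)" "f \<union> g = f \<union> h"
  moreover from this have "g = (f \<union> g) - f" "h = (f \<union> h) - f" by (auto simp: ksub_def)
  ultimately show "g = h" by simp
qed

lemma card_ksub_superset:
  assumes "finite V" "f \<subseteq> V"
  shows "card {e \<in> ksub (card f + k) V. f \<subseteq> e} = (card V - card f) choose k"
  using assms finite_subset[OF assms(2,1)]
  by (simp add: ksub_superset card_image inj_on_Un_ksub card_ksub card_Diff_subset)

lemma esym_cong: "(\<And>i. i \<in> V \<Longrightarrow> x i = y i) \<Longrightarrow> esym k V x = esym k V y"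
  unfolding esym_def by (intro sum.cong prod.cong refl) (auto simp: ksub_def)

text \<open>The polynomial is linear in each of \<open>x u\<close> and \<open>x v\<close>, and its
  monomials without the product \<open>x u * x v\<close> depend on the two weights only through
  their sum.\<close>

lemma esym_merge:
  fixes x :: "'a \<Rightarrow> real"
  assumes fin: "finite V" and uv: "u \<in> V" "v \<in> V" "u \<noteq> v"
  shows "esym (k + 2) V x = esym (k + 2) (V - {u}) (x(v := x u + x v))
    + (\<Sum>e\<in>{e\<in>ksub (k + 2) V. u \<in> e \<and> v \<in> e}. prod x e)"
proof -
  define R where "R = V - {u, v}"
  define x' where "x' = x(v := x u + x v)"
  have R: "V - {u} - {v} = R" "finite R" using fin by (auto simp: R_def)
  have x': "esym j R x' = esym j R x" for j
    by (rule esym_cong) (simp add: x'_def R_def)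
  have s: "esym (Suc j) (V - {u}) z = esym (Suc j) R z + z v * esym j R z" for j z
    using esym_split[of "V - {u}" v j z] fin uv R by simp
  have "{e\<in>ksub (k + 2) V. u \<in> e \<and> v \<in> e} = {e\<in>ksub (card {u, v} + k) V. {u, v} \<subseteq> e}"
    using uv by auto
  then have "(\<Sum>e\<in>{e\<in>ksub (k + 2) V. u \<in> e \<and> v \<in> e}. prod x e) = (\<Sum>g\<in>ksub k R. prod x ({u, v} \<union> g))"
    using ksub_superset[OF fin, of "{u, v}" k] uv sum.reindex[OF inj_on_Un_ksub[of "{u, v}" k V], of "prod x"]
    by (simp add: R_def)
  also have "\<dots> = (\<Sum>g\<in>ksub k R. x u * x v * prod x g)"
  proof (intro sum.cong refl)
    fix g assume "g \<in> ksub k R"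
    then have "finite g" "u \<notin> g" "v \<notin> g" using R(2) finite_subset by (auto simp: ksub_def R_def)
    then show "prod x ({u, v} \<union> g) = x u * x v * prod x g" using uv by simp
  qed
  also have "\<dots> = x u * x v * esym k R x" by (simp add: esym_def sum_distrib_left)
  finally have "(\<Sum>e\<in>{e\<in>ksub (k + 2) V. u \<in> e \<and> v \<in> e}. prod x e) = x u * x v * esym k R x" .
  moreover have "x' v = x u + x v" by (simp add: x'_def)
  ultimately show ?thesis
    using esym_split[OF fin uv(1), of "Suc k" x] unfolding x'_def[symmetric]
    by (simp add: s x' algebra_simps)
qed

text \<open>By convexity the power lies below its chord over the interval from 0 to 1.\<close>

lemma one_plus_power_le:
  fixes p :: real
  assumes "0 \<le> p" "p \<le> 1"
  shows "(1 + p) ^ k \<le> 1 + (2 ^ k - 1) * p"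
proof (induction k)
  case (Suc k)
  have "(1 + p) ^ Suc k \<le> (1 + p) * (1 + (2 ^ k - 1) * p)"
    using Suc assms by (simp add: mult_left_mono)
  also have "\<dots> = 1 + 2 ^ k * p + (2 ^ k - 1) * (p * p)" by (simp add: algebra_simps)
  also have "\<dots> \<le> 1 + 2 ^ k * p + (2 ^ k - 1) * (p * 1)"
    using assms by (intro add_left_mono mult_left_mono) auto
  finally show ?case by (simp add: algebra_simps)
qed simp

section \<open>Exchanging missing sets for a star\<close>

locale heavy_missing = heavy_weighting +
  fixes D :: "'a set set"
  assumes cV: "card V = T + 1" and Dsub: "D \<subseteq> ksub r V - G"
    and cD: "card D = (T - 1) choose (r - 2)"
begin

text \<open>\<open>N\<close> counts the \<open>r\<close>-subsets of the \<open>T + 1\<close>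
  vertices through a given pair, so \<open>D\<close> and every star \<open>St u v\<close> have equal
  size. \<open>N'\<close> is the binomial coefficient in the stability term of the
  \<open>T\<close>-clique; the two differ by a factor \<open>1 - O(1 / T)\<close>.\<close>

definition "N = real ((T - 1) choose (r - 2))"
definition "N' = real ((T - 2) choose (r - 2))"
definition "St u v = {e\<in>ksub r V. u \<in> e \<and> v \<in> e}"
text \<open>The squared deviation from weight 1 after \<open>u\<close> has been merged into
  \<open>v\<close>.\<close>

definition "Q u v = (x u + x v - 1)\<^sup>2 + (\<Sum>i\<in>V - {u, v}. (x i - 1)\<^sup>2)"
definition "gain u v = (\<Sum>e\<in>St u v - D. prod x e) - (\<Sum>e\<in>D - St u v. prod x e)"

lemma finD: "finite D" and finSt: "finite (St u v)"
  using Dsub finV finite_ksub[OF finV, of r] by (auto simp: St_def intro: finite_subset)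

lemma edgeD:
  assumes "e \<in> D \<or> e \<in> St u v"
  shows "e \<subseteq> V" "card e = r" "finite e"
  using assms Dsub finV by (auto simp: St_def ksub_def intro: finite_subset)

lemma prod_x_nonneg: "e \<subseteq> V \<Longrightarrow> 0 \<le> prod x e"
  by (intro prod_nonneg) (auto intro: xnonneg)

lemma N_pos: "0 < N"
  using Tr r3 by (simp add: N_def)

lemma N'_eq: "(real T - 1) * N' = (real T + 1 - real r) * N"
proof -
  have "(T - 1 - (r - 2)) * ((T - 1) choose (r - 2)) = (T - 1) * ((T - 2) choose (r - 2))"
    using binomial_absorb_comp[of "T - 1" "r - 2"] by (simp add: numeral_2_eq_2)
  then have "real (T - 1 - (r - 2)) * N = real (T - 1) * N'"
    unfolding N_def N'_def by (metis of_nat_mult)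
  moreover have "real (T - 1 - (r - 2)) = real T + 1 - real r" "real (T - 1) = real T - 1"
    using Tr r3 by (auto simp: of_nat_diff)
  ultimately show ?thesis by metis
qed

lemma N'_ge: "(1 - real r / real T) * N \<le> N'"
proof -
  have T1: "0 < real T - 1" using Tr r3 by simp
  have "(real T - 1) * (1 - real r / real T) \<le> real T + 1 - real r"
    using Tpos Tr r3 by (simp add: field_simps)
  then have "((real T - 1) * (1 - real r / real T)) * N \<le> (real T - 1) * N'"
    unfolding N'_eq using N_pos by (intro mult_right_mono) auto
  then have "(real T - 1) * ((1 - real r / real T) * N) \<le> (real T - 1) * N'"
    by (simp only: mult.assoc)
  then show ?thesis using T1 by simp
qed

lemma N'_ge_half: "N / 2 \<le> N'"
proof -
  have "1 / 2 \<le> 1 - real r / real T" using Tr Tpos by (simp add: field_simps)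
  then have "1 / 2 * N \<le> (1 - real r / real T) * N" using N_pos by (intro mult_right_mono) auto
  then show ?thesis using N'_ge by linarith
qed

text \<open>Prescribing a third vertex multiplies the codegree of a pair by
  \<open>(r - 2) / (T - 1)\<close>, which is at most \<open>r / T\<close>.\<close>

lemma codegree3:
  assumes "f \<subseteq> V" "card f = 3"
  shows "real (card {e\<in>ksub r V. f \<subseteq> e}) \<le> real r / real T * N"
proof -
  define M where "M = real ((T - 2) choose (r - 3))"
  have "card {e\<in>ksub r V. f \<subseteq> e} = (T - 2) choose (r - 3)"
    using card_ksub_superset[OF finV assms(1), of "r - 3"] assms(2) r3 cV by simp
  moreover have "Suc (r - 3) * ((T - 1) choose Suc (r - 3)) = (T - 1) * ((T - 1 - 1) choose (r - 3))"
    by (rule binomial_absorption)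
  moreover have "Suc (r - 3) = r - 2" "T - 1 - 1 = T - 2" using r3 by auto
  ultimately have "real (r - 2) * N = real (T - 1) * M" "real (card {e\<in>ksub r V. f \<subseteq> e}) = M"
    unfolding N_def M_def by (metis of_nat_mult)+
  then have M: "(real r - 2) * N = (real T - 1) * M" "real (card {e\<in>ksub r V. f \<subseteq> e}) = M"
    using r3 Tr by (auto simp: of_nat_diff)
  have "real T * (real r - 2) \<le> real r * (real T - 1)" using Tr r3 by (simp add: algebra_simps)
  then have "real T * (real r - 2) * N \<le> real r * (real T - 1) * N"
    using N_pos by (intro mult_right_mono) auto
  then have "(real T - 1) * (real T * M) \<le> (real T - 1) * (real r * N)"
    using M(1) by (simp only: mult_ac)
  moreover have "0 < real T - 1" using Tr r3 by simp
  ultimately have "real T * M \<le> real r * N" by simp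
  then show ?thesis using M(2) Tpos by (simp add: field_simps)
qed

lemma r2: "Suc (Suc (r - 2)) = r"
  using r3 by simp

lemma card_St: "u \<in> V \<Longrightarrow> v \<in> V \<Longrightarrow> u \<noteq> v \<Longrightarrow> card (St u v) = card D"
  using card_ksub_superset[OF finV, of "{u, v}" "r - 2"] cV cD by (simp add: St_def r2)

lemma card_exchange: "u \<in> V \<Longrightarrow> v \<in> V \<Longrightarrow> u \<noteq> v \<Longrightarrow> card (St u v - D) = card (D - St u v)"
  using card_St[of u v] finD finSt[of u v] by (simp add: card_Diff_subset_Int Int_commute)

lemma gain_eq: "gain u v = (\<Sum>e\<in>St u v. prod x e) - (\<Sum>e\<in>D. prod x e)"
proof -
  have "(\<Sum>e\<in>St u v. prod x e) = (\<Sum>e\<in>St u v \<inter> D. prod x e) + (\<Sum>e\<in>St u v - D. prod x e)"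
    by (rule sum.Int_Diff[OF finSt])
  moreover have "(\<Sum>e\<in>D. prod x e) = (\<Sum>e\<in>D \<inter> St u v. prod x e) + (\<Sum>e\<in>D - St u v. prod x e)"
    by (rule sum.Int_Diff[OF finD])
  ultimately show ?thesis by (simp add: gain_def Int_commute)
qed

text \<open>Enlarge \<open>G\<close> to all \<open>r\<close>-sets outside \<open>D\<close>. Putting
  \<open>D\<close> back and removing the star through \<open>u, v\<close> changes the weight by
  \<open>- gain u v\<close> and leaves a family whose weight is that of the merged clique.\<close>

lemma W_le_merge:
  assumes uv: "u \<in> V" "v \<in> V" "u \<noteq> v"
  shows "W \<le> esym r (V - {u}) (x(v := x u + x v)) + gain u v"
proof -
  have "W \<le> (\<Sum>e\<in>ksub r V - D. prod x e)"
    unfolding W_def using Gsub Dsub finV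
    by (intro sum_mono2) (auto simp: ksub_def intro!: prod_x_nonneg)
  also have "\<dots> = esym r V x - (\<Sum>e\<in>D. prod x e)"
    unfolding esym_def using Dsub finV by (intro sum_diff) auto
  also have "r = r - 2 + 2" using r3 by simp
  finally show ?thesis
    using esym_merge[OF finV uv, of "r - 2" x] \<open>r = r - 2 + 2\<close> by (simp add: gain_eq St_def)
qed

lemma gain_gt:
  assumes "u \<in> V" "v \<in> V" "u \<noteq> v" "esym r (V - {u}) (x(v := x u + x v)) \<le> \<Lambda> - q"
  shows "q < gain u v"
  using W_le_merge[OF assms(1-3)] W_gt assms(4) by linarith

lemma merged:
  assumes uv: "u \<in> V" "v \<in> V" "u \<noteq> v"
  defines "x' \<equiv> x(v := x u + x v)"
  shows "card (V - {u}) = T" "sum x' (V - {u}) = real T"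
    "(\<Sum>i\<in>V - {u}. (x' i - 1)\<^sup>2) = Q u v"
proof -
  show "card (V - {u}) = T" using uv cV finV by simp
  have s: "sum f (V - {u}) = f v + sum f (V - {u, v})" for f :: "'a \<Rightarrow> real"
  proof -
    have "V - {u, v} = V - {u} - {v}" by auto
    then show ?thesis using uv finV by (simp add: sum.remove)
  qed
  have "sum x' (V - {u, v}) = sum x (V - {u, v})"
    by (intro sum.cong) (auto simp: x'_def)
  moreover have "real T = x u + (x v + sum x (V - {u, v}))"
    using xsum sum.remove[OF finV uv(1), of x] s[of x] by simp
  ultimately show "sum x' (V - {u}) = real T" unfolding s[of x'] by (simp add: x'_def)
  have "(\<Sum>i\<in>V - {u, v}. (x' i - 1)\<^sup>2) = (\<Sum>i\<in>V - {u, v}. (x i - 1)\<^sup>2)"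
    by (intro sum.cong) (auto simp: x'_def)
  then show "(\<Sum>i\<in>V - {u}. (x' i - 1)\<^sup>2) = Q u v"
    unfolding s Q_def by (simp add: x'_def)
qed

lemma r_eq: "r - 2 + 2 = r" "r - 2 + 1 = r - 1"
  using r3 by auto

text \<open>Since \<open>W\<close> exceeds the clique value, the gain has to pay for the whole
  stability loss of the merged clique. This version is available before any weight is known to be
  bounded away from 0; \<open>Q_lt_gain\<close> improves the constant afterwards.\<close>

lemma Q_lt_gain_weak:
  assumes uv: "u \<in> V" "v \<in> V" "u \<noteq> v"
  shows "N' / (real r * real r) * Q u v < gain u v"
proof -
  note M = merged[OF uv]
  have "0 \<le> (x(v := x u + x v)) i" if "i \<in> V - {u}" for i
    using that xnonneg uv by auto
  then have "esym r (V - {u}) (x(v := x u + x v)) \<le> \<Lambda> - N' / (real (r - 1) * real r) * Q u v"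
    using esym_le_choose_weak_deviation[OF _ M(1) Tpos(2) M(2), of "r - 2", unfolded M(3) r_eq, OF _ _ Tpos(3)]
      finV unfolding \<Lambda>_def N'_def by blast
  then have "N' / (real (r - 1) * real r) * Q u v < gain u v"
    by (rule gain_gt[OF uv])
  moreover have "N' / (real r * real r) * Q u v \<le> N' / (real (r - 1) * real r) * Q u v"
  proof (rule mult_right_mono)
    show "N' / (real r * real r) \<le> N' / (real (r - 1) * real r)"
      using r3 by (intro divide_left_mono mult_right_mono) (auto simp: N'_def)
    show "0 \<le> Q u v" by (simp add: Q_def sum_nonneg)
  qed
  ultimately show ?thesis by (metis le_less_trans)
qed

lemma Q_lt_gain:
  assumes uv: "u \<in> V" "v \<in> V" "u \<noteq> v" and \<theta>: "0 \<le> \<theta>" "\<theta> \<le> 1"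
    and ge: "\<And>i. i \<in> V - {u} \<Longrightarrow> \<theta> \<le> x i"
  shows "\<theta> ^ (r - 2) / 2 * N' * Q u v < gain u v"
proof -
  note M = merged[OF uv]
  have "\<theta> \<le> (x(v := x u + x v)) i" if "i \<in> V - {u}" for i
    using ge[OF that] xnonneg[OF uv(1)] by auto
  then have "esym r (V - {u}) (x(v := x u + x v)) \<le> \<Lambda> - \<theta> ^ (r - 2) / 2 * N' * Q u v"
    using esym_le_choose_deviation[OF _ M(1) Tpos(2) M(2) \<theta>, of "r - 2", unfolded M(3) r_eq, OF _ _ Tpos(3)]
      finV unfolding \<Lambda>_def N'_def by blast
  then show ?thesis by (rule gain_gt[OF uv])
qed

end

section \<open>All weights but one are close to 1\<close>

context heavy_missing
begin

lemma sum_defect: "(\<Sum>i\<in>V. 1 - x i) = 1"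
  using cV xsum by (simp add: sum_subtractf)

lemma two_smallest:
  obtains u v where "u \<in> V" "v \<in> V" "u \<noteq> v" "\<And>i. i \<in> V \<Longrightarrow> x u \<le> x i"
    "\<And>i. i \<in> V - {u} \<Longrightarrow> x v \<le> x i" "x v \<le> 1"
proof -
  have ne: "V \<noteq> {}" using cV by auto
  define u where "u = arg_min_on x V"
  have u: "u \<in> V" "\<And>i. i \<in> V \<Longrightarrow> x u \<le> x i"
    using arg_min_if_finite[OF finV ne, of x] by (auto simp: u_def not_less)
  have c: "card (V - {u}) = T" using u(1) cV finV by simp
  then have ne': "V - {u} \<noteq> {}" using Tpos by (metis card.empty less_irrefl)
  define v where "v = arg_min_on x (V - {u})"
  have v: "v \<in> V - {u}" "\<And>i. i \<in> V - {u} \<Longrightarrow> x v \<le> x i"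
    using arg_min_if_finite[of "V - {u}" x] finV ne' unfolding v_def by (force simp: not_less)+
  \<comment> \<open>The \<open>T\<close> vertices other than \<open>u\<close> have average weight at
    most 1, and \<open>v\<close> is the lightest of them.\<close>
  have "real T * x v \<le> sum x (V - {u})"
    using sum_mono[of "V - {u}" "\<lambda>_. x v" x] v(2) c by simp
  also have "\<dots> \<le> real T * 1" using sum_del[OF u(1)] xnonneg[OF u(1)] by simp
  finally have "x v \<le> 1" using Tpos by simp
  then show ?thesis using that[of u v] u v by auto
qed

text \<open>The defects \<open>1 - x i\<close> sum to 1. By \<open>x_le\<close> their negative parts
  total only a constant, so the number of vertices with defect above \<open>p\<close> is bounded
  independently of \<open>T\<close>.\<close>

lemma card_deficient:
  assumes p: "0 < p"
  shows "real (card {i\<in>V. x i < 1 - p}) \<le> 11 * real r ^ 6 / p"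
proof -
  define S where "S = {i\<in>V. x i < 1 - p}"
  define g where "g = 5 * real r ^ 6 / real T"
  have g0: "0 \<le> g" by (simp add: g_def)
  have S: "S \<subseteq> V" "finite S" using finV by (auto simp: S_def)
  have "real (card S) * p \<le> (\<Sum>i\<in>S. 1 - x i)"
    using sum_mono[of S "\<lambda>_. p" "\<lambda>i. 1 - x i"] by (auto simp: S_def)
  also have "\<dots> = 1 - (\<Sum>i\<in>V - S. 1 - x i)"
    using sum_defect sum.subset_diff[OF S(1) finV, of "\<lambda>i. 1 - x i"] by simp
  also have "\<dots> \<le> 1 + (real T + 1) * g"
  proof -
    have "(\<Sum>i\<in>V - S. - g) \<le> (\<Sum>i\<in>V - S. 1 - x i)"
      by (intro sum_mono) (use x_le in \<open>auto simp: g_def algebra_simps\<close>)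
    moreover have "real (card (V - S)) * g \<le> (real T + 1) * g"
      using card_mono[OF finV, of "V - S"] cV g0 by (intro mult_right_mono) auto
    ultimately show ?thesis by simp
  qed
  also have "\<dots> \<le> 1 + (2 * real T) * g" using g0 Tpos by (intro add_left_mono mult_right_mono) auto
  also have "\<dots> = 1 + 10 * real r ^ 6" using Tpos by (simp add: g_def)
  also have "\<dots> \<le> 11 * real r ^ 6" using r3 by simp
  finally show ?thesis using p unfolding S_def by (simp add: pos_le_divide_eq)
qed

text \<open>A union bound over the triples in \<open>S\<close>. For bounded \<open>S\<close> these
  sets form a fraction \<open>O(1 / T)\<close> of \<open>D\<close> and can be neglected.\<close>

lemma card_many_deficient:
  assumes S: "S \<subseteq> V"
  shows "real (card {e\<in>D. 3 \<le> card (e \<inter> S)}) \<le> real (card S) ^ 3 * (real r / real T * N)"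
proof -
  have fS: "finite S" using S finV finite_subset by blast
  have "{e\<in>D. 3 \<le> card (e \<inter> S)} \<subseteq> (\<Union>f\<in>ksub 3 S. {e\<in>ksub r V. f \<subseteq> e})"
  proof
    fix e assume e: "e \<in> {e\<in>D. 3 \<le> card (e \<inter> S)}"
    then have "3 \<le> card (e \<inter> S)" by simp
    then obtain f where "f \<subseteq> e \<inter> S" "card f = 3"
      by (rule obtain_subset_with_card_n)
    then have "f \<in> ksub 3 S" "f \<subseteq> e" by (auto simp: ksub_def)
    moreover have "e \<in> ksub r V" using e Dsub by blast
    ultimately show "e \<in> (\<Union>f\<in>ksub 3 S. {e\<in>ksub r V. f \<subseteq> e})" by blast
  qed
  then have "card {e\<in>D. 3 \<le> card (e \<inter> S)} \<le> card (\<Union>f\<in>ksub 3 S. {e\<in>ksub r V. f \<subseteq> e})"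
    using fS finV by (intro card_mono finite_UN_I finite_Collect_conjI) (auto simp only: finite_ksub Collect_mem_eq)
  also have "\<dots> \<le> (\<Sum>f\<in>ksub 3 S. card {e\<in>ksub r V. f \<subseteq> e})"
    using fS by (intro card_UN_le finite_ksub)
  finally have "card {e\<in>D. 3 \<le> card (e \<inter> S)} \<le> (\<Sum>f\<in>ksub 3 S. card {e\<in>ksub r V. f \<subseteq> e})" .
  from of_nat_mono[OF this, where 'a = real]
  have "real (card {e\<in>D. 3 \<le> card (e \<inter> S)}) \<le> (\<Sum>f\<in>ksub 3 S. real (card {e\<in>ksub r V. f \<subseteq> e}))"
    by (simp only: of_nat_sum)
  also have "\<dots> \<le> (\<Sum>f\<in>ksub 3 S. real r / real T * N)"
    using S by (intro sum_mono codegree3) (auto simp: ksub_def)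
  also have "\<dots> = real (card S choose 3) * (real r / real T * N)"
    using fS by (simp add: card_ksub)
  also have "\<dots> \<le> real (card S) ^ 3 * (real r / real T * N)"
  proof (rule mult_right_mono)
    have "card S choose 3 \<le> card S ^ 3"
    proof (cases "3 \<le> card S")
      case True
      then show ?thesis by (rule binomial_le_pow)
    qed (simp add: binomial_eq_0)
    then show "real (card S choose 3) \<le> real (card S) ^ 3" by (metis of_nat_le_iff of_nat_power)
  qed (use N_pos in auto)
  finally show ?thesis .
qed

text \<open>This makes a missing set with at most two deficient vertices nearly as heavy as a star
  set. The bound \<open>x v \<le> 1\<close> covers the cases of fewer than two vertices.\<close>

lemma prod_ge_two_smallest:
  assumes u: "u \<in> V" "\<And>i. i \<in> V \<Longrightarrow> x u \<le> x i" and v: "v \<in> V" "\<And>i. i \<in> V - {u} \<Longrightarrow> x v \<le> x i"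
    and v1: "x v \<le> 1" and f: "f \<subseteq> V" "card f \<le> 2" "finite f"
  shows "x u * x v \<le> prod x f"
proof -
  have pos: "0 < x u" "0 < x v" using u v xpos by auto
  have uv: "x u \<le> x v" using u v by auto
  have le: "x u * x v \<le> x u" using pos v1 by (simp add: mult_left_le)
  consider "card f = 0" | "card f = 1" | "card f = 2" using f(2) by linarith
  then show ?thesis
  proof cases
    case 1
    then show ?thesis using f(3) le uv v1 by simp
  next
    case 2
    then obtain i where "f = {i}" by (auto simp: card_1_singleton_iff)
    then show ?thesis using f(1) u le by (auto intro: order_trans)
  next
    case 3
    then obtain i j where ij: "f = {i, j}" "i \<noteq> j" by (meson card_2_iff)
    show ?thesis
    proof (cases "i = u")
      case True
      then show ?thesis using ij v f(1) pos by (simp add: mult_left_mono)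
    next
      case False
      have "x v * x u \<le> x i * x j"
        by (intro mult_mono) (use False ij v u f(1) pos in \<open>auto intro: xnonneg\<close>)
      then show ?thesis using ij by (simp add: mult.commute)
    qed
  qed
qed

lemma prod_ge_power:
  assumes "finite f" "card f \<le> r" "0 \<le> t" "t \<le> 1" "\<And>i. i \<in> f \<Longrightarrow> t \<le> x i"
  shows "t ^ r \<le> prod x f"
proof -
  have "t ^ r \<le> t ^ card f" using assms by (intro power_decreasing) auto
  also have "\<dots> = (\<Prod>i\<in>f. t)" by simp
  also have "\<dots> \<le> prod x f" using assms by (intro prod_mono) auto
  finally show ?thesis .
qed

lemma prod_le_power:
  assumes "f \<subseteq> V" "finite f" "card f \<le> r" "0 \<le> p" "\<And>i. i \<in> V \<Longrightarrow> x i \<le> 1 + p"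
  shows "prod x f \<le> (1 + p) ^ r"
proof -
  have "prod x f \<le> (\<Prod>i\<in>f. 1 + p)" using assms xnonneg by (intro prod_mono) auto
  also have "\<dots> = (1 + p) ^ card f" by simp
  also have "\<dots> \<le> (1 + p) ^ r" using assms by (intro power_increasing) auto
  finally show ?thesis .
qed

lemma prod_St_eq:
  assumes "e \<in> St u v" "u \<noteq> v"
  shows "prod x e = x u * x v * prod x (e - {u, v})"
proof -
  have "finite e" "u \<in> e" "v \<in> e - {u}" "e - {u, v} = e - {u} - {v}"
    using edgeD[of e u v] assms by (auto simp: St_def)
  then show ?thesis by (metis (no_types, lifting) finite_Diff mult.assoc prod.remove)
qed

lemma prod_St_le:
  assumes "e \<in> St u v" "u \<in> V" "v \<in> V" "u \<noteq> v" "0 \<le> p" "\<And>i. i \<in> V \<Longrightarrow> x i \<le> 1 + p"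
  shows "prod x e \<le> x u * x v * (1 + p) ^ r"
proof -
  have e: "e \<subseteq> V" "card e = r" "finite e" using edgeD[of e u v] assms(1) by auto
  have "card (e - {u, v}) \<le> r" using e card_mono[of e "e - {u, v}"] by auto
  then show ?thesis unfolding prod_St_eq[OF assms(1,4)]
    using e assms xnonneg by (intro mult_left_mono prod_le_power) auto
qed

text \<open>The gain is used twice. Apart from the few sets in \<open>B\<close>, the sets of
  \<open>D\<close> weigh almost \<open>x u * x v\<close> or more, and star sets weigh at most
  slightly more than that. So the gain is small and the weak stability bound gives
  \<open>Q u v \<le> \<rho>\<^sup>2\<close>, which controls \<open>x u\<close> and
  \<open>x v\<close> only through their sum. Next, a set of \<open>D\<close> outside the star
  contains at most one of \<open>u, v\<close> and weighs almost \<open>x u\<close> or more; as the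
  gain is positive, \<open>x v\<close> must be close to 1.\<close>

lemma all_but_one_near_1:
  assumes \<rho>: "0 < \<rho>" "\<rho> \<le> 1 / 2"
  defines "p \<equiv> \<rho>\<^sup>2 / (2 * real r ^ 2 * (2 ^ r + real r + 1))"
  assumes T1: "5 * real r ^ 6 / real T \<le> p" and T2: "(11 * real r ^ 6 / p) ^ 3 * (real r / real T) \<le> p"
  obtains u where "u \<in> V" "x u \<le> 3 * real r * \<rho>" "\<And>i. i \<in> V - {u} \<Longrightarrow> \<bar>x i - 1\<bar> \<le> 3 * real r * \<rho>"
proof -
  \<comment> \<open>\<open>K * p\<close> bounds the relative spread in \<open>pw\<close>. The value
    of \<open>p\<close> makes \<open>2 * r^2 * K * p\<close> equal to \<open>\<rho>\<^sup>2\<close>,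
    which is the bound on \<open>Q u v\<close> that results from
    \<open>N' \<ge> N / 2\<close>.\<close>
  define K where "K = 2 ^ r + real r + 1"
  have K: "1 \<le> K" by (simp add: K_def)
  have p0: "0 < p" using \<rho> r3 by (simp add: p_def add_pos_nonneg)
  have pK: "2 * real r ^ 2 * (K * p) = \<rho>\<^sup>2"
    using r3 K unfolding p_def K_def[symmetric] by simp
  have pl: "p \<le> \<rho>"
  proof -
    have "1 \<le> real r ^ 2" using r3 by (intro one_le_power) auto
    then have "1 * 1 \<le> (2 * real r ^ 2) * K" using K by (intro mult_mono) auto
    then have "1 * p \<le> 2 * real r ^ 2 * (K * p)"
      using p0 mult_right_mono[of 1 "2 * real r ^ 2 * K" p] by (simp add: mult_ac)
    also have "\<dots> \<le> \<rho>" unfolding pK using \<rho> by (simp add: power2_eq_square)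
    finally show ?thesis by simp
  qed
  have xp: "x i \<le> 1 + p" if "i \<in> V" for i using x_le[OF that] T1 by simp
  have x\<rho>: "x i \<le> 1 + \<rho>" if "i \<in> V" for i using xp[OF that] pl by simp
  obtain u v where u: "u \<in> V" "\<And>i. i \<in> V \<Longrightarrow> x u \<le> x i" and v: "v \<in> V" "u \<noteq> v"
    "\<And>i. i \<in> V - {u} \<Longrightarrow> x v \<le> x i" "x v \<le> 1"
    by (rule two_smallest) blast
  define a b where "a = x v" and "b = x u"
  have ab: "0 < b" "b \<le> a" "0 < a" "a \<le> 1"
    using u(2)[OF v(1)] xpos[OF u(1)] xpos[OF v(1)] v(4) by (simp_all add: a_def b_def)
  have ab1: "0 < b * a" "b * a \<le> 1" using ab by (auto simp: mult_le_one)
  have fD: "real (card D) = N" by (simp add: cD N_def)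
  have fSt: "real (card (St u v)) = N" using card_St[OF u(1) v(1,2)] fD by simp
  have up: "(\<Sum>e\<in>St u v. prod x e) \<le> N * (b * a * (1 + p) ^ r)"
  proof -
    have "(\<Sum>e\<in>St u v. prod x e) \<le> (\<Sum>e\<in>St u v. b * a * (1 + p) ^ r)"
    proof (rule sum_mono)
      fix e assume "e \<in> St u v"
      then show "prod x e \<le> b * a * (1 + p) ^ r"
        unfolding a_def b_def using prod_St_le[OF _ u(1) v(1,2) _ xp] p0 by simp
    qed
    then show ?thesis using fSt by simp
  qed
  define S where "S = {i\<in>V. x i < 1 - p}"
  define B where "B = {e\<in>D. 3 \<le> card (e \<inter> S)}"
  have Bb: "real (card B) \<le> p * N"
  proof -
    have "real (card B) \<le> real (card S) ^ 3 * (real r / real T * N)"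
      unfolding B_def by (rule card_many_deficient) (auto simp: S_def)
    also have "\<dots> \<le> (11 * real r ^ 6 / p) ^ 3 * (real r / real T * N)"
      using card_deficient[OF p0] N_pos unfolding S_def by (intro mult_right_mono power_mono) auto
    also have "\<dots> = ((11 * real r ^ 6 / p) ^ 3 * (real r / real T)) * N" by simp
    also have "\<dots> \<le> p * N" using T2 N_pos by (intro mult_right_mono) auto
    finally show ?thesis .
  qed
  have good: "b * a * (1 - p) ^ r \<le> prod x e" if e: "e \<in> D - B" for e
  proof -
    have e': "e \<subseteq> V" "card e = r" "finite e" using edgeD[of e u v] e by auto
    have "b * a \<le> prod x (e \<inter> S)"
      unfolding a_def b_def by (rule prod_ge_two_smallest[OF u v(1,3,4)]) (use e e' in \<open>auto simp: B_def\<close>)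
    moreover have "(1 - p) ^ r \<le> prod x (e - S)"
      by (rule prod_ge_power) (use e' p0 pl \<rho> card_mono[of e "e - S"] in \<open>auto simp: S_def not_less\<close>)
    ultimately have "b * a * (1 - p) ^ r \<le> prod x (e \<inter> S) * prod x (e - S)"
      using e' pl \<rho> by (intro mult_mono prod_x_nonneg zero_le_power) auto
    also have "\<dots> = prod x e" using prod.Int_Diff[OF e'(3)] by metis
    finally show ?thesis .
  qed
  \<comment> \<open>The extra factor \<open>1 - p\<close> accounts for the sets in \<open>B\<close>,
    at most \<open>p * N\<close> of them, whose weights are bounded below by 0.\<close>
  have low: "N * (b * a * ((1 - p) * (1 - p) ^ r)) \<le> (\<Sum>e\<in>D. prod x e)"
  proof -
    have BD: "B \<subseteq> D" by (auto simp: B_def)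
    have "(N - p * N) * (b * a * (1 - p) ^ r) \<le> real (card (D - B)) * (b * a * (1 - p) ^ r)"
    proof (rule mult_right_mono)
      show "N - p * N \<le> real (card (D - B))"
        using Bb fD BD finD card_mono[OF finD BD]
        by (simp add: card_Diff_subset finite_subset of_nat_diff)
    qed (use ab1 p0 pl \<rho> in auto)
    also have "\<dots> \<le> (\<Sum>e\<in>D - B. prod x e)"
      using sum_mono[of "D - B" "\<lambda>_. b * a * (1 - p) ^ r" "prod x"] good by simp
    also have "\<dots> \<le> (\<Sum>e\<in>D. prod x e)"
      using finD edgeD by (intro sum_mono2) (auto intro!: prod_x_nonneg)
    finally show ?thesis by (simp add: algebra_simps)
  qed
  have pw: "(1 + p) ^ r - (1 - p) * (1 - p) ^ r \<le> K * p"
  proof -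
    have "(1 + p) ^ r \<le> 1 + (2 ^ r - 1) * p" by (rule one_plus_power_le) (use p0 pl \<rho> in auto)
    moreover have "1 - (real r + 1) * p \<le> (1 - p) ^ Suc r"
      using Bernoulli_inequality[of "- p" "Suc r"] pl \<rho> by (simp add: algebra_simps)
    moreover have "0 \<le> p" using p0 by simp
    ultimately show ?thesis by (simp add: K_def algebra_simps)
  qed
  have "gain u v \<le> N * (b * a) * ((1 + p) ^ r - (1 - p) * (1 - p) ^ r)"
    unfolding gain_eq using up low by (simp add: algebra_simps)
  also have "\<dots> \<le> N * (b * a) * (K * p)"
    using pw ab1 N_pos by (intro mult_left_mono) auto
  also have "\<dots> \<le> N * 1 * (K * p)"
    using ab1 N_pos K p0 by (intro mult_right_mono mult_left_mono) auto
  finally have g1: "gain u v \<le> N * (K * p)" by simp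
  have Q0: "0 \<le> Q u v" by (simp add: Q_def sum_nonneg)
  have "N / 2 * Q u v \<le> N' * Q u v" using N'_ge_half Q0 by (intro mult_right_mono)
  also have "\<dots> = real r ^ 2 * (N' / (real r * real r) * Q u v)"
    using r3 by (simp add: power2_eq_square)
  also have "\<dots> \<le> real r ^ 2 * (N * (K * p))"
    using Q_lt_gain_weak[OF u(1) v(1,2)] g1 by (intro mult_left_mono) auto
  finally have "N * Q u v \<le> N * (2 * real r ^ 2 * (K * p))" by (simp add: mult_ac)
  then have Q: "Q u v \<le> \<rho>\<^sup>2" unfolding pK using N_pos by simp
  have "(b + a - 1)\<^sup>2 \<le> \<rho>\<^sup>2"
    using Q sum_nonneg[of "V - {u, v}" "\<lambda>i. (x i - 1)\<^sup>2"] by (simp add: Q_def a_def b_def)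
  then have s: "\<bar>b + a - 1\<bar> \<le> \<rho>" using \<rho> by (simp add: power2_le_iff_abs_le)
  have R: "\<bar>x i - 1\<bar> \<le> \<rho>" if "i \<in> V - {u, v}" for i
  proof -
    have "(x i - 1)\<^sup>2 \<le> (\<Sum>i\<in>V - {u, v}. (x i - 1)\<^sup>2)"
      using that finV by (intro member_le_sum) auto
    then have "(x i - 1)\<^sup>2 \<le> \<rho>\<^sup>2"
      using Q zero_le_power2[of "x u + x v - 1"] unfolding Q_def by linarith
    then show ?thesis using \<rho> by (simp add: power2_le_iff_abs_le)
  qed
  have gpos: "0 < gain u v"
  proof -
    have "0 \<le> N' / (real r * real r) * Q u v" using Q0 by (simp add: N'_def)
    then show ?thesis using Q_lt_gain_weak[OF u(1) v(1,2)] by linarith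
  qed
  \<comment> \<open>Both differences have \<open>c\<close> members, so \<open>c\<close> cancels from
    the comparison of their weights.\<close>
  define c where "c = real (card (D - St u v))"
  have cc: "real (card (St u v - D)) = c" using card_exchange[OF u(1) v(1,2)] by (simp add: c_def)
  have "b * (1 - \<rho>) ^ r \<le> prod x e" if e: "e \<in> D - St u v" for e
  proof -
    have e': "e \<subseteq> V" "card e = r" "finite e" using edgeD[of e u v] e by auto
    have nb: "\<not> (u \<in> e \<and> v \<in> e)" using e Dsub by (auto simp: St_def)
    have "b \<le> prod x (e \<inter> {u, v})"
    proof -
      consider "e \<inter> {u, v} = {}" | "e \<inter> {u, v} = {u}" | "e \<inter> {u, v} = {v}" using nb by blast
      then show ?thesis using ab by cases (auto simp: a_def b_def)
    qed
    moreover have "(1 - \<rho>) ^ r \<le> prod x (e - {u, v})"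
    proof (rule prod_ge_power)
      fix i assume "i \<in> e - {u, v}"
      then have "i \<in> V - {u, v}" using e'(1) by blast
      then have "\<bar>x i - 1\<bar> \<le> \<rho>" by (rule R)
      then show "1 - \<rho> \<le> x i" by linarith
    qed (use e' \<rho> card_mono[of e "e - {u, v}"] in auto)
    ultimately have "b * (1 - \<rho>) ^ r \<le> prod x (e \<inter> {u, v}) * prod x (e - {u, v})"
      using e' \<rho> by (intro mult_mono prod_x_nonneg zero_le_power) auto
    also have "\<dots> = prod x e" using prod.Int_Diff[OF e'(3)] by metis
    finally show ?thesis .
  qed
  then have "c * (b * (1 - \<rho>) ^ r) \<le> (\<Sum>e\<in>D - St u v. prod x e)"
    using sum_mono[of "D - St u v" "\<lambda>_. b * (1 - \<rho>) ^ r" "prod x"] by (simp add: c_def)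
  moreover have "(\<Sum>e\<in>St u v - D. prod x e) \<le> c * (b * a * (1 + \<rho>) ^ r)"
  proof -
    have "(\<Sum>e\<in>St u v - D. prod x e) \<le> (\<Sum>e\<in>St u v - D. b * a * (1 + \<rho>) ^ r)"
    proof (rule sum_mono)
      fix e assume "e \<in> St u v - D"
      then have "e \<in> St u v" by blast
      then show "prod x e \<le> b * a * (1 + \<rho>) ^ r"
        unfolding a_def b_def using prod_St_le[OF _ u(1) v(1,2) _ x\<rho>] \<rho>(1) by simp
    qed
    then show ?thesis using cc by simp
  qed
  ultimately have "0 < (c * b) * (a * (1 + \<rho>) ^ r - (1 - \<rho>) ^ r)"
    using gpos unfolding gain_def by (simp add: algebra_simps)
  then have "(1 - \<rho>) ^ r < a * (1 + \<rho>) ^ r"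
  proof -
    assume *: "0 < (c * b) * (a * (1 + \<rho>) ^ r - (1 - \<rho>) ^ r)"
    then have "c * b \<noteq> 0" by auto
    moreover have "0 \<le> c * b" using ab by (simp add: c_def)
    ultimately have "0 < c * b" by linarith
    with * have "0 < a * (1 + \<rho>) ^ r - (1 - \<rho>) ^ r" by (rule zero_less_mult_pos)
    then show ?thesis by linarith
  qed
  \<comment> \<open>Bernoulli's inequality combined with
    \<open>(1 - 2 * \<rho>) * (1 + \<rho>) \<le> 1 - \<rho>\<close>.\<close>
  moreover have "(1 - 2 * real r * \<rho>) * (1 + \<rho>) ^ r \<le> (1 - \<rho>) ^ r"
  proof -
    have "1 + real r * (- (2 * \<rho>)) \<le> (1 + - (2 * \<rho>)) ^ r" by (rule Bernoulli_inequality) (use \<rho> in simp)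
    then have "1 - 2 * real r * \<rho> \<le> (1 - 2 * \<rho>) ^ r" by (simp add: mult_ac)
    then have "(1 - 2 * real r * \<rho>) * (1 + \<rho>) ^ r \<le> (1 - 2 * \<rho>) ^ r * (1 + \<rho>) ^ r"
      using \<rho> by (intro mult_right_mono) auto
    also have "\<dots> = ((1 - 2 * \<rho>) * (1 + \<rho>)) ^ r" by (simp add: power_mult_distrib)
    also have "\<dots> \<le> (1 - \<rho>) ^ r"
    proof (rule power_mono)
      show "(1 - 2 * \<rho>) * (1 + \<rho>) \<le> 1 - \<rho>" by (simp add: algebra_simps)
      show "0 \<le> (1 - 2 * \<rho>) * (1 + \<rho>)" using \<rho> by (intro mult_nonneg_nonneg) auto
    qed
    finally show ?thesis .
  qed
  ultimately have "(1 - 2 * real r * \<rho>) * (1 + \<rho>) ^ r < a * (1 + \<rho>) ^ r" by linarith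
  then have a: "1 - 2 * real r * \<rho> < a" using \<rho> by simp
  have r\<rho>: "\<rho> \<le> real r * \<rho>" using \<rho> r3 by simp
  show ?thesis
  proof (rule that[OF u(1)])
    show "x u \<le> 3 * real r * \<rho>" using s a r\<rho> unfolding a_def b_def by linarith
    fix i assume i: "i \<in> V - {u}"
    show "\<bar>x i - 1\<bar> \<le> 3 * real r * \<rho>"
    proof (cases "i = v")
      case True
      have "- (3 * real r * \<rho>) \<le> x v - 1" "x v - 1 \<le> 3 * real r * \<rho>"
        using a ab(4) r\<rho> \<rho>(1) unfolding a_def by linarith+
      then show ?thesis unfolding True by (intro abs_leI) linarith+
    next
      case False
      then have "\<bar>x i - 1\<bar> \<le> \<rho>" using i by (intro R) simp
      moreover have "\<rho> \<le> 3 * real r * \<rho>" using r\<rho> \<rho>(1) by linarith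
      ultimately show ?thesis by (rule order_trans)
    qed
  qed
qed

end

section \<open>Almost uniform weightings\<close>

lemma exp_minus_le_quadratic:
  fixes s :: real
  assumes "\<bar>s\<bar> \<le> 1"
  shows "exp (- s) \<le> 1 - s + s\<^sup>2"
proof (cases "0 \<le> s")
  case True
  have "1 \<le> (1 - s + s\<^sup>2) * (1 + s)"
    using True by (simp add: algebra_simps power2_eq_square)
  also have "\<dots> \<le> (1 - s + s\<^sup>2) * exp s"
  proof (rule mult_left_mono[OF exp_ge_add_one_self])
    show "0 \<le> 1 - s + s\<^sup>2" using assms by (smt (verit) zero_le_power2)
  qed
  finally show ?thesis by (simp add: exp_minus field_simps)
next
  case False
  then show ?thesis using exp_bound[of "- s"] assms by simp
qed

text \<open>Pass to the exponential of minus the sum, expand it to second order, and bound the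
  squared sum by Cauchy-Schwarz. The bound on \<open>card A * p\<close> keeps the exponent in the
  range of the expansion.\<close>

lemma prod_one_minus_le:
  fixes y :: "'a \<Rightarrow> real"
  assumes "\<And>i. i \<in> A \<Longrightarrow> \<bar>y i\<bar> \<le> p" "real (card A) * p \<le> 1" "p \<le> 1" "card A \<le> r"
  shows "(\<Prod>i\<in>A. 1 - y i) \<le> 1 - (\<Sum>i\<in>A. y i) + real r * (\<Sum>i\<in>A. (y i)\<^sup>2)"
proof (cases "finite A")
  case fin: True
  have "(\<Prod>i\<in>A. 1 - y i) \<le> (\<Prod>i\<in>A. exp (- y i))"
  proof (rule prod_mono)
    fix i assume "i \<in> A"
    then show "0 \<le> 1 - y i \<and> 1 - y i \<le> exp (- y i)"
      using assms(1)[of i] assms(3) exp_ge_add_one_self[of "- y i"] by auto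
  qed
  also have "\<dots> = exp (- (\<Sum>i\<in>A. y i))"
    using fin by (simp add: exp_sum flip: sum_negf)
  also have "\<dots> \<le> 1 - (\<Sum>i\<in>A. y i) + (\<Sum>i\<in>A. y i)\<^sup>2"
  proof (rule exp_minus_le_quadratic)
    have "\<bar>\<Sum>i\<in>A. y i\<bar> \<le> (\<Sum>i\<in>A. \<bar>y i\<bar>)" by (rule sum_abs)
    also have "\<dots> \<le> real (card A) * p" using sum_mono[of A "\<lambda>i. \<bar>y i\<bar>" "\<lambda>_. p"] assms(1) by simp
    finally show "\<bar>\<Sum>i\<in>A. y i\<bar> \<le> 1" using assms(2) by simp
  qed
  also have "(\<Sum>i\<in>A. y i)\<^sup>2 \<le> (\<Sum>i\<in>A. (y i)\<^sup>2) * real (card A)"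
    by (rule sum_squared_le_sum_of_squares)
  also have "\<dots> \<le> (\<Sum>i\<in>A. (y i)\<^sup>2) * real r"
    using assms(4) by (intro mult_left_mono) (auto intro: sum_nonneg)
  finally show ?thesis by (simp add: mult.commute)
qed simp

text \<open>For arguments up to \<open>1 / 2\<close> in absolute value, \<open>ln (1 - y)\<close> is
  at least \<open>- y - 2 * y^2\<close>; summing and using \<open>1 + z \<le> exp z\<close> gives
  the bound.\<close>

lemma prod_one_minus_ge:
  fixes y :: "'a \<Rightarrow> real"
  assumes "\<And>i. i \<in> A \<Longrightarrow> \<bar>y i\<bar> \<le> 1 / 2"
  shows "1 - (\<Sum>i\<in>A. y i + 2 * (y i)\<^sup>2) \<le> (\<Prod>i\<in>A. 1 - y i)"
proof (cases "finite A")
  case fin: True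
  have "1 - (\<Sum>i\<in>A. y i + 2 * (y i)\<^sup>2) \<le> exp (- (\<Sum>i\<in>A. y i + 2 * (y i)\<^sup>2))"
    using exp_ge_add_one_self[of "- (\<Sum>i\<in>A. y i + 2 * (y i)\<^sup>2)"] by simp
  also have "\<dots> = (\<Prod>i\<in>A. exp (- (y i + 2 * (y i)\<^sup>2)))"
    using fin by (simp add: exp_sum flip: sum_negf)
  also have "\<dots> \<le> (\<Prod>i\<in>A. 1 - y i)"
  proof (rule prod_mono)
    fix i assume i: "i \<in> A"
    then have "- (y i + 2 * (y i)\<^sup>2) \<le> ln (1 - y i)"
      using abs_ln_one_plus_x_minus_x_bound[of "- y i"] assms[OF i] by simp
    moreover have "0 < 1 - y i" using assms[OF i] by simp
    ultimately have "exp (- (y i + 2 * (y i)\<^sup>2)) \<le> 1 - y i" by (metis exp_le_cancel_iff exp_ln)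
    then show "0 \<le> exp (- (y i + 2 * (y i)\<^sup>2)) \<and> exp (- (y i + 2 * (y i)\<^sup>2)) \<le> 1 - y i" by simp
  qed
  finally show ?thesis .
qed simp

text \<open>Any two members that meet in \<open>k\<close> points share \<open>k * (k - 1) \<ge> k - 1\<close> ordered pairs.\<close>
lemma sum_degree_squares_le:
  fixes F :: "'e set" and B :: "'e \<Rightarrow> 'a set"
  assumes fF: "finite F" and fR: "finite R"
    and B: "\<And>e. e \<in> F \<Longrightarrow> B e \<subseteq> R" "\<And>e. e \<in> F \<Longrightarrow> card (B e) \<le> r"
    and cod: "\<And>i j. i \<in> R \<Longrightarrow> j \<in> R \<Longrightarrow> i \<noteq> j \<Longrightarrow> real (card {e\<in>F. i \<in> B e \<and> j \<in> B e}) \<le> q"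
    and q: "0 \<le> q"
  shows "(\<Sum>i\<in>R. (real (card {e\<in>F. i \<in> B e}))\<^sup>2) \<le> real (card F) * (real (card F) + real r ^ 2 * q)"
proof -
  define d where "d i = real (card {e\<in>F. i \<in> B e})" for i
  have one: "(\<Sum>i\<in>B e. d i) \<le> real (card F) + real r ^ 2 * q" if e: "e \<in> F" for e
  proof -
    have fB: "finite (B e')" if "e' \<in> F" for e' using B(1)[OF that] fR finite_subset by blast
    \<comment> \<open>The ordered pairs of distinct points in \<open>B e\<close>: the excess of each
      intersection over 1 is charged to them, and each pair is charged at most \<open>q\<close>
      times.\<close>
    define Z where "Z = {z\<in>B e \<times> B e. fst z \<noteq> snd z}"
    have fZ: "finite Z" using fB[OF e] by (simp add: Z_def)
    have "(\<Sum>i\<in>B e. d i) = (\<Sum>i\<in>B e. \<Sum>e'\<in>{e'\<in>F. i \<in> B e'}. 1)" by (simp add: d_def)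
    also have "\<dots> = (\<Sum>e'\<in>F. \<Sum>i\<in>{i\<in>B e. i \<in> B e'}. 1)"
      by (rule sum.swap_restrict) (use fB e fF in auto)
    also have "\<dots> \<le> (\<Sum>e'\<in>F. 1 + (\<Sum>z\<in>{z\<in>Z. fst z \<in> B e' \<and> snd z \<in> B e'}. 1))"
    proof (rule sum_mono)
      fix e' assume e': "e' \<in> F"
      define C where "C = {i\<in>B e. i \<in> B e'}"
      have fC: "finite C" using fB[OF e] by (simp add: C_def)
      have "{z\<in>Z. fst z \<in> B e' \<and> snd z \<in> B e'} = C \<times> C - (\<lambda>i. (i, i)) ` C"
        by (auto simp: Z_def C_def)
      then have "card {z\<in>Z. fst z \<in> B e' \<and> snd z \<in> B e'} = card C * card C - card C"
        using fC by (simp add: card_Diff_subset card_image inj_on_def card_cartesian_product image_subset_iff)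
      moreover have "card C \<le> 1 + (card C * card C - card C)"
        by (cases "card C") (auto simp: algebra_simps)
      ultimately have "card C \<le> 1 + card {z\<in>Z. fst z \<in> B e' \<and> snd z \<in> B e'}" by simp
      then have "real (card C) \<le> 1 + real (card {z\<in>Z. fst z \<in> B e' \<and> snd z \<in> B e'})" by simp
      then show "(\<Sum>i\<in>{i\<in>B e. i \<in> B e'}. 1) \<le> 1 + (\<Sum>z\<in>{z\<in>Z. fst z \<in> B e' \<and> snd z \<in> B e'}. 1::real)"
        by (simp add: C_def)
    qed
    also have "\<dots> = real (card F) + (\<Sum>z\<in>Z. \<Sum>e'\<in>{e'\<in>F. fst z \<in> B e' \<and> snd z \<in> B e'}. 1)"
      unfolding sum.distrib using sum.swap_restrict[OF fF fZ, of "\<lambda>_ _. 1::real" "\<lambda>e' z. fst z \<in> B e' \<and> snd z \<in> B e'"]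
      by simp
    also have "\<dots> \<le> real (card F) + real r ^ 2 * q"
    proof -
      have "(\<Sum>z\<in>Z. \<Sum>e'\<in>{e'\<in>F. fst z \<in> B e' \<and> snd z \<in> B e'}. 1) \<le> (\<Sum>z\<in>Z. q)"
      proof (rule sum_mono)
        fix z assume "z \<in> Z"
        then have "fst z \<in> R" "snd z \<in> R" "fst z \<noteq> snd z" using B(1)[OF e] by (auto simp: Z_def)
        then show "(\<Sum>e'\<in>{e'\<in>F. fst z \<in> B e' \<and> snd z \<in> B e'}. 1) \<le> q"
          using cod[of "fst z" "snd z"] by simp
      qed
      also have "\<dots> = real (card Z) * q" by simp
      also have "\<dots> \<le> real r ^ 2 * q"
      proof (rule mult_right_mono[OF _ q])
        have "card Z \<le> card (B e \<times> B e)" using fB[OF e] by (intro card_mono) (auto simp: Z_def)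
        also have "\<dots> \<le> r * r" using B(2)[OF e] by (simp add: card_cartesian_product mult_le_mono)
        finally show "real (card Z) \<le> real r ^ 2" unfolding power2_eq_square by (metis of_nat_le_iff of_nat_mult)
      qed
      finally show ?thesis by simp
    qed
    finally show ?thesis .
  qed
  have "(\<Sum>i\<in>R. (d i)\<^sup>2) = (\<Sum>i\<in>R. \<Sum>e\<in>{e\<in>F. i \<in> B e}. d i)"
    by (simp add: d_def power2_eq_square)
  also have "\<dots> = (\<Sum>e\<in>F. \<Sum>i\<in>B e. d i)"
    using sum_over_members[OF fF fR B(1), where f = "\<lambda>i _. d i"] by simp
  also have "\<dots> \<le> (\<Sum>e\<in>F. real (card F) + real r ^ 2 * q)" by (rule sum_mono[OF one])
  finally show ?thesis by (simp add: d_def)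
qed

lemma sum_degrees:
  assumes "finite F" "finite R" "\<And>e. e \<in> F \<Longrightarrow> B e \<subseteq> R" "\<And>e. e \<in> F \<Longrightarrow> card (B e) \<le> r"
  shows "(\<Sum>i\<in>R. real (card {e\<in>F. i \<in> B e})) \<le> real r * real (card F)"
proof -
  have "(\<Sum>i\<in>R. real (card {e\<in>F. i \<in> B e})) = (\<Sum>e\<in>F. real (card (B e)))"
    using sum_over_members[OF assms(1-3), where f = "\<lambda>_ _. 1"] by simp
  also have "\<dots> \<le> (\<Sum>e\<in>F. real r)" using assms(4) by (intro sum_mono) simp
  finally show ?thesis by (simp add: mult.commute)
qed

lemma sum_squares_le_max:
  fixes d :: "'a \<Rightarrow> real"
  assumes "\<And>i. i \<in> R \<Longrightarrow> 0 \<le> d i" "\<And>i. i \<in> R \<Longrightarrow> d i \<le> M"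
  shows "(\<Sum>i\<in>R. (d i)\<^sup>2) \<le> M * sum d R"
  unfolding sum_distrib_left power2_eq_square using assms by (intro sum_mono mult_right_mono) auto

section \<open>Contradiction for almost uniform weightings\<close>

context heavy_missing
begin

text \<open>To first order the gain is \<open>- b * c * (1 - a)\<close> plus a linear form in the
  defects \<open>y i\<close> with coefficients \<open>b * g i\<close>. It has to exceed nearly
  \<open>N / 2\<close> times \<open>Q u v\<close>. Completing squares eliminates all deviations and
  leaves an inequality between \<open>c\<close>, the \<open>g i\<close> and \<open>N\<close>, which
  \<open>main\<close> refutes.\<close>

lemma no_almost_uniform:
  defines "\<rho> \<equiv> 1 / (32 * real r ^ 2)"
  assumes T: "18 * real r ^ 4 \<le> real T" and u: "u \<in> V" "x u \<le> \<rho>"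
    and near: "\<And>i. i \<in> V - {u} \<Longrightarrow> \<bar>x i - 1\<bar> \<le> \<rho>"
  shows False
proof -
  have r1: "3 \<le> real r" using r3 by simp
  have r2: "9 \<le> real r ^ 2" using power_mono[OF r1, of 2] by simp
  have \<rho>: "0 < \<rho>" "real r * \<rho> = 1 / (32 * real r)" "real r * \<rho> \<le> 1 / 96" "\<rho> \<le> 1 / 288"
  proof -
    show "0 < \<rho>" using r1 by (simp add: \<rho>_def)
    show eq: "real r * \<rho> = 1 / (32 * real r)" using r1 by (simp add: \<rho>_def power2_eq_square)
    show "real r * \<rho> \<le> 1 / 96" unfolding eq using r1 by (intro divide_left_mono) auto
    show "\<rho> \<le> 1 / 288" unfolding \<rho>_def using r2 r3 by (intro divide_left_mono) auto
  qed
  have ne: "V - {u} \<noteq> {}"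
  proof
    assume "V - {u} = {}"
    then have "V \<subseteq> {u}" by blast
    then have "card V \<le> 1" using card_mono[of "{u}" V] by simp
    then show False using cV Tpos by simp
  qed
  \<comment> \<open>Maximising the codegree with \<open>u\<close> among the missing sets caps every
    other such codegree at \<open>N - c\<close>, since \<open>deg v\<close> itself equals
    \<open>N - c\<close>.\<close>
  define deg where "deg i = card {e\<in>D. u \<in> e \<and> i \<in> e}" for i
  have fimg: "finite (deg ` (V - {u}))" "deg ` (V - {u}) \<noteq> {}" using finV ne by auto
  then obtain v where v0: "v \<in> V - {u}" "deg v = Max (deg ` (V - {u}))"
    using Max_in[OF fimg] unfolding image_iff by metis
  have v: "v \<in> V" "u \<noteq> v" using v0(1) by auto
  have vmax: "deg i \<le> deg v" if "i \<in> V - {u}" for i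
    using that fimg v0(2) by simp
  define R where "R = V - {u, v}"
  have fR: "finite R" using finV by (simp add: R_def)
  define a b y where "a = x v" and "b = x u" and "y = (\<lambda>i. 1 - x i)"
  define FA FB FU where "FA = St u v - D" and "FB = D - St u v" and "FU = {e\<in>FB. u \<in> e}"
  have fin: "finite FA" "finite FB" "finite FU"
    using finD finSt by (auto simp: FA_def FB_def FU_def)
  \<comment> \<open>A set of \<open>FB\<close> that avoids \<open>u\<close> has weight close to 1,
    hence at least \<open>b\<close>. Giving it the empty \<open>B e\<close> expresses just this
    bound, without a first-order term.\<close>
  define A B where "A = (\<lambda>e::'a set. e - {u, v})" and "B = (\<lambda>e. if u \<in> e then e - {u} else {})"
  have edges: "e \<subseteq> V" "card e = r" "finite e" if "e \<in> FA \<or> e \<in> FB" for e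
    using edgeD[of e u v] that by (auto simp: FA_def FB_def)
  have AR: "A e \<subseteq> R" "card (A e) \<le> r" if "e \<in> FA" for e
    using edges[of e] that card_mono[of e "A e"] by (auto simp: A_def R_def)
  have FUv: "v \<notin> e" if "e \<in> FU" for e
    using that Dsub by (auto simp: FU_def FB_def St_def)
  have BR: "B e \<subseteq> R" "card (B e) \<le> r" if "e \<in> FB" for e
  proof -
    show "B e \<subseteq> R" using FUv[of e] edges(1)[of e] that by (auto simp: B_def R_def FU_def)
    show "card (B e) \<le> r" using edges[of e] that card_mono[of e "B e"] by (auto simp: B_def)
  qed
  define c where "c = real (card FB)"
  have cA: "real (card FA) = c"
    using card_exchange[OF u(1) v] by (simp add: c_def FA_def FB_def)
  have c0: "0 \<le> c" by (simp add: c_def)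
  have ND: "real (card D) = N" by (simp add: cD N_def)
  have cdeg: "c = N - real (deg v)"
  proof -
    have "{e\<in>D. u \<in> e \<and> v \<in> e} = D \<inter> St u v" using Dsub by (auto simp: St_def)
    then have "card FB = card D - deg v" "deg v \<le> card D"
      using finD by (auto simp: FB_def deg_def card_Diff_subset_Int intro: card_mono)
    then show ?thesis using ND by (simp add: c_def of_nat_diff)
  qed
  have cN: "c \<le> N" using cdeg by simp
  define dA dB where "dA i = real (card {e\<in>FA. i \<in> A e})" and "dB i = real (card {e\<in>FB. i \<in> B e})" for i
  have dBU: "dB i = real (card {e\<in>FU. i \<in> e - {u}})" for i
  proof -
    have "{e\<in>FB. i \<in> B e} = {e\<in>FU. i \<in> e - {u}}" by (auto simp: B_def FU_def split: if_splits)
    then show ?thesis by (simp add: dB_def)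
  qed
  have d0: "0 \<le> dA i" "0 \<le> dB i" for i by (simp_all add: dA_def dB_def)
  have dc: "dA i \<le> c" "dB i \<le> c" for i
    using card_mono[OF fin(1), of "{e\<in>FA. i \<in> A e}"] card_mono[OF fin(2), of "{e\<in>FB. i \<in> B e}"] cA
    by (auto simp: dA_def dB_def c_def)
  have yR: "\<bar>y i\<bar> \<le> \<rho>" if "i \<in> R" for i using near[of i] that by (auto simp: y_def R_def)
  have xy: "prod x f = (\<Prod>i\<in>f. 1 - y i)" for f by (simp add: y_def)
  have b: "0 < b" "b \<le> \<rho>" using u xpos by (auto simp: b_def)
  have a: "0 < a" "a \<le> 2" "1 - \<rho> \<le> a"
    using near[OF v0(1)] xpos[OF v(1)] \<rho> by (auto simp: a_def)

  have FAle: "prod x e \<le> b * a * (1 - (\<Sum>i\<in>A e. y i) + real r * (\<Sum>i\<in>A e. (y i)\<^sup>2))" if e: "e \<in> FA" for e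
  proof -
    have "prod x e = b * a * prod x (A e)"
      using prod_St_eq[of e u v] e v by (simp add: FA_def A_def a_def b_def)
    moreover have "prod x (A e) \<le> 1 - (\<Sum>i\<in>A e. y i) + real r * (\<Sum>i\<in>A e. (y i)\<^sup>2)"
      unfolding xy
    proof (rule prod_one_minus_le)
      show "\<bar>y i\<bar> \<le> \<rho>" if "i \<in> A e" for i using yR AR[OF e] that by blast
      have "real (card (A e)) * \<rho> \<le> real r * \<rho>" using AR(2)[OF e] \<rho>(1) by (intro mult_right_mono) auto
      then show "real (card (A e)) * \<rho> \<le> 1" using \<rho>(3) by linarith
      show "\<rho> \<le> 1" "card (A e) \<le> r" using \<rho>(4) AR(2)[OF e] by auto
    qed
    ultimately show ?thesis using a b by (simp add: mult_left_mono)
  qed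
  have FBge: "b * (1 - (\<Sum>i\<in>B e. y i + 2 * (y i)\<^sup>2)) \<le> prod x e" if e: "e \<in> FB" for e
  proof (cases "u \<in> e")
    case True
    have fe: "finite e" using edges(3) e by blast
    have "prod x e = b * prod x (B e)"
      using True prod.remove[OF fe True, of x] by (simp add: B_def b_def)
    moreover have "1 - (\<Sum>i\<in>B e. y i + 2 * (y i)\<^sup>2) \<le> prod x (B e)"
      unfolding xy
    proof (rule prod_one_minus_ge)
      fix i assume "i \<in> B e"
      then have "\<bar>y i\<bar> \<le> \<rho>" using yR BR[OF e] by blast
      then show "\<bar>y i\<bar> \<le> 1 / 2" using \<rho>(4) by linarith
    qed
    ultimately show ?thesis using b by (simp add: mult_left_mono)
  next
    case False
    have "(1 - \<rho>) ^ r \<le> prod x e"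
    proof (rule prod_ge_power)
      fix i assume "i \<in> e"
      then have "i \<in> V - {u}" using False edges(1)[of e] e by blast
      from near[OF this] show "1 - \<rho> \<le> x i" by linarith
    qed (use edges[of e] e \<rho> in auto)
    moreover have "1 + real r * (- \<rho>) \<le> (1 + - \<rho>) ^ r"
      by (rule Bernoulli_inequality) (use \<rho> in simp)
    ultimately have "b \<le> prod x e" using b \<rho>(3,4) by simp
    then show ?thesis using False by (simp add: B_def)
  qed
  have swapA: "(\<Sum>e\<in>FA. \<Sum>i\<in>A e. f i) = (\<Sum>i\<in>R. dA i * f i)" for f :: "'a \<Rightarrow> real"
    using sum_over_members[OF fin(1) fR AR(1), where f = "\<lambda>i _. f i"] by (simp add: dA_def)
  have swapB: "(\<Sum>e\<in>FB. \<Sum>i\<in>B e. f i) = (\<Sum>i\<in>R. dB i * f i)" for f :: "'a \<Rightarrow> real"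
    using sum_over_members[OF fin(2) fR BR(1), where f = "\<lambda>i _. f i"] by (simp add: dB_def)
  \<comment> \<open>\<open>b * g i\<close> is the coefficient of \<open>y i\<close> in the linear
    part of the upper bound for the gain.\<close>
  define g where "g i = dB i - a * dA i" for i
  have up: "(\<Sum>e\<in>FA. prod x e) \<le> b * a * (c - (\<Sum>i\<in>R. dA i * y i) + real r * (\<Sum>i\<in>R. dA i * (y i)\<^sup>2))"
  proof -
    have "(\<Sum>e\<in>FA. prod x e) \<le> (\<Sum>e\<in>FA. b * a * (1 - (\<Sum>i\<in>A e. y i) + real r * (\<Sum>i\<in>A e. (y i)\<^sup>2)))"
      by (rule sum_mono[OF FAle])
    also have "\<dots> = b * a * (\<Sum>e\<in>FA. 1 - (\<Sum>i\<in>A e. y i) + real r * (\<Sum>i\<in>A e. (y i)\<^sup>2))"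
      by (rule sum_distrib_left[symmetric])
    also have "(\<Sum>e\<in>FA. 1 - (\<Sum>i\<in>A e. y i) + real r * (\<Sum>i\<in>A e. (y i)\<^sup>2))
      = c - (\<Sum>i\<in>R. dA i * y i) + real r * (\<Sum>i\<in>R. dA i * (y i)\<^sup>2)"
      unfolding sum.distrib sum_subtractf swapA[symmetric] by (simp add: sum_distrib_left cA)
    finally show ?thesis .
  qed
  have low: "b * (c - (\<Sum>i\<in>R. dB i * (y i + 2 * (y i)\<^sup>2))) \<le> (\<Sum>e\<in>FB. prod x e)"
  proof -
    have "b * (c - (\<Sum>i\<in>R. dB i * (y i + 2 * (y i)\<^sup>2))) = b * (\<Sum>e\<in>FB. 1 - (\<Sum>i\<in>B e. y i + 2 * (y i)\<^sup>2))"
      unfolding sum_subtractf swapB[symmetric] by (simp add: c_def)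
    also have "\<dots> = (\<Sum>e\<in>FB. b * (1 - (\<Sum>i\<in>B e. y i + 2 * (y i)\<^sup>2)))"
      by (rule sum_distrib_left)
    also have "\<dots> \<le> (\<Sum>e\<in>FB. prod x e)" by (rule sum_mono[OF FBge])
    finally show ?thesis .
  qed
  \<comment> \<open>All quadratic errors carry the factor \<open>b \<le> \<rho>\<close> and degrees
    at most \<open>N\<close>, so they fit into a small multiple of \<open>N * (y i)\<^sup>2\<close>
    that the stability loss can absorb.\<close>
  have gain_le: "gain u v \<le> - b * c * (1 - a) + (\<Sum>i\<in>R. b * g i * y i + 3 * real r * \<rho> * N * (y i)\<^sup>2)"
  proof -
    have "gain u v \<le> b * a * (c - (\<Sum>i\<in>R. dA i * y i) + real r * (\<Sum>i\<in>R. dA i * (y i)\<^sup>2))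
      - b * (c - (\<Sum>i\<in>R. dB i * (y i + 2 * (y i)\<^sup>2)))"
      using up low by (simp add: gain_def FA_def FB_def)
    also have "\<dots> = - b * c * (1 - a) + (\<Sum>i\<in>R. b * g i * y i + b * (2 * dB i + a * real r * dA i) * (y i)\<^sup>2)"
      by (simp add: g_def algebra_simps sum.distrib sum_subtractf sum_distrib_left)
    also have "\<dots> \<le> - b * c * (1 - a) + (\<Sum>i\<in>R. b * g i * y i + 3 * real r * \<rho> * N * (y i)\<^sup>2)"
    proof (intro add_left_mono sum_mono mult_right_mono)
      fix i
      have "a * real r * dA i \<le> 2 * real r * N"
        using a d0 dc[of i] cN by (intro mult_mono) auto
      moreover have "2 * dB i \<le> real r * N" 
        using dc[of i] cN d0 r1 by (intro mult_mono) auto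
      ultimately have "2 * dB i + a * real r * dA i \<le> 3 * real r * N" by linarith
      then have "b * (2 * dB i + a * real r * dA i) \<le> \<rho> * (3 * real r * N)"
        using a b d0 \<rho> by (intro mult_mono) auto
      then show "b * (2 * dB i + a * real r * dA i) \<le> 3 * real r * \<rho> * N" by (simp add: mult_ac)
    qed simp
    finally show ?thesis .
  qed

  define \<eta> where "\<eta> = real r / real T"
  have \<eta>: "0 \<le> \<eta>" "real r ^ 2 * \<eta> \<le> 1 / (18 * real r)" "\<eta> \<le> 1 / (162 * real r)"
  proof -
    show "0 \<le> \<eta>" by (simp add: \<eta>_def)
    have "real r ^ 2 * \<eta> = real r ^ 3 / real T" by (simp add: \<eta>_def power2_eq_square power3_eq_cube)
    also have "\<dots> \<le> real r ^ 3 / (18 * real r ^ 4)"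
      using T r1 Tpos by (intro divide_left_mono) auto
    also have "\<dots> = 1 / (18 * real r)" using r1 by (simp add: power_numeral_reduce)
    finally show le: "real r ^ 2 * \<eta> \<le> 1 / (18 * real r)" .
    have "9 * \<eta> \<le> real r ^ 2 * \<eta>" using r2 by (intro mult_right_mono) (simp_all add: \<eta>_def)
    with le have "9 * \<eta> \<le> 1 / (18 * real r)" by linarith
    then show "\<eta> \<le> 1 / (162 * real r)" by simp
  qed
  have cod3: "real (card {e\<in>F. i \<in> e \<and> j \<in> e \<and> k \<in> e}) \<le> \<eta> * N"
    if "F \<subseteq> ksub r V" "i \<in> V" "j \<in> V" "k \<in> V" "i \<noteq> j" "i \<noteq> k" "j \<noteq> k" for F i j k
  proof -
    have "card {e\<in>F. i \<in> e \<and> j \<in> e \<and> k \<in> e} \<le> card {e\<in>ksub r V. {i, j, k} \<subseteq> e}"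
      using that finV by (intro card_mono) auto
    moreover have "real (card {e\<in>ksub r V. {i, j, k} \<subseteq> e}) \<le> \<eta> * N"
      unfolding \<eta>_def using that by (intro codegree3) auto
    ultimately show ?thesis by linarith
  qed
  \<comment> \<open>Every degree \<open>dA i\<close> counts sets through the three vertices
    \<open>u, v, i\<close>, so this contribution is of lower order.\<close>
  have sA: "(\<Sum>i\<in>R. (dA i)\<^sup>2) \<le> real r * \<eta> * N * c"
  proof -
    have "dA i \<le> \<eta> * N" if i: "i \<in> R" for i
    proof -
      have "{e\<in>FA. i \<in> A e} = {e\<in>FA. u \<in> e \<and> v \<in> e \<and> i \<in> e}"
        using i by (auto simp: A_def R_def FA_def St_def)
      moreover have "FA \<subseteq> ksub r V" by (auto simp: FA_def St_def)
      ultimately show ?thesis using cod3[of FA u v i] u v i by (auto simp: dA_def R_def)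
    qed
    then have "(\<Sum>i\<in>R. (dA i)\<^sup>2) \<le> \<eta> * N * sum dA R" using d0 by (intro sum_squares_le_max)
    also have "\<dots> \<le> \<eta> * N * (real r * c)"
      using sum_degrees[OF fin(1) fR AR] cA \<eta> N_pos by (intro mult_left_mono) (auto simp: dA_def)
    finally show ?thesis by (simp add: mult_ac)
  qed
  \<comment> \<open>\<open>sB1\<close> is good enough unless \<open>c\<close> is close to \<open>N\<close>; then all codegrees with \<open>u\<close> are small, as
    \<open>v\<close> maximises them, and \<open>sB2\<close> takes over.\<close>
  have sB1: "(\<Sum>i\<in>R. (dB i)\<^sup>2) \<le> c * (c + real r ^ 2 * (\<eta> * N))"
  proof -
    have FU: "card FU \<le> card FB" using fin by (intro card_mono) (auto simp: FU_def)
    have "(\<Sum>i\<in>R. (dB i)\<^sup>2) \<le> real (card FU) * (real (card FU) + real r ^ 2 * (\<eta> * N))"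
      unfolding dBU
    proof (rule sum_degree_squares_le[OF fin(3) fR])
      show "e - {u} \<subseteq> R" "card (e - {u}) \<le> r" if "e \<in> FU" for e
        using BR[of e] that by (auto simp: FU_def B_def)
      show "0 \<le> \<eta> * N" using \<eta> N_pos by simp
      fix i j assume ij: "i \<in> R" "j \<in> R" "i \<noteq> j"
      then have "{e\<in>FU. i \<in> e - {u} \<and> j \<in> e - {u}} = {e\<in>FU. u \<in> e \<and> i \<in> e \<and> j \<in> e}"
        by (auto simp: R_def FU_def)
      moreover have "FU \<subseteq> ksub r V" using Dsub by (auto simp: FU_def FB_def)
      ultimately show "real (card {e\<in>FU. i \<in> e - {u} \<and> j \<in> e - {u}}) \<le> \<eta> * N"
        using cod3[of FU u i j] u ij by (auto simp: R_def)
    qed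
    also have "\<dots> \<le> c * (c + real r ^ 2 * (\<eta> * N))"
      using FU \<eta> N_pos by (intro mult_mono) (auto simp: c_def)
    finally show ?thesis .
  qed
  have sB2: "(\<Sum>i\<in>R. (dB i)\<^sup>2) \<le> (N - c) * (real r * c)"
  proof -
    have "dB i \<le> N - c" if i: "i \<in> R" for i
    proof -
      have "card {e\<in>FU. i \<in> e - {u}} \<le> deg i"
        unfolding deg_def using finD by (intro card_mono) (auto simp: FU_def FB_def)
      then have "card {e\<in>FU. i \<in> e - {u}} \<le> deg v" using vmax[of i] i by (auto simp: R_def)
      then show ?thesis using cdeg by (simp add: dBU)
    qed
    then have "(\<Sum>i\<in>R. (dB i)\<^sup>2) \<le> (N - c) * sum dB R" using d0 by (intro sum_squares_le_max)
    also have "\<dots> \<le> (N - c) * (real r * c)"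
      using sum_degrees[OF fin(2) fR BR] cN by (intro mult_left_mono) (auto simp: dB_def c_def)
    finally show ?thesis .
  qed
  have sg: "(\<Sum>i\<in>R. (g i)\<^sup>2) \<le> (\<Sum>i\<in>R. (dB i)\<^sup>2) + 4 * (\<Sum>i\<in>R. (dA i)\<^sup>2)"
  proof -
    have "(g i)\<^sup>2 \<le> (dB i)\<^sup>2 + 4 * (dA i)\<^sup>2" for i
    proof -
      have "(a * dA i)\<^sup>2 \<le> (2 * dA i)\<^sup>2" using a d0[of i] by (intro power_mono mult_right_mono) auto
      moreover have "0 \<le> dB i * (a * dA i)" using a d0[of i] by simp
      ultimately show ?thesis by (simp add: g_def power2_diff power_mult_distrib)
    qed
    then show ?thesis by (simp add: sum_distrib_left sum_mono flip: sum.distrib)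
  qed
  \<comment> \<open>The left side is of size \<open>2 * N * c\<close> at most. Splitting at
    \<open>c = (1 - 1 / (2 * r)) * N\<close> saves \<open>1 / r\<close> in the first case and more
    in the second; \<open>1 / (3 * r)\<close> covers the lower-order errors.\<close>
  have main: "c\<^sup>2 + (\<Sum>i\<in>R. (g i)\<^sup>2) \<le> (2 - 1 / real r + 1 / (3 * real r)) * N * c"
  proof -
    have NC: "0 \<le> N * c" using N_pos c0 by simp
    have "4 * (real r * \<eta>) * (N * c) \<le> 4 / (54 * real r) * (N * c)"
    proof (rule mult_right_mono[OF _ NC])
      have "3 * (real r * \<eta>) \<le> real r * (real r * \<eta>)" using r1 \<eta> by (intro mult_right_mono) auto
      also have "\<dots> \<le> 1 / (18 * real r)" using \<eta>(2) by (simp add: power2_eq_square mult.assoc)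
      finally show "4 * (real r * \<eta>) \<le> 4 / (54 * real r)" by simp
    qed
    moreover have "4 * (\<Sum>i\<in>R. (dA i)\<^sup>2) \<le> 4 * (real r * \<eta>) * (N * c)" using sA by (simp add: mult_ac)
    ultimately have 1: "4 * (\<Sum>i\<in>R. (dA i)\<^sup>2) \<le> 4 / (54 * real r) * (N * c)" by linarith
    have 2: "c\<^sup>2 + (\<Sum>i\<in>R. (dB i)\<^sup>2) \<le> (2 - 1 / real r + 1 / (18 * real r)) * (N * c)"
    proof (cases "c \<le> (1 - 1 / (2 * real r)) * N")
      case True
      have "c\<^sup>2 + (\<Sum>i\<in>R. (dB i)\<^sup>2) \<le> 2 * c * c + (real r ^ 2 * \<eta>) * (N * c)"
        using sB1 by (simp add: power2_eq_square algebra_simps)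
      also have "\<dots> \<le> 2 * ((1 - 1 / (2 * real r)) * N) * c + 1 / (18 * real r) * (N * c)"
        using True c0 \<eta>(2) NC by (intro add_mono mult_right_mono mult_left_mono) auto
      also have "\<dots> = (2 - 1 / real r + 1 / (18 * real r)) * (N * c)"
        by (simp add: algebra_simps)
      finally show ?thesis .
    next
      case False
      then have "N - c \<le> 1 / (2 * real r) * N" by (simp add: algebra_simps)
      then have "(N - c) * (real r * c) \<le> (1 / (2 * real r) * N) * (real r * c)"
        using c0 by (intro mult_right_mono) auto
      also have "\<dots> = 1 / 2 * (N * c)" using r1 by simp
      finally have "(\<Sum>i\<in>R. (dB i)\<^sup>2) \<le> 1 / 2 * (N * c)" using sB2 by linarith
      moreover have "c\<^sup>2 \<le> N * c" using cN c0 by (simp add: power2_eq_square mult_right_mono)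
      ultimately have "c\<^sup>2 + (\<Sum>i\<in>R. (dB i)\<^sup>2) \<le> (3 / 2) * (N * c)" by linarith
      also have "\<dots> \<le> (2 - 1 / real r + 1 / (18 * real r)) * (N * c)"
        by (intro mult_right_mono[OF _ NC]) (use r1 in \<open>simp add: field_simps\<close>)
      finally show ?thesis .
    qed
    have "c\<^sup>2 + (\<Sum>i\<in>R. (g i)\<^sup>2) \<le> (2 - 1 / real r + 1 / (18 * real r)) * (N * c) + 4 / (54 * real r) * (N * c)"
      using 1 2 sg by linarith
    also have "\<dots> = (2 - 1 / real r + 1 / (18 * real r) + 4 / (54 * real r)) * (N * c)"
      by (rule distrib_right[symmetric])
    also have "\<dots> \<le> (2 - 1 / real r + 1 / (3 * real r)) * (N * c)"
      by (intro mult_right_mono[OF _ NC]) (use r1 in \<open>simp add: field_simps\<close>)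
    finally show ?thesis by simp
  qed

  define \<kappa>1 where "\<kappa>1 = (1 - \<rho>) ^ (r - 2) / 2 * N'"
  \<comment> \<open>What remains of the stability constant once the quadratic errors of
    \<open>gain_le\<close> are absorbed.\<close>
  define \<kappa> where "\<kappa> = \<kappa>1 - 3 * real r * \<rho> * N"
  \<comment> \<open>\<open>4 * \<kappa>\<close> falls short of \<open>2 * N\<close> by at most
    \<open>14 * r * \<rho> + 2 * \<eta>\<close> times \<open>N\<close>. The value
    \<open>1 / (32 * r^2)\<close> of \<rho> keeps this below the margin
    \<open>2 / (3 * r)\<close>.\<close>
  have \<kappa>4: "(2 - 1 / real r + 1 / (3 * real r)) * N \<le> 4 * \<kappa>"
  proof -
    have "1 - real r * \<rho> \<le> (1 - \<rho>) ^ (r - 2)"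
    proof -
      have "1 + real (r - 2) * (- \<rho>) \<le> (1 + - \<rho>) ^ (r - 2)"
        by (rule Bernoulli_inequality) (use \<rho> in simp)
      moreover have "real (r - 2) * \<rho> \<le> real r * \<rho>" using \<rho> by (intro mult_right_mono) auto
      ultimately show ?thesis by simp
    qed
    then have "(1 - real r * \<rho>) * ((1 - \<eta>) * N) \<le> (1 - \<rho>) ^ (r - 2) * N'"
      using N'_ge N_pos \<rho> Tpos unfolding \<eta>_def by (intro mult_mono) (auto simp: field_simps)
    moreover have "(1 - real r * \<rho> - \<eta>) * N \<le> (1 - real r * \<rho>) * ((1 - \<eta>) * N)"
    proof -
      have "0 \<le> real r * \<rho> * \<eta> * N" using \<rho> \<eta> N_pos by simp
      then show ?thesis by (simp add: algebra_simps)
    qed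
    ultimately have "(1 - real r * \<rho> - \<eta>) * N \<le> 2 * \<kappa>1" by (simp add: \<kappa>1_def)
    then have "(2 - 2 * (real r * \<rho>) - 2 * \<eta> - 12 * (real r * \<rho>)) * N \<le> 4 * \<kappa>"
      unfolding \<kappa>_def by (simp add: algebra_simps)
    moreover have "(2 - 1 / real r + 1 / (3 * real r)) * N
      \<le> (2 - 2 * (real r * \<rho>) - 2 * \<eta> - 12 * (real r * \<rho>)) * N"
    proof (rule mult_right_mono)
      have "1 / (3 * real r) = 1 / 3 * (1 / real r)" "1 / (162 * real r) = 1 / 162 * (1 / real r)"
        "1 / (32 * real r) = 1 / 32 * (1 / real r)" by simp_all
      moreover have "0 < 1 / real r" using r1 by simp
      ultimately show "2 - 1 / real r + 1 / (3 * real r)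
        \<le> 2 - 2 * (real r * \<rho>) - 2 * \<eta> - 12 * (real r * \<rho>)"
        using \<eta>(3) unfolding \<rho>(2) by linarith
    qed (use N_pos in simp)
    ultimately show ?thesis by linarith
  qed
  have \<kappa>0: "0 < \<kappa>"
  proof -
    have "0 < 2 - 1 / real r + 1 / (3 * real r)" using r1 by (simp add: field_simps)
    then have "0 < (2 - 1 / real r + 1 / (3 * real r)) * N" using N_pos by simp
    then show ?thesis using \<kappa>4 by linarith
  qed
  \<comment> \<open>Writing \<open>1 - a\<close> as \<open>b - s\<close> isolates the negative term
    \<open>- b^2 * c\<close>, while \<open>s\<close> is the deviation of the merged vertex in
    \<open>Q u v\<close>.\<close>
  define s where "s = a + b - 1"
  have "\<kappa>1 * Q u v < gain u v"
    unfolding \<kappa>1_def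
  proof (rule Q_lt_gain[OF u(1) v])
    fix i assume "i \<in> V - {u}"
    from near[OF this] show "1 - \<rho> \<le> x i" by linarith
  qed (use \<rho> in auto)
  moreover have "Q u v = s\<^sup>2 + (\<Sum>i\<in>R. (y i)\<^sup>2)"
    by (simp add: Q_def R_def s_def a_def b_def y_def power2_commute[of _ 1] add.commute)
  moreover have "(\<Sum>i\<in>R. b * g i * y i + 3 * real r * \<rho> * N * (y i)\<^sup>2)
    = (\<Sum>i\<in>R. b * g i * y i) + 3 * real r * \<rho> * N * (\<Sum>i\<in>R. (y i)\<^sup>2)"
    by (simp add: sum.distrib sum_distrib_left)
  moreover have "\<kappa> * s\<^sup>2 \<le> \<kappa>1 * s\<^sup>2"
    using \<rho> N_pos unfolding \<kappa>_def by (intro mult_right_mono) auto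
  ultimately have key: "\<kappa> * s\<^sup>2 + \<kappa> * (\<Sum>i\<in>R. (y i)\<^sup>2) < - b * c * (b - s) + (\<Sum>i\<in>R. b * g i * y i)"
    using gain_le unfolding \<kappa>_def s_def by (simp add: algebra_simps)
  \<comment> \<open>The coefficient \<open>4 * \<kappa>\<^sup>2\<close> is chosen so that the terms
    in \<open>s\<close> and \<open>y i\<close> cancel exactly after \<open>key\<close> is multiplied
    by \<open>4 * \<kappa>\<close>; only multiples of \<open>b^2\<close> survive.\<close>
  have amgm: "4 * \<kappa> * (p * t) \<le> p\<^sup>2 + 4 * \<kappa>\<^sup>2 * t\<^sup>2" for p t
    using zero_le_power2[of "p - 2 * \<kappa> * t"] by (simp add: power2_eq_square algebra_simps)
  have "4 * \<kappa> * (\<kappa> * s\<^sup>2 + \<kappa> * (\<Sum>i\<in>R. (y i)\<^sup>2)) < 4 * \<kappa> * (- b * c * (b - s) + (\<Sum>i\<in>R. b * g i * y i))"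
    using key \<kappa>0 by simp
  moreover have "4 * \<kappa> * (\<Sum>i\<in>R. b * g i * y i) \<le> b\<^sup>2 * (\<Sum>i\<in>R. (g i)\<^sup>2) + 4 * \<kappa>\<^sup>2 * (\<Sum>i\<in>R. (y i)\<^sup>2)"
  proof -
    have "4 * \<kappa> * (\<Sum>i\<in>R. b * g i * y i) = (\<Sum>i\<in>R. 4 * \<kappa> * ((b * g i) * y i))"
      by (rule sum_distrib_left)
    also have "\<dots> \<le> (\<Sum>i\<in>R. (b * g i)\<^sup>2 + 4 * \<kappa>\<^sup>2 * (y i)\<^sup>2)" by (rule sum_mono[OF amgm])
    also have "\<dots> = b\<^sup>2 * (\<Sum>i\<in>R. (g i)\<^sup>2) + 4 * \<kappa>\<^sup>2 * (\<Sum>i\<in>R. (y i)\<^sup>2)"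
      by (simp add: sum.distrib sum_distrib_left power_mult_distrib)
    finally show ?thesis .
  qed
  moreover have "4 * \<kappa> * (b * c * s) \<le> b\<^sup>2 * c\<^sup>2 + 4 * \<kappa>\<^sup>2 * s\<^sup>2"
    using amgm[of "b * c" s] by (simp add: power_mult_distrib)
  ultimately have "4 * \<kappa> * (b\<^sup>2 * c) < b\<^sup>2 * c\<^sup>2 + b\<^sup>2 * (\<Sum>i\<in>R. (g i)\<^sup>2)"
    by (simp add: algebra_simps power2_eq_square)
  then have "b\<^sup>2 * (4 * \<kappa> * c) < b\<^sup>2 * (c\<^sup>2 + (\<Sum>i\<in>R. (g i)\<^sup>2))"
    by (simp add: algebra_simps)
  then have "4 * \<kappa> * c < c\<^sup>2 + (\<Sum>i\<in>R. (g i)\<^sup>2)"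
    using b by simp
  also have "\<dots> \<le> 4 * \<kappa> * c"
    using main mult_right_mono[OF \<kappa>4 c0] by linarith
  finally show False by simp
qed

end

section \<open>Choice of the threshold\<close>

lemma no_heavy_weighting:
  assumes "3 \<le> r"
  shows "\<exists>T0. \<forall>T\<ge>T0. \<forall>V (G :: 'a set set) x. \<not> heavy_weighting r T V G x"
proof -
  have r0: "0 < real r" using assms by simp
  \<comment> \<open>Chosen so that the accuracy \<open>3 * r * \<rho>\<close> of
    \<open>all_but_one_near_1\<close> is the tolerance of \<open>no_almost_uniform\<close>.\<close>
  define \<rho> where "\<rho> = 1 / (96 * real r ^ 3)"
  define p where "p = \<rho>\<^sup>2 / (2 * real r ^ 2 * (2 ^ r + real r + 1))"
  have \<rho>: "0 < \<rho>" "\<rho> \<le> 1 / 2" "3 * real r * \<rho> = 1 / (32 * real r ^ 2)"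
  proof -
    show "0 < \<rho>" using r0 by (simp add: \<rho>_def)
    have "1 \<le> real r ^ 3" using assms by (intro one_le_power) auto
    then have "2 \<le> 96 * real r ^ 3" by simp
    then show "\<rho> \<le> 1 / 2" unfolding \<rho>_def using r0 by (intro divide_left_mono) auto
    show "3 * real r * \<rho> = 1 / (32 * real r ^ 2)"
      using r0 by (simp add: \<rho>_def power2_eq_square power3_eq_cube)
  qed
  have p: "0 < p"
    unfolding p_def using \<rho> r0 by (intro divide_pos_pos mult_pos_pos add_pos_pos) auto
  \<comment> \<open>The lower bounds on \<open>T\<close> required by \<open>card_V\<close>, by the
    two smallness conditions on \<open>p\<close>, and by \<open>no_almost_uniform\<close>.\<close>
  define c1 c2 c3 c4 where "c1 = 30 * real r ^ 13 * 2 ^ r" and "c2 = 5 * real r ^ 6 / p"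
    and "c3 = (11 * real r ^ 6 / p) ^ 3 * real r / p" and "c4 = 18 * real r ^ 4"
  have c: "0 \<le> c1" "0 \<le> c2" "0 \<le> c3" "0 \<le> c4"
    using p by (simp_all add: c1_def c2_def c3_def c4_def)
  obtain T0 where T0: "c1 + c2 + c3 + c4 \<le> real T0" using real_arch_simple by blast
  show ?thesis
  proof (intro exI[of _ T0] allI impI notI)
    fix T V and G :: "'a set set" and x :: "'a \<Rightarrow> real"
    assume T: "T0 \<le> T" and "heavy_weighting r T V G x"
    then interpret heavy_weighting r T V G x by simp
    have "real T0 \<le> real T" using T by simp
    then have cT: "c1 \<le> real T" "c2 \<le> real T" "c3 \<le> real T" "c4 \<le> real T" using T0 c by linarith+
    have cV: "card V = T + 1" by (rule card_V) (use cT(1) in \<open>simp add: c1_def\<close>)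
    \<comment> \<open>Two applications of Pascal's rule to \<open>(T + 1) choose r\<close> leave
      exactly this number of missing sets.\<close>
    have "(T - 1) choose (r - 2) \<le> card (ksub r V - G)"
    proof -
      obtain k where k: "r = k + 2" using assms by (intro that[of "r - 2"]) simp
      obtain S where S: "T = Suc S" using Tpos(2) by (cases T) auto
      have "card (ksub r V - G) = card (ksub r V) - card G"
        using finG Gsub by (rule card_Diff_subset)
      also have "card (ksub r V) = (T + 1) choose r" using card_ksub[OF finV] cV by simp
      finally show ?thesis using Gcard by (simp add: k S)
    qed
    then obtain D where D: "D \<subseteq> ksub r V - G" "card D = (T - 1) choose (r - 2)"
      by (rule obtain_subset_with_card_n)
    interpret heavy_missing r T V G x D by unfold_locales (use cV D in auto)
    have "5 * real r ^ 6 / real T \<le> p"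
      using cT(2) p Tpos by (simp add: c2_def field_simps)
    moreover have "(11 * real r ^ 6 / p) ^ 3 * (real r / real T) \<le> p"
      using cT(3) p Tpos unfolding c3_def by (simp add: pos_divide_le_eq mult.commute)
    ultimately obtain u where u: "u \<in> V" "x u \<le> 3 * real r * \<rho>"
      "\<And>i. i \<in> V - {u} \<Longrightarrow> \<bar>x i - 1\<bar> \<le> 3 * real r * \<rho>"
      by (rule all_but_one_near_1[OF \<rho>(1,2), folded p_def]) blast
    show False
    proof (rule no_almost_uniform[OF _ u(1)])
      show "18 * real r ^ 4 \<le> real T" using cT(4) by (simp only: c4_def)
      show "x u \<le> 1 / (32 * real r ^ 2)" using u(2) by (simp only: \<rho>(3))
      show "\<bar>x i - 1\<bar> \<le> 1 / (32 * real r ^ 2)" if "i \<in> V - {u}" for i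
        using u(3)[OF that] by (simp only: \<rho>(3))
    qed
  qed
qed

lemma prod_scale: "finite e \<Longrightarrow> (\<Prod>i\<in>e. c * w i) = c ^ card e * prod w e"
  for c :: real
  by (simp add: prod.distrib)

section \<open>Existence of optimal weightings\<close>

text \<open>The points are functions on the whole type that vanish off \<open>U\<close>, so that the
  product topology on functions applies directly.\<close>

definition simplex_on :: "'a set \<Rightarrow> ('a \<Rightarrow> real) set" where
  "simplex_on U = {w. (\<forall>i. 0 \<le> w i) \<and> (\<forall>i. i \<notin> U \<longrightarrow> w i = 0) \<and> sum w U = 1}"

text \<open>Tychonoff's theorem for a product of unit intervals and single points, cut by a closed
  condition.\<close>

lemma compact_simplex_on:
  assumes "finite U"
  shows "compact (simplex_on U)"
proof -
  define B where "B = PiE UNIV (\<lambda>i. {0..if i \<in> U then 1 else 0 :: real})"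
  have "compactin (product_topology (\<lambda>i. euclidean) UNIV) B"
    unfolding B_def compactin_PiE by auto
  then have "compact B" by (simp add: euclidean_product_topology)
  moreover have "closed {w. sum w U = (1::real)}"
    by (intro closed_Collect_eq continuous_on_sum continuous_on_const continuous_on_product_coordinates)
  ultimately have "compact (B \<inter> {w. sum w U = 1})" by (rule compact_Int_closed)
  also have "B \<inter> {w. sum w U = 1} = simplex_on U"
  proof (intro set_eqI iffI)
    fix w assume w: "w \<in> B \<inter> {w. sum w U = 1}"
    then have bound: "w i \<in> {0..if i \<in> U then 1 else 0}" for i by (auto simp: B_def PiE_def Pi_def)
    have "0 \<le> w i" "i \<notin> U \<Longrightarrow> w i \<le> 0" for i using bound[of i] by (auto split: if_splits)
    with w show "w \<in> simplex_on U" by (auto simp: simplex_on_def intro: antisym)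
  next
    fix w assume w: "w \<in> simplex_on U"
    then have "w i \<le> 1" if "i \<in> U" for i
      using member_le_sum[of i U w] that assms by (auto simp: simplex_on_def)
    with w show "w \<in> B \<inter> {w. sum w U = 1}" by (auto simp: B_def simplex_on_def)
  qed
  finally show ?thesis .
qed

lemma simplex_on_attains_max:
  assumes "finite U" "U \<noteq> {}"
  obtains w where "w \<in> simplex_on U"
    "\<And>v. v \<in> simplex_on U \<Longrightarrow> (\<Sum>e\<in>G. prod v e) \<le> (\<Sum>e\<in>G. prod w e)"
proof -
  obtain j where "j \<in> U" using assms by blast
  then have "(\<lambda>i. if i = j then 1 else 0) \<in> simplex_on U"
    using assms by (auto simp: simplex_on_def)
  moreover have "continuous_on (simplex_on U) (\<lambda>w. \<Sum>e\<in>G. prod w e)"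
    by (intro continuous_on_sum continuous_on_prod continuous_on_subset[OF continuous_on_product_coordinates]) auto
  ultimately show ?thesis
    using continuous_attains_sup[OF compact_simplex_on[OF assms(1)]] that by blast
qed

text \<open>Lower the coordinate \<open>i\<close> by \<epsilon> and renormalise. To first order this
  changes the value by \<epsilon> times \<open>r * f - d\<close>, so at a maximum that quantity
  cannot be positive.\<close>

lemma simplex_on_critical:
  assumes fin: "finite U" "finite G" and G: "\<And>e. e \<in> G \<Longrightarrow> finite e" "\<And>e. e \<in> G \<Longrightarrow> card e = r"
    and r: "2 \<le> r" and w: "w \<in> simplex_on U"
    and max: "\<And>v. v \<in> simplex_on U \<Longrightarrow> (\<Sum>e\<in>G. prod v e) \<le> (\<Sum>e\<in>G. prod w e)"
    and i: "0 < w i"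
  shows "real r * (\<Sum>e\<in>G. prod w e) \<le> (\<Sum>e\<in>{e\<in>G. i \<in> e}. prod w (e - {i}))"
proof (rule ccontr)
  define f where "f = (\<Sum>e\<in>G. prod w e)"
  define d where "d = (\<Sum>e\<in>{e\<in>G. i \<in> e}. prod w (e - {i}))"
  define C where "C = real (r choose 2)"
  assume "\<not> ?thesis"
  then have less: "0 < real r * f - d" by (simp add: f_def d_def)
  have f0: "0 \<le> f" unfolding f_def using w by (intro sum_nonneg prod_nonneg) (auto simp: simplex_on_def)
  have iU: "i \<in> U" using w i by (auto simp: simplex_on_def)
  \<comment> \<open>The three bounds keep the new weight nonnegative, keep the renormalising factor
    away from 0, and make the second-order term smaller than the first-order gain. Adding 1 to
    \<open>f * C\<close> keeps the denominator positive and the last comparison strict.\<close>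
  define \<epsilon> where "\<epsilon> = min (w i) (min (1 / 2) ((real r * f - d) / (f * C + 1)))"
  have fC: "0 \<le> f * C" using f0 by (simp add: C_def)
  then have "0 < \<epsilon>" using i less by (simp add: \<epsilon>_def)
  moreover have "\<epsilon> \<le> w i" "\<epsilon> \<le> 1 / 2" "\<epsilon> \<le> (real r * f - d) / (f * C + 1)"
    unfolding \<epsilon>_def by linarith+
  ultimately have \<epsilon>: "0 < \<epsilon>" "\<epsilon> \<le> w i" "\<epsilon> \<le> 1 / 2" "\<epsilon> \<le> (real r * f - d) / (f * C + 1)" .
  define v where "v j = (if j = i then w i - \<epsilon> else w j)" for j
  define v' where "v' j = v j / (1 - \<epsilon>)" for j
  have sv: "sum v U = 1 - \<epsilon>"
  proof -
    have "sum v (U - {i}) = sum w (U - {i})" by (intro sum.cong) (auto simp: v_def)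
    then show ?thesis
      using w sum.remove[OF fin(1) iU, of v] sum.remove[OF fin(1) iU, of w] by (simp add: v_def simplex_on_def)
  qed
  have "v' \<in> simplex_on U"
    using w \<epsilon> sv iU by (auto simp: simplex_on_def v'_def v_def simp flip: sum_divide_distrib)
  then have "(\<Sum>e\<in>G. prod v' e) \<le> f" unfolding f_def by (rule max)
  moreover have "(\<Sum>e\<in>G. prod v e) = (1 - \<epsilon>) ^ r * (\<Sum>e\<in>G. prod v' e)"
  proof -
    have "prod v e = (1 - \<epsilon>) ^ r * prod v' e" if "e \<in> G" for e
      using G[OF that] \<epsilon>(3) prod_scale[of e "1 - \<epsilon>" v'] by (simp add: v'_def)
    then show ?thesis by (simp add: sum_distrib_left)
  qed
  moreover have "(\<Sum>e\<in>G. prod v e) = f - \<epsilon> * d"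
  proof -
    have "prod v e = prod w e - (if i \<in> e then \<epsilon> * prod w (e - {i}) else 0)" if e: "e \<in> G" for e
    proof (cases "i \<in> e")
      case True
      have "prod v (e - {i}) = prod w (e - {i})" by (intro prod.cong) (auto simp: v_def)
      then have "prod v e = (w i - \<epsilon>) * prod w (e - {i})" "prod w e = w i * prod w (e - {i})"
        using prod.remove[OF G(1)[OF e] True, of v] prod.remove[OF G(1)[OF e] True, of w] by (simp_all add: v_def)
      then show ?thesis using True by (simp add: algebra_simps)
    next
      case False
      then have "prod v e = prod w e" by (intro prod.cong) (auto simp: v_def)
      then show ?thesis using False by simp
    qed
    then have "(\<Sum>e\<in>G. prod v e) = f - (\<Sum>e\<in>G. if i \<in> e then \<epsilon> * prod w (e - {i}) else 0)"
      by (simp add: f_def sum_subtractf)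
    also have "(\<Sum>e\<in>G. if i \<in> e then \<epsilon> * prod w (e - {i}) else 0) = \<epsilon> * d"
      unfolding d_def sum_distrib_left by (rule sum.inter_filter[OF fin(2), symmetric])
    finally show ?thesis .
  qed
  ultimately have "f - \<epsilon> * d \<le> (1 - \<epsilon>) ^ r * f"
    using \<epsilon>(3) by (simp add: mult_left_mono)
  moreover have "r - 2 + 2 = r" using r by simp
  then have "(1 - \<epsilon>) ^ r \<le> 1 - real r * \<epsilon> + C * \<epsilon>\<^sup>2"
    using power_diff_le_quadratic[of \<epsilon> 1 "r - 2"] \<epsilon> unfolding C_def by simp
  then have "(1 - \<epsilon>) ^ r * f \<le> (1 - real r * \<epsilon> + C * \<epsilon>\<^sup>2) * f" using f0 by (rule mult_right_mono)
  ultimately have "\<epsilon> * (real r * f - d) \<le> \<epsilon> * (f * C * \<epsilon>)"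
    by (simp add: algebra_simps power2_eq_square)
  then have "real r * f - d \<le> f * C * \<epsilon>" using \<epsilon> by simp
  also have "\<dots> < (f * C + 1) * \<epsilon>" using \<epsilon> by (simp add: algebra_simps)
  also have "\<dots> \<le> real r * f - d" using \<epsilon>(4) fC by (simp add: pos_le_divide_eq mult.commute)
  finally show False by simp
qed

text \<open>A maximiser that beats the clique yields a \<open>heavy_weighting\<close> when it is
  restricted to its support, together with the edges inside it, and scaled to total weight
  \<open>T\<close>.\<close>

lemma max_weight_le:
  assumes r: "3 \<le> r" and rT: "2 * r \<le> T" and none: "\<And>V G x. \<not> heavy_weighting r T V (G :: 'a set set) x"
    and U: "finite U" "(G :: 'a set set) \<subseteq> ksub r U"
    and cG: "card G \<le> (T choose r) + ((T - 1) choose (r - 1))"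
    and w: "w \<in> simplex_on U"
  shows "(\<Sum>e\<in>G. prod w e) \<le> real (T choose r) / real T ^ r"
proof -
  have T: "0 < real T" using r rT by simp
  have "U \<noteq> {}" using w by (auto simp: simplex_on_def)
  then obtain z where z: "z \<in> simplex_on U"
    "\<And>v. v \<in> simplex_on U \<Longrightarrow> (\<Sum>e\<in>G. prod v e) \<le> (\<Sum>e\<in>G. prod z e)"
    using simplex_on_attains_max[OF U(1)] by blast
  have finG: "finite G" by (rule finite_subset[OF U(2) finite_ksub[OF U(1)]])
  have edge: "finite e" "card e = r" "e \<subseteq> U" if "e \<in> G" for e
  proof -
    have "e \<in> ksub r U" using that U(2) by blast
    then show "card e = r" "e \<subseteq> U" by (simp_all add: ksub_def)
    then show "finite e" using U(1) by (blast intro: finite_subset)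
  qed
  have z0: "0 \<le> z i" for i using z(1) by (simp add: simplex_on_def)
  define V where "V = {i\<in>U. 0 < z i}"
  define G' where "G' = {e\<in>G. e \<subseteq> V}"
  define x where "x i = real T * z i" for i
  have zV: "z i = 0" if "i \<notin> V" for i
    using that z(1) z0[of i] by (cases "i \<in> U") (auto simp: V_def simplex_on_def)
  have outside: "prod z f = 0" if "f \<subseteq> U" "\<not> f \<subseteq> V" for f
  proof -
    have "finite f" by (rule finite_subset[OF that(1) U(1)])
    moreover have "\<exists>j\<in>f. z j = 0" using that(2) zV by blast
    ultimately show ?thesis by (rule prod_zero)
  qed
  have W: "(\<Sum>e\<in>G'. prod z e) = (\<Sum>e\<in>G. prod z e)"
    using finG outside edge(3) by (intro sum.mono_neutral_left) (auto simp: G'_def)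
  have scale: "prod x e = real T ^ card e * prod z e" if "finite e" for e
    unfolding x_def by (rule prod_scale[OF that])
  have Wx: "(\<Sum>e\<in>G'. prod x e) = real T ^ r * (\<Sum>e\<in>G. prod z e)"
    unfolding W[symmetric] sum_distrib_left using edge scale by (intro sum.cong) (auto simp: G'_def)
  have link: "(\<Sum>e\<in>{e\<in>G'. i \<in> e}. prod x (e - {i})) = real T ^ (r - 1) * (\<Sum>e\<in>{e\<in>G. i \<in> e}. prod z (e - {i}))"
    if "i \<in> V" for i
  proof -
    have "(\<Sum>e\<in>{e\<in>G'. i \<in> e}. prod x (e - {i})) = (\<Sum>e\<in>{e\<in>G'. i \<in> e}. real T ^ (r - 1) * prod z (e - {i}))"
      using edge scale by (intro sum.cong) (auto simp: G'_def)
    also have "\<dots> = real T ^ (r - 1) * (\<Sum>e\<in>{e\<in>G'. i \<in> e}. prod z (e - {i}))"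
      by (rule sum_distrib_left[symmetric])
    \<comment> \<open>An edge through \<open>i\<close> that leaves \<open>V\<close> has a vertex of
      weight 0 other than \<open>i\<close>, as \<open>i\<close> lies in \<open>V\<close>; its link
      product therefore vanishes.\<close>
    also have "(\<Sum>e\<in>{e\<in>G'. i \<in> e}. prod z (e - {i})) = (\<Sum>e\<in>{e\<in>G. i \<in> e}. prod z (e - {i}))"
    proof (rule sum.mono_neutral_left)
      show "\<forall>e\<in>{e\<in>G. i \<in> e} - {e\<in>G'. i \<in> e}. prod z (e - {i}) = 0"
        using edge(3) that by (intro ballI outside) (auto simp: G'_def)
    qed (use finG in \<open>auto simp: G'_def\<close>)
    finally show ?thesis .
  qed
  have "(\<Sum>e\<in>G. prod z e) \<le> real (T choose r) / real T ^ r"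
  proof (rule ccontr)
    assume "\<not> ?thesis"
    then have big: "real (T choose r) < real T ^ r * (\<Sum>e\<in>G. prod z e)"
      using T by (simp add: not_le pos_divide_less_eq mult.commute)
    have "heavy_weighting r T V G' x"
    proof
      show "3 \<le> r" "2 * r \<le> T" by fact+
      show "finite V" using U by (simp add: V_def)
      show "0 < x i" if "i \<in> V" for i using that T by (simp add: x_def V_def)
      have "sum z V = sum z U"
        by (rule sum.mono_neutral_left[OF U(1)]) (simp_all add: zV, simp add: V_def)
      then have "sum z V = 1" using z(1) by (simp add: simplex_on_def)
      then show "sum x V = real T" unfolding x_def sum_distrib_left[symmetric] by simp
      show "G' \<subseteq> ksub r V" unfolding G'_def ksub_def using edge(2) by blast
      have "card G' \<le> card G" using finG by (intro card_mono) (auto simp: G'_def)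
      then show "card G' \<le> (T choose r) + ((T - 1) choose (r - 1))" using cG by simp
      show "real (T choose r) < (\<Sum>e\<in>G'. prod x e)" unfolding Wx by (rule big)
      fix i assume i: "i \<in> V"
      have "real r * (\<Sum>e\<in>G. prod z e) \<le> (\<Sum>e\<in>{e\<in>G. i \<in> e}. prod z (e - {i}))"
        by (rule simplex_on_critical[OF U(1) finG edge(1,2) _ z]) (use r i in \<open>auto simp: V_def\<close>)
      then have "real T ^ r * (real r * (\<Sum>e\<in>G. prod z e)) \<le> real T ^ r * (\<Sum>e\<in>{e\<in>G. i \<in> e}. prod z (e - {i}))"
        by (intro mult_left_mono) auto
      also have "\<dots> = real T * (real T ^ (r - 1) * (\<Sum>e\<in>{e\<in>G. i \<in> e}. prod z (e - {i})))"
        using r by (cases r) (auto simp: mult_ac)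
      finally show "real r * (\<Sum>e\<in>G'. prod x e) \<le> real T * (\<Sum>e\<in>{e\<in>G'. i \<in> e}. prod x (e - {i}))"
        unfolding Wx link[OF i] by (simp only: mult.left_commute)
    qed
    with none[of V G' x] show False by contradiction
  qed
  then show ?thesis using z(2)[OF w] by linarith
qed

section \<open>Colex graphs and the main theorem\<close>

lemma colex_val_ge: "finite B \<Longrightarrow> j \<in> B \<Longrightarrow> 2 ^ j \<le> colex_val B"
  unfolding colex_val_def using member_le_sum[of j B "\<lambda>i. 2 ^ i :: nat"] by simp

lemma colex_val_less: "A \<subseteq> {1..k} \<Longrightarrow> colex_val A < 2 ^ Suc k"
proof -
  assume A: "A \<subseteq> {1..k}"
  have "colex_val A \<le> (\<Sum>i\<in>{0..<Suc k}. 2 ^ i)"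
    unfolding colex_val_def using A by (intro sum_mono2) auto
  also have "\<dots> < 2 ^ Suc k" using sum_power2[of "Suc k"] by simp
  finally show ?thesis .
qed

text \<open>Needed to compare ranks by \<open>card_mono\<close>, since \<open>card\<close> is 0 on
  infinite sets. Elements of a predecessor are below its colex value because
  \<open>j < 2^j\<close>.\<close>

lemma finite_colex_predecessors: "finite {B \<in> r_sets r. colex_less B A}"
proof (rule finite_subset)
  show "{B \<in> r_sets r. colex_less B A} \<subseteq> Pow {..<colex_val A}"
  proof (intro subsetI PowI)
    fix B j assume B: "B \<in> {B \<in> r_sets r. colex_less B A}" and j: "j \<in> B"
    have "j < 2 ^ j" by (rule less_exp)
    also have "2 ^ j \<le> colex_val B" using B j by (intro colex_val_ge) (auto simp: r_sets_def)
    also have "\<dots> < colex_val A" using B by (simp add: colex_less_def)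
    finally show "j \<in> {..<colex_val A}" by simp
  qed
qed simp

lemma less_choose: "0 < r \<Longrightarrow> m < (m + r) choose r"
proof (induction m)
  case (Suc m)
  then obtain k where k: "r = Suc k" by (cases r) auto
  have "0 < Suc (m + k) choose k" by simp
  moreover have "(Suc m + r) choose r = (Suc (m + k) choose k) + ((m + r) choose r)"
    by (simp add: k)
  ultimately show ?case using Suc.IH[OF Suc.prems] by linarith
qed simp

text \<open>A set with an element above \<open>m + r\<close> is preceded by all
  \<open>r\<close>-subsets of \<open>{1..m + r}\<close>, of which there are more than
  \<open>m\<close>.\<close>

lemma finite_colex_graph:
  assumes "0 < r"
  shows "finite (colex_graph m r)"
proof (rule finite_subset)
  show "colex_graph m r \<subseteq> Pow {..m + r}"
  proof (intro subsetI PowI, rule ccontr)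
    fix A j assume A: "A \<in> colex_graph m r" and j: "j \<in> A" and "j \<notin> {..m + r}"
    then have jm: "m + r < j" by simp
    have "ksub r {1..m + r} \<subseteq> {B \<in> r_sets r. colex_less B A}"
    proof
      fix B assume B: "B \<in> ksub r {1..m + r}"
      then have Bs: "B \<subseteq> {1..m + r}" "card B = r" by (auto simp: ksub_def)
      have "colex_val B < 2 ^ Suc (m + r)" by (rule colex_val_less[OF Bs(1)])
      also have "\<dots> \<le> 2 ^ j" using jm by (intro power_increasing) auto
      also have "\<dots> \<le> colex_val A"
        using A j by (intro colex_val_ge) (auto simp: colex_graph_def r_sets_def)
      finally show "B \<in> {B \<in> r_sets r. colex_less B A}"
        using Bs finite_subset[OF Bs(1)] by (auto simp: r_sets_def colex_less_def)
    qed
    then have "card (ksub r {1..m + r}) \<le> card {B \<in> r_sets r. colex_less B A}"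
      by (rule card_mono[OF finite_colex_predecessors])
    moreover have "card {B \<in> r_sets r. colex_less B A} < m"
      using A by (simp add: colex_graph_def)
    moreover have "m < card (ksub r {1..m + r})"
      using less_choose[OF assms, of m] by (simp add: card_ksub)
    ultimately show False by linarith
  qed
qed simp

text \<open>The \<open>r\<close>-subsets of \<open>{1..T}\<close> form an initial segment of the
  colex order, because every set with an element above \<open>T\<close> has a larger value.\<close>

lemma clique_subset_colex_graph:
  assumes "T choose r \<le> m"
  shows "ksub r {1..T} \<subseteq> colex_graph m r"
proof
  fix A assume A: "A \<in> ksub r {1..T}"
  then have A': "A \<subseteq> {1..T}" "card A = r" by (simp_all add: ksub_def)
  then have A_r: "A \<in> r_sets r" using finite_subset[OF A'(1)] by (auto simp: r_sets_def)
  have "{B \<in> r_sets r. colex_less B A} \<subseteq> ksub r {1..T} - {A}"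
  proof
    fix B assume B: "B \<in> {B \<in> r_sets r. colex_less B A}"
    have "j \<le> T" if "j \<in> B" for j
    proof -
      have "(2::nat) ^ j \<le> colex_val B" using B that by (intro colex_val_ge) (auto simp: r_sets_def)
      also have "\<dots> < 2 ^ Suc T"
        using B colex_val_less[OF A'(1)] by (simp add: colex_less_def)
      finally show ?thesis using power_less_imp_less_exp[of "2::nat" j "Suc T"] by simp
    qed
    then show "B \<in> ksub r {1..T} - {A}"
      using B by (auto simp: ksub_def r_sets_def colex_less_def)
  qed
  then have "card {B \<in> r_sets r. colex_less B A} \<le> card (ksub r {1..T} - {A})"
    by (intro card_mono) auto
  also have "\<dots> < card (ksub r {1..T})" using A by (intro psubset_card_mono) auto
  also have "\<dots> \<le> m" using assms by (simp add: card_ksub)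
  finally show "A \<in> colex_graph m r" using A_r by (simp add: colex_graph_def)
qed

section \<open>Weightings and Lagrangians\<close>

lemma weighting_nonneg: "weighting w \<Longrightarrow> 1 \<le> i \<Longrightarrow> 0 \<le> w i"
  by (simp add: weighting_def)

lemma weighting_sum_le_1:
  assumes "weighting w" "finite B" "B \<subseteq> {1..}"
  shows "sum w B \<le> 1"
  using assms by (intro finite_sum_le_has_sum[where f = w and A = "{1..}"]) (auto simp: weighting_def)

lemma weighting_le_1: "weighting w \<Longrightarrow> 1 \<le> i \<Longrightarrow> w i \<le> 1"
  using weighting_sum_le_1[of w "{i}"] by simp

lemma weight_graph_bounded:
  assumes "\<And>e. e \<in> G \<Longrightarrow> e \<subseteq> {1..}" "weighting w"
  shows "weight_graph w G \<le> real (card G)"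
proof -
  have "weight_edge w e \<le> 1" if "e \<in> G" for e
    unfolding weight_edge_def using assms(1)[OF that] assms(2)
    by (intro prod_le_1) (auto intro!: weighting_nonneg weighting_le_1)
  then have "(\<Sum>e\<in>G. weight_edge w e) \<le> (\<Sum>e\<in>G. 1)" by (rule sum_mono)
  then show ?thesis by (simp add: weight_graph_def)
qed

definition uniform :: "nat \<Rightarrow> nat \<Rightarrow> real" where
  "uniform T i = (if i \<in> {1..T} then 1 / real T else 0)"

lemma weighting_uniform: "0 < T \<Longrightarrow> weighting (uniform T)"
  unfolding weighting_def
proof (intro conjI allI impI)
  assume "0 < T"
  then show "(uniform T has_sum 1) {1..}"
    by (intro has_sum_finite_neutralI[where B = "{1..T}"]) (auto simp: uniform_def)
qed (simp add: uniform_def)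

lemma lagrangian_colex_ge:
  assumes "0 < r" "0 < T" "T choose r \<le> m"
  shows "real (T choose r) / real T ^ r \<le> lagrangian (colex_graph m r)"
proof -
  have edges: "e \<subseteq> {1..}" if "e \<in> colex_graph m r" for e
    using that by (auto simp: colex_graph_def r_sets_def)
  have "weight_edge (uniform T) e = (1 / real T) ^ r" if "e \<in> ksub r {1..T}" for e
  proof -
    have "weight_edge (uniform T) e = (\<Prod>i\<in>e. 1 / real T)"
      unfolding weight_edge_def using that by (intro prod.cong) (auto simp: ksub_def uniform_def)
    then show ?thesis using that by (simp add: ksub_def power_one_over)
  qed
  then have "real (T choose r) / real T ^ r = (\<Sum>e\<in>ksub r {1..T}. weight_edge (uniform T) e)"
    by (simp add: card_ksub power_one_over)
  also have "\<dots> \<le> weight_graph (uniform T) (colex_graph m r)"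
    unfolding weight_graph_def weight_edge_def
    using finite_colex_graph[OF assms(1)] clique_subset_colex_graph[OF assms(3)]
    by (intro sum_mono2 prod_nonneg) (auto simp: uniform_def)
  also have "\<dots> \<le> lagrangian (colex_graph m r)"
    unfolding lagrangian_def
  proof (rule cSup_upper)
    show "weight_graph (uniform T) (colex_graph m r) \<in> {weight_graph w (colex_graph m r) |w. weighting w}"
      using weighting_uniform[OF assms(2)] by blast
    show "bdd_above {weight_graph w (colex_graph m r) |w. weighting w}"
      using weight_graph_bounded[OF edges] by (auto intro!: bdd_aboveI)
  qed
  finally show ?thesis .
qed

text \<open>A weighting may have infinite support and put mass outside the vertices of
  \<open>G\<close>. Restricting it to those vertices and rescaling the remaining mass
  \<open>s \<le> 1\<close> to 1 divides the weight of \<open>G\<close> by \<open>s^r\<close>, so it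
  cannot decrease.\<close>

lemma weight_graph_le:
  assumes r: "3 \<le> r" "2 * r \<le> T" and none: "\<And>V G x. \<not> heavy_weighting r T V (G :: nat set set) x"
    and G: "r_graph r G" and cG: "card G \<le> (T choose r) + ((T - 1) choose (r - 1))"
    and w: "weighting w"
  shows "weight_graph w G \<le> real (T choose r) / real T ^ r"
proof -
  define U where "U = \<Union> G"
  define s where "s = sum w U"
  have U: "finite U" "G \<subseteq> ksub r U" "U \<subseteq> {1..}"
    using G by (auto simp: r_graph_def U_def ksub_def)
  have w0: "0 \<le> w i" if "i \<in> U" for i using that U(3) by (intro weighting_nonneg[OF w]) auto
  have s: "0 \<le> s" "s \<le> 1"
    unfolding s_def using w0 U by (auto intro!: sum_nonneg weighting_sum_le_1[OF w])
  have edge: "finite e" "card e = r" "e \<subseteq> U" if "e \<in> G" for e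
    using that G by (auto simp: r_graph_def U_def)
  define v where "v i = (if i \<in> U then w i / s else 0)" for i
  have scale: "weight_graph w G = s ^ r * (\<Sum>e\<in>G. prod v e)" if "s \<noteq> 0"
  proof -
    have "prod w e = s ^ r * prod v e" if e: "e \<in> G" for e
    proof -
      have "prod w e = (\<Prod>i\<in>e. s * v i)"
        using edge(3)[OF e] \<open>s \<noteq> 0\<close> by (intro prod.cong) (auto simp: v_def)
      then show ?thesis using prod_scale[OF edge(1)[OF e], of s v] edge(2)[OF e] by simp
    qed
    then show ?thesis by (simp add: weight_graph_def weight_edge_def sum_distrib_left)
  qed
  show ?thesis
  \<comment> \<open>For \<open>s = 0\<close> the rescaled \<open>v\<close> is identically 0 by
    division by zero and lies outside the simplex; every edge then has weight 0.\<close>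
  proof (cases "s = 0")
    case True
    then have wU: "w i = 0" if "i \<in> U" for i
      using that w0 sum_nonneg_eq_0_iff[OF U(1), of w] by (auto simp: s_def)
    have "weight_edge w e = 0" if "e \<in> G" for e
    proof -
      have "e \<noteq> {}" using edge[OF that] r by auto
      then show ?thesis
        unfolding weight_edge_def using edge(1,3)[OF that] wU by (intro prod_zero) auto
    qed
    then show ?thesis by (simp add: weight_graph_def)
  next
    case False
    then have "0 < s" using s by simp
    have "sum v U = sum w U / s"
      unfolding sum_divide_distrib by (intro sum.cong) (simp_all add: v_def)
    then have "sum v U = 1" using \<open>0 < s\<close> by (simp add: s_def)
    then have "v \<in> simplex_on U"
      using w0 s(1) by (simp add: simplex_on_def v_def)
    then have le: "(\<Sum>e\<in>G. prod v e) \<le> real (T choose r) / real T ^ r"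
      by (rule max_weight_le[OF r none U(1,2) cG])
    have v0: "0 \<le> (\<Sum>e\<in>G. prod v e)"
      using w0 s by (intro sum_nonneg prod_nonneg) (auto simp: v_def)
    have "s ^ r \<le> 1" using s by (intro power_le_one)
    then have "weight_graph w G \<le> 1 * (\<Sum>e\<in>G. prod v e)"
      unfolding scale[OF False] using v0 by (rule mult_right_mono)
    then show ?thesis using le by simp
  qed
qed

theorem theorem1p2:
  fixes r :: nat
  assumes "r \<ge> 3"
  shows "\<exists>t0::nat. \<forall>t m. t \<ge> t0 \<and> (t - 1) choose r \<le> m
            \<and> m \<le> (t choose r) - ((t - 2) choose (r - 2)) \<longrightarrow>
          (\<forall>G. r_graph r G \<and> card G = m \<longrightarrow> lagrangian G \<le> lagrangian (colex_graph m r))"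
proof -
  obtain T0 where "\<forall>T\<ge>T0. \<forall>V (G :: nat set set) x. \<not> heavy_weighting r T V G x"
    using no_heavy_weighting[OF assms] ..
  then have T0: "\<not> heavy_weighting r T V G x" if "T0 \<le> T" for T V x and G :: "nat set set"
    using that by simp
  show ?thesis
  proof (intro exI[of _ "T0 + 2 * r + 1"] allI impI, elim conjE)
    fix t m G
    assume t: "T0 + 2 * r + 1 \<le> t" and m: "(t - 1) choose r \<le> m" "m \<le> (t choose r) - ((t - 2) choose (r - 2))"
      and G: "r_graph r G" "card G = m"
    define T where "T = t - 1"
    have T: "t = T + 1" "T0 \<le> T" "2 * r \<le> T" using t by (auto simp: T_def)
    \<comment> \<open>Pascal's rule twice with \<open>t = T + 1\<close>; substituting successors
      makes the truncated subtraction exact.\<close>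
    have "(t choose r) - ((t - 2) choose (r - 2)) = (T choose r) + ((T - 1) choose (r - 1))"
    proof -
      obtain k where k: "r = Suc (Suc k)"
        using assms by (intro that[of "r - 2"]) simp
      obtain S where S: "T = Suc S" using T(3) k by (cases T) auto
      show ?thesis unfolding T(1) k S by simp
    qed
    then have cG: "card G \<le> (T choose r) + ((T - 1) choose (r - 1))" using m(2) G(2) by simp
    have "lagrangian G \<le> real (T choose r) / real T ^ r"
      unfolding lagrangian_def
    proof (rule cSup_least)
      show "{weight_graph w G |w. weighting w} \<noteq> {}"
        using weighting_uniform[of 1] by auto
      fix y assume "y \<in> {weight_graph w G |w. weighting w}"
      then obtain w where y: "y = weight_graph w G" and w: "weighting w" by blast
      show "y \<le> real (T choose r) / real T ^ r"
        unfolding y by (rule weight_graph_le[OF assms T(3) T0[OF T(2)] G(1) cG w])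
    qed
    also have "\<dots> \<le> lagrangian (colex_graph m r)"
      by (rule lagrangian_colex_ge) (use assms T(3) m(1) in \<open>simp_all add: T_def\<close>)
    finally show "lagrangian G \<le> lagrangian (colex_graph m r)" .
  qed
qed

end
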